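(* Let $N\ge1$. The non-zero blocks in a canonical form of the defining matrix of the associated quasipolynomial algebra $\overline{F_q(N)}$ are the same as the non-zero blocks in a canonical form of the defining matrix of $\mathcal L^N_{\downarrow}$. If $q$ is a primitive $m$th root of unity with $m$ odd, then the degree of $F_q(N)$ is equal to $m^{N-1}$.
   Context: $F_q(N)$ is the associative unital $\mathbb C$-algebra generated by $z_0,\dots,z_{N-1},z_0^*,\dots,z_{N-1}^*$ subject to $z_iz_j=q^{-1}z_jz_i$ for $i<j$; $z_i^*z_j^*=q\,z_j^*z_i^*$ for $i<j$; $z_iz_j^*=q^{-1}z_j^*z_i$ for $i\neq j$; $z_iz_i^*-z_i^*z_i=(q^2-1)\sum_{k>i}z_kz_k^*$. The associated quasipolynomial algebra $\overline{F_q(N)}$ has generators $\bar z_i,\bar z_i^*$ ($0\le i\le N-1$) and the same relations except that the last one is replaced by $\bar z_i\bar z_i^*=\bar z_i^*\bar z_i$. A quasipolynomial algebra is given by generators $x_1,\dots,x_n$ and relations $x_ix_j=q^{h_{ij}}x_jx_i$, where $H=(h_{ij})$ is a skew-symmetric integer matrix, called its defining matrix. A canonical form of $H$ is a block diagonal matrix $WHW^t$, with $W\in SL_n(\mathbb Z)$, whose diagonal blocks are $2\times2$ blocks $S(d)=\begin{pmatrix}0&-d\\d&0\end{pmatrix}$, $d\in\mathbb Z$, together with a $1\times1$ zero block if $n$ is odd; generators may be reordered. $\mathcal L^N_\downarrow$ is the quasipolynomial algebra with generators $z_1,\dots,z_N,\Omega_1,\dots,\Omega_{N-1}$ and relations $z_az_b=q^{-1}z_bz_a$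 for $a<b$; $\Omega_j\Omega_k=\Omega_k\Omega_j$; $\Omega_jz_a=q^2z_a\Omega_j$ if $a\le j$; $\Omega_jz_a=z_a\Omega_j$ if $a>j$. The degree of $F_q(N)$ at a root of unity (where it is a domain, finite over its center) is the square root of the dimension of its division ring of fractions over the center of that division ring; equivalently, the maximal dimension of its irreducible representations. *)

theory Defs
  imports
    "HOL-Algebra.Algebraic_Closure_Type"
    "HOL-Algebra.Embedded_Algebras"
    "HOL-Algebra.QuotRing"
    "HOL-Library.Poly_Mapping"
    "HOL-Library.Multiset"
    "HOL-Combinatorics.Permutations"
    "Jordan_Normal_Form.Determinant"
begin

section \<open>Algebras given by generators and relations\<close>

text \<open>
  The free monoid is written additively, because the product on \<^typ>\<open>'m \<Rightarrow>\<^sub>0 complex\<close> is the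
  convolution over the additive monoid \<^typ>\<open>'m\<close>. So \<open>'g free_monoid \<Rightarrow>\<^sub>0 complex\<close> is
  the free associative unital algebra on all letters of type \<open>'g\<close>.
\<close>

datatype 'g free_monoid = Monomial (letters: "'g list")

instantiation free_monoid :: (type) monoid_add
begin

definition zero_free_monoid :: "'a free_monoid" where
  "0 = Monomial []"

definition plus_free_monoid :: "'a free_monoid \<Rightarrow> 'a free_monoid \<Rightarrow> 'a free_monoid" where
  "u + v = Monomial (letters u @ letters v)"

instance
  by standard (simp_all add: zero_free_monoid_def plus_free_monoid_def)

end

type_synonym 'g free_poly = "'g free_monoid \<Rightarrow>\<^sub>0 complex"

definition var :: "'g \<Rightarrow> 'g free_poly" where
  "var x = Poly_Mapping.single (Monomial [x]) 1"

definition scalar :: "complex \<Rightarrow> 'g free_poly" where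
  "scalar c = Poly_Mapping.single 0 c"

definition free_algebra :: "'g set \<Rightarrow> 'g free_poly ring" where
  "free_algebra S =
     ring_of_type_algebra\<lparr>carrier := {p. \<forall>w\<in>Poly_Mapping.keys p. set (letters w) \<subseteq> S}\<rparr>"

text \<open>
  In \<^theory>\<open>HOL-Algebra.Ideal\<close> ideals are two-sided. The relations are the elements of \<open>R\<close>, each
  set equal to zero.
\<close>

definition presented_algebra :: "'g set \<Rightarrow> 'g free_poly set \<Rightarrow> 'g free_poly set ring" where
  "presented_algebra S R = free_algebra S Quot (genideal (free_algebra S) R)"


section \<open>Quasipolynomial algebras, their defining matrices and canonical forms\<close>

text \<open>A triple \<open>(x, y, h)\<close> stands for the relation \<open>x y = q\<^sup>h y x\<close>.\<close>

type_synonym 'g qrel = "'g \<times> 'g \<times> int"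

fun qrel_poly :: "complex \<Rightarrow> 'g qrel \<Rightarrow> 'g free_poly" where
  "qrel_poly q (x, y, h) = var x * var y - scalar (q powi h) * var y * var x"

text \<open>
  A quasipolynomial algebra is presented by the list \<open>xs\<close> of its generators and relations \<open>R\<close> which
  give exactly one exponent for each pair of distinct generators, in at least one of the two orders.
  The exponents in the opposite order and on the diagonal are those forced by skew-symmetry.
\<close>

definition defining_matrix :: "'g list \<Rightarrow> 'g qrel set \<Rightarrow> int mat" where
  "defining_matrix xs R = mat (length xs) (length xs) (\<lambda>(i, j).
     (THE h. (xs ! i, xs ! j, h) \<in> R \<or> (xs ! j, xs ! i, - h) \<in> R \<or> (i = j \<and> h = 0)))"

definition skew_block :: "int \<Rightarrow> int mat" where
  "skew_block d = mat_of_rows_list 2 [[0, - d], [d, 0]]"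

definition canonical_matrix :: "nat \<Rightarrow> int list \<Rightarrow> int mat" where
  "canonical_matrix n ds =
     diag_block_mat (map skew_block ds @ (if odd n then [0\<^sub>m 1 1] else []))"

text \<open>
  \<open>canonical_form H ds\<close>: the diagonal blocks \<open>S(d)\<close>, for \<open>d\<close> in \<open>ds\<close>, make up a canonical form of
  \<open>H\<close>. The permutation \<open>\<sigma>\<close> is the reordering of the generators. No divisibility between
  the \<open>d\<close>'s is required, so a canonical form is not unique.
\<close>

definition canonical_form :: "int mat \<Rightarrow> int list \<Rightarrow> bool" where
  "canonical_form H ds \<longleftrightarrow>
     (let n = dim_row H in
      length ds = n div 2 \<and>
      (\<exists>\<sigma> W. \<sigma> permutes {..<n} \<and> W \<in> carrier_mat n n \<and> det W = 1 \<and>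
         W * mat n n (\<lambda>(i, j). H $$ (\<sigma> i, \<sigma> j)) * transpose_mat W = canonical_matrix n ds))"

definition nonzero_blocks :: "int mat \<Rightarrow> int multiset set" where
  "nonzero_blocks H = {filter_mset (\<lambda>d. d \<noteq> 0) (mset ds) | ds. canonical_form H ds}"


section \<open>The algebras \<open>F\<^sub>q(N)\<close>, its associated quasipolynomial algebra, and \<open>L\<close>\<close>

text \<open>\<open>Zs i\<close> is the generator \<open>z\<^sub>i\<^sup>*\<close>.\<close>

datatype F_gen = Z nat | Zs nat

definition F_gens :: "nat \<Rightarrow> F_gen list" where
  "F_gens N = map Z [0..<N] @ map Zs [0..<N]"

definition F_common_rels :: "nat \<Rightarrow> F_gen qrel set" where
  "F_common_rels N =
     {(Z i, Z j, -1) | i j. i < j \<and> j < N} \<union>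
     {(Zs i, Zs j, 1) | i j. i < j \<and> j < N} \<union>
     {(Z i, Zs j, -1) | i j. i \<noteq> j \<and> i < N \<and> j < N}"

definition F_algebra :: "complex \<Rightarrow> nat \<Rightarrow> F_gen free_poly set ring" where
  "F_algebra q N = presented_algebra (set (F_gens N))
     (qrel_poly q ` F_common_rels N \<union>
      {var (Z i) * var (Zs i) - var (Zs i) * var (Z i)
         - scalar (q\<^sup>2 - 1) * (\<Sum>k\<in>{i<..<N}. var (Z k) * var (Zs k)) | i. i < N})"

definition Fbar_rels :: "nat \<Rightarrow> F_gen qrel set" where
  "Fbar_rels N = F_common_rels N \<union> {(Z i, Zs i, 0) | i. i < N}"

definition Fbar_matrix :: "nat \<Rightarrow> int mat" where
  "Fbar_matrix N = defining_matrix (F_gens N) (Fbar_rels N)"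

datatype L_gen = LZ nat | LOmega nat

definition L_gens :: "nat \<Rightarrow> L_gen list" where
  "L_gens N = map LZ [1..<N + 1] @ map LOmega [1..<N]"

definition L_rels :: "nat \<Rightarrow> L_gen qrel set" where
  "L_rels N =
     {(LZ a, LZ b, -1) | a b. 1 \<le> a \<and> a < b \<and> b \<le> N} \<union>
     {(LOmega j, LOmega k, 0) | j k. j \<in> {1..<N} \<and> k \<in> {1..<N}} \<union>
     {(LOmega j, LZ a, 2) | j a. j \<in> {1..<N} \<and> a \<in> {1..N} \<and> a \<le> j} \<union>
     {(LOmega j, LZ a, 0) | j a. j \<in> {1..<N} \<and> a \<in> {1..N} \<and> a > j}"

definition L_matrix :: "nat \<Rightarrow> int mat" where
  "L_matrix N = defining_matrix (L_gens N) (L_rels N)"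


section \<open>Division rings of fractions and the degree\<close>

definition division_ring_of_fractions ::
    "('a, 'm) ring_scheme \<Rightarrow> ('d, 'n) ring_scheme \<Rightarrow> ('a \<Rightarrow> 'd) \<Rightarrow> bool" where
  "division_ring_of_fractions A D \<phi> \<longleftrightarrow>
     ring D \<and> \<one>\<^bsub>D\<^esub> \<noteq> \<zero>\<^bsub>D\<^esub> \<and> Units D = carrier D - {\<zero>\<^bsub>D\<^esub>} \<and>
     \<phi> \<in> Ring.ring_hom A D \<and> inj_on \<phi> (carrier A) \<and>
     (\<forall>d\<in>carrier D. \<exists>a\<in>carrier A. \<exists>s\<in>carrier A - {\<zero>\<^bsub>A\<^esub>}. d = \<phi> a \<otimes>\<^bsub>D\<^esub> inv\<^bsub>D\<^esub> (\<phi> s))"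

definition ring_center :: "('a, 'm) ring_scheme \<Rightarrow> 'a set" where
  "ring_center D = {x \<in> carrier D. \<forall>y\<in>carrier D. x \<otimes>\<^bsub>D\<^esub> y = y \<otimes>\<^bsub>D\<^esub> x}"

text \<open>
  A division ring of fractions is unique up to isomorphism, and it has a copy whose elements are
  sets of pairs (numerator, denominator). Hence the type of \<open>D\<close> is no restriction. The first
  conjunct makes the degree defined, the second makes it independent of the choice of \<open>D\<close>.
\<close>

definition has_degree :: "('a, 'm) ring_scheme \<Rightarrow> nat \<Rightarrow> bool" where
  "has_degree A n \<longleftrightarrow>
     (\<exists>(D :: ('a \<times> 'a) set ring) \<phi>. division_ring_of_fractions A D \<phi>) \<and>
     (\<forall>(D :: ('a \<times> 'a) set ring) \<phi>. division_ring_of_fractions A D \<phi> \<longrightarrow>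
        ring.dimension D (n\<^sup>2) (ring_center D) (carrier D))"

end

(*
  The monomials z_i, z_i z_i^* form a new basis of the exponent lattice of the quasipolynomial
  algebra; its first N + (N - 1) elements z_0, ..., z_(N-1), z_1 z_1^*, ..., z_(N-1) z_(N-1)^* have the
  relations of L, and z_0 z_0^* is in the radical. So the two matrices differ by a zero summand up to
  congruence, and a zero summand can be cancelled: the blocks d <> 0 span a nondegenerate form, and a
  congruence between two such forms, each extended by zero, is block triangular.

  In F_q(N) the elements Omega_j = sum_(k >= j) z_k z_k^* q-commute with the z_i and with each other, and
  z_i^* = z_i^-1 (Omega_i - Omega_(i+1)). Hence F_q(N) acts on functions on the exponent lattice of a
  quantum torus; comparing leading exponents shows that it is a domain. The m-th powers of z_i and
  Omega_j are central. In a division ring of fractions D, the centralizer of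
  x_1, ..., x_(k-1) in D decomposes under conjugation by x_k into m eigenspaces, which are translates
  of the centralizer of x_1, ..., x_k; running through the 2(N-1) elements
  Omega_1, ..., Omega_(N-1), z_(N-2), ..., z_0 ends in the center. The same computation shows that the
  localization of F_q(N) at its nonzero central elements has finite dimension over its center, so
  that it is a division ring.
*)
theory Submission
  imports Defs
begin

section \<open>Unimodular congruence of integer matrices\<close>

text \<open>Congruence is taken under matrices of determinant 1 or -1; exchanging two generators, or
  in size 1 a change of sign, restores the determinant 1 of the definition. The blocks are not
  normalised by divisibility, so a matrix has many canonical forms, and each form of one matrix has
  to be turned into a form of the other. Only the passage from the larger matrix to the smaller one
  needs cancellation.

  The degree is demanded of every division ring of fractions, and one has to exist. Both follow from
  a single dimension count, made in a ring where only the \<open>z i\<close>, the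
  \<open>Om j\<close> and the nonzero central elements are known to be invertible. It applies to the
  central localization before that is known to be a division ring, so there is no circle, and again
  to an arbitrary \<open>D\<close>.

  The chain has 2(N-1) members although there are 2N elements z_i and Omega_j: Omega_0 is central,
  and z_(N-1) is a central element times a power of Omega_(N-1), because 2 is invertible modulo the
  odd number m. For the same reason q^2 is again a primitive m-th root of unity, so that every
  conjugation has m different eigenvalues.\<close>

definition unimodular :: "nat \<Rightarrow> int mat \<Rightarrow> bool" where
  "unimodular n P \<longleftrightarrow> P \<in> carrier_mat n n \<and> det P \<in> {1, - 1}"

text \<open>Only the size of \<open>A\<close> is required; that of \<open>B\<close> follows.
  Allowing determinant -1 makes every reordering of the generators a congruence.\<close>

definition congruent_mat :: "nat \<Rightarrow> int mat \<Rightarrow> int mat \<Rightarrow> bool" where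
  "congruent_mat n A B \<longleftrightarrow> A \<in> carrier_mat n n \<and> (\<exists>P. unimodular n P \<and> P * A * transpose_mat P = B)"

lemma unimodular_carrier: "unimodular n P \<Longrightarrow> P \<in> carrier_mat n n"
  by (simp add: unimodular_def)

lemma unimodular_one: "unimodular n (1\<^sub>m n)"
  by (simp add: unimodular_def)

lemma unimodular_mult: "unimodular n P \<Longrightarrow> unimodular n Q \<Longrightarrow> unimodular n (P * Q)"
  by (auto simp: unimodular_def det_mult)

lemma unimodularI:
  assumes "P \<in> carrier_mat n n" "Q \<in> carrier_mat n n" "P * Q = 1\<^sub>m n"
  shows "unimodular n P"
proof -
  have "det P * det Q = 1"
    using det_mult[OF assms(1,2)] assms(3) by simp
  then show ?thesis
    using assms(1) by (auto simp: unimodular_def zmult_eq_1_iff)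
qed

lemma unimodular_inverse:
  assumes "unimodular n P"
  obtains Q where "unimodular n Q" "P * Q = 1\<^sub>m n" "Q * P = 1\<^sub>m n"
proof -
  have P: "P \<in> carrier_mat n n" and d: "det P * det P = 1"
    using assms by (auto simp: unimodular_def)
  \<comment> \<open>As det P is its own inverse, this is the usual adjugate formula.\<close>
  let ?Q = "det P \<cdot>\<^sub>m adj_mat P"
  have Q: "?Q \<in> carrier_mat n n"
    using adj_mat(1)[OF P] by simp
  have 1: "det P \<cdot>\<^sub>m (det P \<cdot>\<^sub>m 1\<^sub>m n) = (1\<^sub>m n :: int mat)"
    by (rule eq_matI) (simp_all add: d)
  have PQ: "P * ?Q = 1\<^sub>m n"
    by (simp only: mult_smult_distrib[OF P adj_mat(1)[OF P]] adj_mat(2)[OF P] 1)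
  have QP: "?Q * P = 1\<^sub>m n"
    by (simp only: mult_smult_assoc_mat[OF adj_mat(1)[OF P] P] adj_mat(3)[OF P] 1)
  show ?thesis
    using that[OF unimodularI[OF Q P QP] PQ QP] .
qed

lemma congruent_mat_carrier:
  "congruent_mat n A B \<Longrightarrow> A \<in> carrier_mat n n" "congruent_mat n A B \<Longrightarrow> B \<in> carrier_mat n n"
  by (auto simp: congruent_mat_def unimodular_def)

lemma congruent_matI:
  "A \<in> carrier_mat n n \<Longrightarrow> unimodular n P \<Longrightarrow> P * A * transpose_mat P = B \<Longrightarrow> congruent_mat n A B"
  by (auto simp: congruent_mat_def)

lemma congruent_mat_refl: "A \<in> carrier_mat n n \<Longrightarrow> congruent_mat n A A"
  by (rule congruent_matI[OF _ unimodular_one]) auto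

lemma congruence_mult:
  fixes P Q A :: "int mat"
  assumes "P \<in> carrier_mat n n" "Q \<in> carrier_mat n n" "A \<in> carrier_mat n n"
  shows "(Q * P) * A * transpose_mat (Q * P) = Q * (P * A * transpose_mat P) * transpose_mat Q"
  using assms by (simp add: transpose_mult[OF assms(2,1)] assoc_mult_mat[of _ n n _ n _ n])

lemma congruent_mat_trans:
  assumes "congruent_mat n A B" "congruent_mat n B C"
  shows "congruent_mat n A C"
proof -
  obtain P Q where P: "unimodular n P" "P * A * transpose_mat P = B"
    and Q: "unimodular n Q" "Q * B * transpose_mat Q = C" and A: "A \<in> carrier_mat n n"
    using assms by (auto simp: congruent_mat_def)
  show ?thesis
    by (rule congruent_matI[OF A unimodular_mult[OF Q(1) P(1)]])
      (use P Q A in \<open>simp add: congruence_mult[OF unimodular_carrier unimodular_carrier]\<close>)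
qed

lemma congruent_mat_sym:
  assumes "congruent_mat n A B"
  shows "congruent_mat n B A"
proof -
  obtain P where P: "unimodular n P" "P * A * transpose_mat P = B" and A: "A \<in> carrier_mat n n"
    using assms by (auto simp: congruent_mat_def)
  obtain Q where Q: "unimodular n Q" "Q * P = 1\<^sub>m n"
    using unimodular_inverse[OF P(1)] by metis
  have "Q * B * transpose_mat Q = A"
    using congruence_mult[of P n Q A] P Q A by (simp add: unimodular_carrier)
  then show ?thesis
    using Q congruent_mat_carrier[OF assms] by (auto intro: congruent_matI)
qed

definition direct_sum_mat :: "int mat \<Rightarrow> int mat \<Rightarrow> int mat" where
  "direct_sum_mat A B =
     four_block_mat A (0\<^sub>m (dim_row A) (dim_col B)) (0\<^sub>m (dim_row B) (dim_col A)) B"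

lemma direct_sum_mat_carrier [simp]:
  "A \<in> carrier_mat k k \<Longrightarrow> B \<in> carrier_mat l l \<Longrightarrow> direct_sum_mat A B \<in> carrier_mat (k + l) (k + l)"
  by (simp add: direct_sum_mat_def)

lemma direct_sum_mat_assoc:
  assumes "A \<in> carrier_mat k k" "B \<in> carrier_mat l l" "C \<in> carrier_mat m m"
  shows "direct_sum_mat (direct_sum_mat A B) C = direct_sum_mat A (direct_sum_mat B C)"
  using assms by (intro eq_matI) (auto simp: direct_sum_mat_def)

lemma unimodular_direct_sum:
  assumes "unimodular k P" "unimodular l Q"
  shows "unimodular (k + l) (direct_sum_mat P Q)"
  using assms det_four_block_mat_upper_right_zero[of P k _ l _ Q]
  by (auto simp: unimodular_def direct_sum_mat_def)

lemma direct_sum_mat_congruence: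
  assumes "P \<in> carrier_mat k k" "Q \<in> carrier_mat l l" "A \<in> carrier_mat k k" "B \<in> carrier_mat l l"
  shows "direct_sum_mat P Q * direct_sum_mat A B * transpose_mat (direct_sum_mat P Q) =
    direct_sum_mat (P * A * transpose_mat P) (Q * B * transpose_mat Q)"
proof -
  have 1: "transpose_mat (direct_sum_mat P Q) = direct_sum_mat (transpose_mat P) (transpose_mat Q)"
    using assms unfolding direct_sum_mat_def by (subst transpose_four_block_mat) auto
  have 2: "direct_sum_mat A1 B1 * direct_sum_mat A2 B2 = direct_sum_mat (A1 * A2) (B1 * B2)"
    if "A1 \<in> carrier_mat k k" "B1 \<in> carrier_mat l l" "A2 \<in> carrier_mat k k" "B2 \<in> carrier_mat l l"
    for A1 A2 B1 B2
    using that unfolding direct_sum_mat_def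
    by (subst mult_four_block_mat[of _ k k _ l _ l _ _ k _ l]) auto
  show ?thesis
    using assms by (simp add: 1 2)
qed

lemma congruent_mat_direct_sum:
  assumes "congruent_mat k A A'" "congruent_mat l B B'"
  shows "congruent_mat (k + l) (direct_sum_mat A B) (direct_sum_mat A' B')"
proof -
  obtain P Q where P: "unimodular k P" "P * A * transpose_mat P = A'" "A \<in> carrier_mat k k"
    and Q: "unimodular l Q" "Q * B * transpose_mat Q = B'" "B \<in> carrier_mat l l"
    using assms by (auto simp: congruent_mat_def)
  show ?thesis
    by (rule congruent_matI[OF _ unimodular_direct_sum[OF P(1) Q(1)]])
      (use P Q in \<open>simp_all add: direct_sum_mat_congruence[OF unimodular_carrier unimodular_carrier]\<close>)
qed

definition permutation_mat :: "nat \<Rightarrow> (nat \<Rightarrow> nat) \<Rightarrow> int mat" where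
  "permutation_mat n \<sigma> = mat n n (\<lambda>(i, j). if j = \<sigma> i then 1 else 0)"

lemma permutation_mat_carrier [simp]: "permutation_mat n \<sigma> \<in> carrier_mat n n"
  by (simp add: permutation_mat_def)

lemma permutation_mat_dims [simp]:
  "dim_row (permutation_mat n \<sigma>) = n" "dim_col (permutation_mat n \<sigma>) = n"
  by (simp_all add: permutation_mat_def)

lemma permutation_mat_mult_index:
  assumes "\<sigma> permutes {..<n}" "A \<in> carrier_mat n k" "i < n" "j < k"
  shows "(permutation_mat n \<sigma> * A) $$ (i, j) = A $$ (\<sigma> i, j)"
proof -
  have "\<sigma> i < n"
    using permutes_in_image[OF assms(1), of i] assms(3) by simp
  then show ?thesis
    using assms by (simp add: permutation_mat_def scalar_prod_def if_distrib[of "\<lambda>x. x * _"] cong: if_cong)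
qed

lemma permutation_mat_congruence:
  assumes "\<sigma> permutes {..<n}" "A \<in> carrier_mat n n"
  shows "permutation_mat n \<sigma> * A * transpose_mat (permutation_mat n \<sigma>) = mat n n (\<lambda>(i, j). A $$ (\<sigma> i, \<sigma> j))"
proof -
  let ?P = "permutation_mat n \<sigma>"
  have s: "\<sigma> i < n" if "i < n" for i
    using permutes_in_image[OF assms(1), of i] that by simp
  \<comment> \<open>Transposing trades the factor on the right for one on the left, so that the row
    rule \<open>permutation_mat_mult_index\<close> serves twice.\<close>
  have "?P * A * transpose_mat ?P = transpose_mat (?P * transpose_mat (?P * A))"
    using assms mult_carrier_mat[OF permutation_mat_carrier[of n \<sigma>] assms(2)]
    by (subst transpose_mult[of _ n n _ n]) auto
  also have "\<dots> = mat n n (\<lambda>(i, j). A $$ (\<sigma> i, \<sigma> j))"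
  proof (rule eq_matI)
    fix i j assume "i < dim_row (mat n n (\<lambda>(i, j). A $$ (\<sigma> i, \<sigma> j)))"
      and "j < dim_col (mat n n (\<lambda>(i, j). A $$ (\<sigma> i, \<sigma> j)))"
    then have ij: "i < n" "j < n"
      by auto
    have PA: "?P * A \<in> carrier_mat n n"
      using mult_carrier_mat[OF permutation_mat_carrier assms(2)] .
    have "transpose_mat (?P * transpose_mat (?P * A)) $$ (i, j) = transpose_mat (?P * A) $$ (\<sigma> j, i)"
      using ij PA permutation_mat_mult_index[OF assms(1), of "transpose_mat (?P * A)" n j i]
      by (simp add: permutation_mat_def)
    also have "\<dots> = (?P * A) $$ (i, \<sigma> j)"
      using ij(1) s[OF ij(2)] assms(2) by simp
    also have "\<dots> = A $$ (\<sigma> i, \<sigma> j)"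
      using ij s permutation_mat_mult_index[OF assms] by simp
    finally show "transpose_mat (?P * transpose_mat (?P * A)) $$ (i, j) =
        mat n n (\<lambda>(i, j). A $$ (\<sigma> i, \<sigma> j)) $$ (i, j)"
      using ij by simp
  qed (simp_all add: permutation_mat_def)
  finally show ?thesis .
qed

lemma unimodular_permutation_mat:
  assumes "\<sigma> permutes {..<n}"
  shows "unimodular n (permutation_mat n \<sigma>)"
proof (rule unimodularI)
  let ?P = "permutation_mat n \<sigma>"
  have "?P * transpose_mat ?P = ?P * 1\<^sub>m n * transpose_mat ?P"
    by (simp add: right_mult_one_mat[OF permutation_mat_carrier])
  also have "\<dots> = 1\<^sub>m n"
  proof (subst permutation_mat_congruence[OF assms one_carrier_mat], rule eq_matI)
    fix i j assume "i < dim_row (1\<^sub>m n)" "j < dim_col (1\<^sub>m n)"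
    then show "mat n n (\<lambda>(i, j). 1\<^sub>m n $$ (\<sigma> i, \<sigma> j)) $$ (i, j) = (1\<^sub>m n :: int mat) $$ (i, j)"
      using permutes_in_image[OF assms, of i] permutes_in_image[OF assms, of j]
      by (simp add: inj_eq[OF permutes_inj[OF assms]])
  qed simp_all
  finally show "?P * transpose_mat ?P = 1\<^sub>m n" .
qed auto

lemma congruent_permuted_mat:
  "\<sigma> permutes {..<n} \<Longrightarrow> A \<in> carrier_mat n n \<Longrightarrow> congruent_mat n A (mat n n (\<lambda>(i, j). A $$ (\<sigma> i, \<sigma> j)))"
  by (metis congruent_matI permutation_mat_congruence unimodular_permutation_mat)

lemma congruent_direct_sum_commute:
  assumes A: "A \<in> carrier_mat k k" and B: "B \<in> carrier_mat l l"
  shows "congruent_mat (k + l) (direct_sum_mat A B) (direct_sum_mat B A)"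
proof -
  define \<sigma> where "\<sigma> i = (if i < l then i + k else if i < k + l then i - l else i)" for i
  have "\<sigma> permutes {..<k + l}"
    by (rule bij_imp_permutes[OF bij_betw_byWitness[where f' = "\<lambda>i. if i < k then i + l else i - k"]])
      (auto simp: \<sigma>_def)
  moreover have "mat (k + l) (k + l) (\<lambda>(i, j). direct_sum_mat A B $$ (\<sigma> i, \<sigma> j)) = direct_sum_mat B A"
    using A B by (intro eq_matI) (auto simp: direct_sum_mat_def \<sigma>_def)
  ultimately show ?thesis
    using congruent_permuted_mat[of \<sigma> "k + l" "direct_sum_mat A B"] A B by simp
qed

text \<open>Needed in size 1, where a determinant -1 cannot be repaired by exchanging two
  generators.\<close>

lemma congruence_uminus:
  fixes P A :: "int mat"
  assumes "P \<in> carrier_mat n n" "A \<in> carrier_mat n n"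
  shows "((- 1) \<cdot>\<^sub>m P) * A * transpose_mat ((- 1) \<cdot>\<^sub>m P) = P * A * transpose_mat P"
proof -
  have PA: "P * A \<in> carrier_mat n n" and P: "transpose_mat P \<in> carrier_mat n n"
    using assms by simp_all
  have "transpose_mat ((- 1) \<cdot>\<^sub>m P) = (- 1) \<cdot>\<^sub>m transpose_mat P"
    by (rule eq_matI) auto
  then show ?thesis
    by (simp add: mult_smult_assoc_mat[OF assms] mult_smult_assoc_mat[OF PA smult_carrier_mat[OF P]]
        mult_smult_distrib[OF PA P] smult_carrier_mat[OF P])
      (rule eq_matI, simp_all)
qed

section \<open>Canonical forms of skew-symmetric matrices\<close>

definition skew_mat :: "int mat \<Rightarrow> bool" where
  "skew_mat A \<longleftrightarrow> transpose_mat A = (- 1) \<cdot>\<^sub>m A"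

lemma skew_mat_index:
  assumes "skew_mat A" "A \<in> carrier_mat n n" "i < n" "j < n"
  shows "A $$ (j, i) = - A $$ (i, j)"
proof -
  have "A $$ (j, i) = transpose_mat A $$ (i, j)"
    using assms by simp
  also have "\<dots> = - A $$ (i, j)"
    using assms unfolding skew_mat_def by simp
  finally show ?thesis .
qed

lemma skew_matI:
  assumes "A \<in> carrier_mat n n" "\<And>i j. i < n \<Longrightarrow> j < n \<Longrightarrow> A $$ (j, i) = - A $$ (i, j)"
  shows "skew_mat A"
  unfolding skew_mat_def
proof (rule eq_matI)
  fix i j assume "i < dim_row (- 1 \<cdot>\<^sub>m A)" "j < dim_col (- 1 \<cdot>\<^sub>m A)"
  then have ij: "i < n" "j < n"
    using assms(1) by simp_all
  show "transpose_mat A $$ (i, j) = (- 1 \<cdot>\<^sub>m A) $$ (i, j)"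
    using assms(1) ij assms(2)[OF ij] by (simp del: minus_equation_iff)
qed (use assms(1) in simp_all)

lemma skew_mat_congruent:
  assumes "congruent_mat n A B" "skew_mat A"
  shows "skew_mat B"
proof -
  obtain P where P: "P \<in> carrier_mat n n" "P * A * transpose_mat P = B" and A: "A \<in> carrier_mat n n"
    using assms by (auto simp: congruent_mat_def unimodular_def)
  have "transpose_mat B = P * transpose_mat A * transpose_mat P"
    unfolding P(2)[symmetric] using P(1) A
    by (simp add: transpose_mult[of _ n n _ n] assoc_mult_mat[of _ n n _ n _ n])
  also have "\<dots> = P * ((- 1) \<cdot>\<^sub>m A) * transpose_mat P"
    using assms(2) by (simp only: skew_mat_def)
  also have "\<dots> = (- 1) \<cdot>\<^sub>m (P * A * transpose_mat P)"
    using P A by (simp add: mult_smult_distrib[of _ n n _ n] mult_smult_assoc_mat[of _ n n _ n])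
  finally show ?thesis
    using P(2) by (simp add: skew_mat_def)
qed

lemma skew_block_carrier [simp]: "skew_block d \<in> carrier_mat 2 2"
  by (rule carrier_matI) (simp_all add: skew_block_def mat_of_rows_list_def)

lemma skew_block_index:
  "skew_block d $$ (0, 0) = 0" "skew_block d $$ (0, Suc 0) = - d"
  "skew_block d $$ (Suc 0, 0) = d" "skew_block d $$ (Suc 0, Suc 0) = 0"
  by (simp_all add: skew_block_def mat_of_rows_list_def)

lemma canonical_matrix_Cons:
  "canonical_matrix (2 + n) (d # ds) = direct_sum_mat (skew_block d) (canonical_matrix n ds)"
  by (simp add: canonical_matrix_def direct_sum_mat_def Let_def)

lemma canonical_matrix_Nil_0: "canonical_matrix 0 [] = 0\<^sub>m 0 0"
  by (simp add: canonical_matrix_def)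

lemma canonical_matrix_Nil_1: "canonical_matrix (Suc 0) [] = 0\<^sub>m 1 1"
  by (rule eq_matI) (simp_all add: canonical_matrix_def Let_def)

lemma canonical_matrix_carrier [simp]:
  "length ds = n div 2 \<Longrightarrow> canonical_matrix n ds \<in> carrier_mat n n"
proof (induction ds arbitrary: n)
  case Nil
  then consider "n = 0" | "n = Suc 0"
    by force
  then show ?case
    by cases (simp_all add: canonical_matrix_Nil_0 canonical_matrix_Nil_1)
next
  case (Cons d ds)
  then obtain k where k: "n = 2 + k"
    using le_Suc_ex[of 2 n] by fastforce
  then have "canonical_matrix k ds \<in> carrier_mat k k"
    using Cons by simp
  then show ?case
    unfolding k canonical_matrix_Cons by (intro direct_sum_mat_carrier skew_block_carrier)
qed

text \<open>Moves a chosen entry into the upper left 2 x 2 corner. The inner transposition uses the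
  place \<open>?\<tau> j\<close>, which the outer one sends to \<open>j\<close>; as
  \<open>i \<noteq> j\<close>, this place is not 0.\<close>

lemma permutation_with_prefix:
  assumes "i < n" "j < n" "i \<noteq> j"
  obtains \<sigma> where "\<sigma> permutes {..<n}" "\<sigma> 0 = i" "\<sigma> (Suc 0) = j"
proof -
  let ?\<tau> = "Transposition.transpose 0 i"
  let ?\<sigma> = "?\<tau> \<circ> Transposition.transpose 1 (?\<tau> j)"
  have "?\<tau> j < n" and n: "0 < n" "1 < n"
    using assms by (auto simp: Transposition.transpose_def)
  then have "?\<sigma> permutes {..<n}"
    using assms by (intro permutes_compose permutes_swap_id) auto
  moreover have "?\<sigma> 0 = i" "?\<sigma> (Suc 0) = j"
    using assms by (auto simp: Transposition.transpose_def)
  ultimately show ?thesis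
    using that by blast
qed

text \<open>The accompanying column operation changes column \<open>k\<close> only, so in any other
  column the congruence looks like a row operation.\<close>

lemma addrow_congruence_index:
  fixes B :: "int mat" and a :: int
  assumes "B \<in> carrier_mat n n" "k < n" "l < n" "c < n" "k \<noteq> c"
  defines "P \<equiv> addrow_mat n a k l"
  shows "(P * B * transpose_mat P) $$ (k, c) = B $$ (k, c) + a * B $$ (l, c)"
proof -
  have P: "P \<in> carrier_mat n n"
    by (simp add: P_def)
  have PB: "P * B = addrow a k l B"
    unfolding P_def using addrow_mat[OF assms(1,3)] by simp
  have "(P * B * transpose_mat P) $$ (k, c) = row (P * B) k \<bullet> col (transpose_mat P) c"
    using assms(1-4) P by (intro index_mult_mat(1)) auto
  also have "col (transpose_mat P) c = row P c"
    using assms(4) P by simp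
  also have "row P c = unit_vec n c"
    using assms(4,5) by (simp add: P_def row_addrow)
  also have "row (P * B) k \<bullet> unit_vec n c = (P * B) $$ (k, c)"
    using assms(1-4) P by (subst scalar_prod_right_unit) auto
  finally show ?thesis
    using assms(1-4) by (simp add: PB)
qed

lemma unimodular_addrow_mat: "k \<noteq> l \<Longrightarrow> unimodular n (addrow_mat n a k l)"
  by (simp add: unimodular_def det_addrow_mat)

text \<open>Block elimination with the pivot block S(p), where p is the entry at (1, 0). It can be
  done over the integers because p divides all entries below the block.\<close>

lemma skew_pivot_split:
  assumes B: "B \<in> carrier_mat (2 + n) (2 + n)" and skew: "skew_mat B"
    and col0: "\<And>k. k < n \<Longrightarrow> B $$ (Suc 0, 0) dvd B $$ (2 + k, 0)"
    and col1: "\<And>k. k < n \<Longrightarrow> B $$ (Suc 0, 0) dvd B $$ (2 + k, Suc 0)"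
  obtains H' where "H' \<in> carrier_mat n n"
    "congruent_mat (2 + n) B (direct_sum_mat (skew_block (B $$ (Suc 0, 0))) H')"
proof -
  define p where "p = B $$ (Suc 0, 0)"
  define V Y Z where "V = mat 2 n (\<lambda>(i, j). B $$ (i, 2 + j))" and "Y = mat n 2 (\<lambda>(i, j). B $$ (2 + i, j))"
    and "Z = mat n n (\<lambda>(i, j). B $$ (2 + i, 2 + j))"
  have car: "V \<in> carrier_mat 2 n" "Y \<in> carrier_mat n 2" "Z \<in> carrier_mat n n"
    by (simp_all add: V_def Y_def Z_def)
  have B0: "B $$ (0, 0) = 0" "B $$ (Suc 0, Suc 0) = 0" "B $$ (0, Suc 0) = - p"
    using skew_mat_index[OF skew B, of 0 0] skew_mat_index[OF skew B, of "Suc 0" "Suc 0"]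
      skew_mat_index[OF skew B, of "Suc 0" 0] by (simp_all add: p_def)
  have Bs: "B $$ (i, j) = skew_block p $$ (i, j)" if "i < 2" "j < 2" for i j
    using that B0 by (auto simp: less_2_cases_iff skew_block_index p_def)
  have sub: "Suc (Suc (i - 2)) = i" if "\<not> i < 2" for i
    using that by simp
  have Bb: "B = four_block_mat (skew_block p) V Y Z"
    using B Bs carrier_matD[OF skew_block_carrier[of p]]
    by (intro eq_matI) (auto simp: V_def Y_def Z_def sub)
  \<comment> \<open>Solution of T S(p) = - Y: a row (s, t) times S(p) is (t p, - s p), which
    exchanges the two columns and brings in one sign.\<close>
  define T where "T = mat n 2 (\<lambda>(k, j). if j = 0 then B $$ (2 + k, Suc 0) div p else - (B $$ (2 + k, 0) div p))"
  have T: "T \<in> carrier_mat n 2"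
    by (simp add: T_def)
  have "T * skew_block p + Y = 0\<^sub>m n 2"
  proof (rule eq_matI)
    fix k j assume kj: "k < dim_row (0\<^sub>m n 2 :: int mat)" "j < dim_col (0\<^sub>m n 2 :: int mat)"
    have "(T * skew_block p) $$ (k, j) = T $$ (k, 0) * skew_block p $$ (0, j) + T $$ (k, Suc 0) * skew_block p $$ (Suc 0, j)"
      using kj T carrier_matD[OF skew_block_carrier[of p]]
      by (simp add: scalar_prod_def numeral_2_eq_2)
    moreover have "j = 0 \<or> j = Suc 0"
      using kj by auto
    ultimately show "(T * skew_block p + Y) $$ (k, j) = 0\<^sub>m n 2 $$ (k, j)"
      using kj col0[of k] col1[of k] carrier_matD[OF skew_block_carrier[of p]]
      by (auto simp: T_def Y_def skew_block_index p_def)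
  qed (use T car in auto)
  then have TS: "T * skew_block p + 1\<^sub>m n * Y = 0\<^sub>m n 2"
    using car by simp
  define P where "P = four_block_mat (1\<^sub>m 2) (0\<^sub>m 2 n) T (1\<^sub>m n)"
  have P: "P \<in> carrier_mat (2 + n) (2 + n)"
    using T unfolding P_def by (intro four_block_carrier_mat) simp_all
  have "unimodular (2 + n) P"
    using T P det_four_block_mat_upper_right_zero[of "1\<^sub>m 2" 2 "0\<^sub>m 2 n" n T "1\<^sub>m n"]
    by (simp add: unimodular_def P_def)
  then have cong: "congruent_mat (2 + n) B (P * B * transpose_mat P)"
    by (rule congruent_matI[OF B _ refl])
  define H' where "H' = T * V + 1\<^sub>m n * Z"
  have H': "H' \<in> carrier_mat n n"
    using T car by (simp add: H'_def)
  have "P * B = four_block_mat (1\<^sub>m 2 * skew_block p + 0\<^sub>m 2 n * Y) (1\<^sub>m 2 * V + 0\<^sub>m 2 n * Z) (0\<^sub>m n 2) H'"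
    unfolding P_def Bb TS[symmetric] H'_def
    by (rule mult_four_block_mat[of _ 2 2 _ n _ n _ _ 2 _ n]) (use T car in simp_all)
  then have PB: "P * B = four_block_mat (skew_block p) V (0\<^sub>m n 2) H'"
    using car by (simp add: left_mult_one_mat[OF skew_block_carrier] right_add_zero_mat[OF skew_block_carrier])
  have "transpose_mat P = four_block_mat (1\<^sub>m 2) (transpose_mat T) (0\<^sub>m n 2) (1\<^sub>m n)"
    unfolding P_def by (subst transpose_four_block_mat[of _ 2 2 _ n _ n]) (use T in simp_all)
  then have "P * B * transpose_mat P = four_block_mat (skew_block p * 1\<^sub>m 2 + V * 0\<^sub>m n 2)
      (skew_block p * transpose_mat T + V * 1\<^sub>m n) (0\<^sub>m n 2 * 1\<^sub>m 2 + H' * 0\<^sub>m n 2)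
      (0\<^sub>m n 2 * transpose_mat T + H' * 1\<^sub>m n)"
    unfolding PB by (simp only:, intro mult_four_block_mat[of _ 2 2 _ n _ n _ _ 2 _ n]) (use T car H' in simp_all)
  moreover define U where "U = skew_block p * transpose_mat T + V * 1\<^sub>m n"
  ultimately have M: "P * B * transpose_mat P = four_block_mat (skew_block p) U (0\<^sub>m n 2) H'"
    using T car H'
    by (simp add: right_mult_one_mat[OF skew_block_carrier] right_add_zero_mat[OF skew_block_carrier])
  have U: "U \<in> carrier_mat 2 n"
    unfolding U_def using T car by (intro add_carrier_mat mult_carrier_mat[OF skew_block_carrier]) auto
  \<comment> \<open>The lower left block has been cleared and the congruent matrix is still
    skew-symmetric, so the upper right block vanishes with it.\<close>
  have "U $$ (i, j) = 0" if "i < 2" "j < n" for i j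
    using skew_mat_index[OF skew_mat_congruent[OF cong skew] congruent_mat_carrier(2)[OF cong], of i "2 + j"]
      that U H' carrier_matD[OF skew_block_carrier[of p]]
    by (simp add: M)
  then have "U = 0\<^sub>m 2 n"
    using U by (intro eq_matI) auto
  then have "P * B * transpose_mat P = direct_sum_mat (skew_block p) H'"
    using M H' carrier_matD[OF skew_block_carrier[of p]] by (simp add: direct_sum_mat_def)
  then show ?thesis
    using that[OF H'] cong by (simp add: p_def)
qed

lemma skew_direct_sum_right:
  assumes "skew_mat (direct_sum_mat A B)" "A \<in> carrier_mat k k" "B \<in> carrier_mat l l"
  shows "skew_mat B"
proof (rule skew_matI[OF assms(3)])
  fix i j assume "i < l" "j < l"
  then show "B $$ (j, i) = - B $$ (i, j)"
    using skew_mat_index[OF assms(1) direct_sum_mat_carrier[OF assms(2,3)], of "k + i" "k + j"] assms(2,3)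
    by (simp add: direct_sum_mat_def)
qed

text \<open>The pivot is a nonzero entry of least absolute value among all matrices congruent to
  \<open>H\<close>. If it did not divide an entry below the corner block, one row operation would
  leave a smaller nonzero remainder.\<close>

lemma skew_mat_split:
  assumes H: "H \<in> carrier_mat (2 + n) (2 + n)" and skew: "skew_mat H"
  obtains d H' where "H' \<in> carrier_mat n n" "skew_mat H'"
    "congruent_mat (2 + n) H (direct_sum_mat (skew_block d) H')"
proof -
  let ?N = "2 + n"
  have "\<exists>d H'. H' \<in> carrier_mat n n \<and> congruent_mat ?N H (direct_sum_mat (skew_block d) H')"
  proof (cases "H = 0\<^sub>m ?N ?N")
    case True
    have "skew_block 0 $$ (i, j) = 0" if "i < 2" "j < 2" for i j
      using that by (auto simp: less_2_cases_iff skew_block_index)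
    then have "direct_sum_mat (skew_block 0) (0\<^sub>m n n) = 0\<^sub>m ?N ?N"
      using carrier_matD[OF skew_block_carrier[of 0]]
      by (intro eq_matI) (auto simp: direct_sum_mat_def)
    then show ?thesis
      using True congruent_mat_refl[OF H] zero_carrier_mat[of n n] by metis
  next
    case False
    define E where "E = (\<lambda>d. \<exists>B i j. congruent_mat ?N H B \<and> i < ?N \<and> j < ?N \<and> B $$ (i, j) \<noteq> 0 \<and>
      nat \<bar>B $$ (i, j)\<bar> = d)"
    have "\<exists>d. E d"
      using False H congruent_mat_refl[OF H] unfolding E_def by (metis eq_matI carrier_matD index_zero_mat)
    then have "E (LEAST d. E d)"
      by (rule LeastI_ex)
    then obtain B i j where B: "congruent_mat ?N H B" "i < ?N" "j < ?N" "B $$ (i, j) \<noteq> 0"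
      and least: "nat \<bar>B $$ (i, j)\<bar> = (LEAST d. E d)"
      unfolding E_def by blast
    have "i \<noteq> j"
      using skew_mat_index[OF skew_mat_congruent[OF B(1) skew] congruent_mat_carrier(2)[OF B(1)] B(2,2)] B(4)
      by auto
    then obtain \<sigma> where \<sigma>: "\<sigma> permutes {..<?N}" "\<sigma> 0 = j" "\<sigma> (Suc 0) = i"
      using permutation_with_prefix[OF B(3,2)] by metis
    define C where "C = mat ?N ?N (\<lambda>(i, j). B $$ (\<sigma> i, \<sigma> j))"
    have HC: "congruent_mat ?N H C"
      using congruent_mat_trans[OF B(1) congruent_permuted_mat[OF \<sigma>(1) congruent_mat_carrier(2)[OF B(1)]]]
      by (simp add: C_def)
    note C = congruent_mat_carrier(2)[OF HC]
    define p where "p = C $$ (Suc 0, 0)"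
    have p: "p = B $$ (i, j)"
      using \<sigma> by (simp add: p_def C_def)
    have C01: "C $$ (0, Suc 0) = - p"
      using skew_mat_index[OF skew_mat_congruent[OF HC skew] C, of "Suc 0" 0] by (simp add: p_def)
    \<comment> \<open>\<open>l\<close> is the row of the corner block that has the pivot, up to
      sign, in column \<open>c\<close>; the other entry of the block in that column is 0.\<close>
    have min: "p dvd C $$ (k, c)" if k: "2 \<le> k" "k < ?N" and c: "c = 0 \<and> l = Suc 0 \<or> c = Suc 0 \<and> l = 0" for k c l
    proof (rule ccontr)
      assume ndvd: "\<not> p dvd C $$ (k, c)"
      define a where "a = - (C $$ (k, c) div C $$ (l, c))"
      let ?P = "addrow_mat ?N a k l"
      let ?D = "?P * C * transpose_mat ?P"
      have HD: "congruent_mat ?N H ?D"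
        by (rule congruent_mat_trans[OF HC congruent_matI[OF C _ refl]])
          (use k c in \<open>auto intro: unimodular_addrow_mat\<close>)
      have lc: "C $$ (l, c) = p \<or> C $$ (l, c) = - p"
        using c C01 by (auto simp: p_def)
      have D: "?D $$ (k, c) = C $$ (k, c) mod C $$ (l, c)"
        using addrow_congruence_index[OF C, of k l c a] k c
        by (auto simp: a_def minus_mult_div_eq_mod mult.commute minus_div_mult_eq_mod)
      have "E (nat \<bar>?D $$ (k, c)\<bar>)"
        unfolding E_def using HD k c D lc ndvd
        by (intro exI[of _ ?D] exI[of _ k] exI[of _ c]) (auto simp: mod_eq_0_iff_dvd)
      then have "nat \<bar>p\<bar> \<le> nat \<bar>?D $$ (k, c)\<bar>"
        using least p by (simp add: Least_le)
      moreover have "\<bar>?D $$ (k, c)\<bar> < \<bar>p\<bar>"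
        using lc D p B(4) abs_mod_less[of "C $$ (l, c)" "C $$ (k, c)"] by auto
      ultimately show False
        by simp
    qed
    obtain H' where "H' \<in> carrier_mat n n" "congruent_mat ?N C (direct_sum_mat (skew_block p) H')"
      by (rule skew_pivot_split[OF C skew_mat_congruent[OF HC skew]])
        (use min[of "2 + _" 0 "Suc 0"] min[of "2 + _" "Suc 0" 0] in \<open>auto simp: p_def\<close>)
    then show ?thesis
      using congruent_mat_trans[OF HC] by blast
  qed
  then show ?thesis
    using that skew_direct_sum_right[OF _ skew_block_carrier] skew_mat_congruent[OF _ skew] by blast
qed

lemma skew_mat_canonical:
  assumes "H \<in> carrier_mat n n" "skew_mat H"
  shows "\<exists>ds. length ds = n div 2 \<and> congruent_mat n H (canonical_matrix n ds)"
  using assms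
proof (induction n arbitrary: H rule: less_induct)
  case (less n)
  show ?case
  proof (cases "n < 2")
    case True
    then have "H = canonical_matrix n []"
      using less.prems skew_mat_index[OF less.prems(2,1), of 0 0]
      by (cases n) (auto simp: canonical_matrix_Nil_0 canonical_matrix_Nil_1 intro!: eq_matI)
    then show ?thesis
      using True less.prems congruent_mat_refl[of H n] by (intro exI[of _ "[]"]) auto
  next
    case False
    then obtain k where k: "n = 2 + k"
      using le_Suc_ex by (metis not_less)
    obtain d H' where H': "H' \<in> carrier_mat k k" "skew_mat H'"
      "congruent_mat n H (direct_sum_mat (skew_block d) H')"
      using skew_mat_split less.prems unfolding k by metis
    then obtain ds where ds: "length ds = k div 2" "congruent_mat k H' (canonical_matrix k ds)"
      using less.IH[of k H'] k by auto
    have "congruent_mat n H (canonical_matrix n (d # ds))"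
      using congruent_mat_trans[OF H'(3)] congruent_mat_direct_sum[OF congruent_mat_refl[OF skew_block_carrier[of d]] ds(2)]
      by (simp only: k canonical_matrix_Cons)
    then show ?thesis
      using ds(1) k by (intro exI[of _ "d # ds"]) simp
  qed
qed

text \<open>A matrix \<open>P\<close> of determinant -1 is split as (P Q) S, where S is a
  transposition matrix and Q its inverse: S becomes the reordering of the generators, and P Q has
  determinant 1. In size 1 the sign of \<open>P\<close> is changed instead.\<close>

lemma canonical_form_iff:
  assumes H: "H \<in> carrier_mat n n"
  shows "canonical_form H ds \<longleftrightarrow> length ds = n div 2 \<and> congruent_mat n H (canonical_matrix n ds)"
proof
  assume "canonical_form H ds"
  then obtain \<sigma> W where \<sigma>: "\<sigma> permutes {..<n}" and W: "W \<in> carrier_mat n n" "det W = 1"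
    "W * mat n n (\<lambda>(i, j). H $$ (\<sigma> i, \<sigma> j)) * transpose_mat W = canonical_matrix n ds"
    and "length ds = n div 2"
    using H by (auto simp: canonical_form_def Let_def)
  moreover have "congruent_mat n (mat n n (\<lambda>(i, j). H $$ (\<sigma> i, \<sigma> j))) (canonical_matrix n ds)"
    using W by (intro congruent_matI[of _ _ W]) (auto simp: unimodular_def)
  ultimately show "length ds = n div 2 \<and> congruent_mat n H (canonical_matrix n ds)"
    using congruent_mat_trans[OF congruent_permuted_mat[OF \<sigma> H]] by simp
next
  assume "length ds = n div 2 \<and> congruent_mat n H (canonical_matrix n ds)"
  then have ds: "length ds = n div 2" and "congruent_mat n H (canonical_matrix n ds)"
    by auto
  then obtain P where P: "P \<in> carrier_mat n n" "det P = 1 \<or> det P = - 1"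
    "P * H * transpose_mat P = canonical_matrix n ds"
    by (auto simp: congruent_mat_def unimodular_def)
  have "\<exists>\<sigma> W. \<sigma> permutes {..<n} \<and> W \<in> carrier_mat n n \<and> det W = 1 \<and>
    W * mat n n (\<lambda>(i, j). H $$ (\<sigma> i, \<sigma> j)) * transpose_mat W = canonical_matrix n ds"
  proof (cases "det P = 1")
    case True
    have "mat n n (\<lambda>(i, j). H $$ (id i, id j)) = H"
      using H by (intro eq_matI) auto
    then show ?thesis
      using True P permutes_id by metis
  next
    case neg: False
    show ?thesis
    proof (cases "n \<ge> 2")
      case True
      define \<sigma> where "\<sigma> = Transposition.transpose 0 (Suc 0)"
      have \<sigma>: "\<sigma> permutes {..<n}"
        unfolding \<sigma>_def using True by (intro permutes_swap_id) auto
      let ?S = "permutation_mat n \<sigma>"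
      have "?S = swaprows_mat n 0 (Suc 0)"
        using True by (intro eq_matI) (auto simp: permutation_mat_def swaprows_mat_def \<sigma>_def Transposition.transpose_def)
      then have dS: "det ?S = - 1"
        using True by (simp add: det_swaprows_mat)
      obtain Q where Q: "unimodular n Q" "?S * Q = 1\<^sub>m n" "Q * ?S = 1\<^sub>m n"
        using unimodular_inverse[OF unimodular_permutation_mat[OF \<sigma>]] .
      have Qc: "Q \<in> carrier_mat n n"
        using Q unimodular_carrier by simp
      have "det Q * det ?S = 1"
        using det_mult[OF Qc permutation_mat_carrier[of n \<sigma>]] Q(3) by simp
      then have "det (P * Q) = 1"
        using det_mult[OF P(1) Qc] neg P(2) dS by auto
      moreover have "(P * Q) * (?S * H * transpose_mat ?S) * transpose_mat (P * Q) = canonical_matrix n ds"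
      proof -
        have "(P * Q) * (?S * H * transpose_mat ?S) * transpose_mat (P * Q) =
          ((P * Q) * ?S) * H * transpose_mat ((P * Q) * ?S)"
          by (rule congruence_mult[symmetric]) (use P Qc H in auto)
        also have "(P * Q) * ?S = P"
          using P(1) Qc Q(3) by (simp add: assoc_mult_mat[of _ n n _ n _ n])
        finally show ?thesis
          using P(3) by simp
      qed
      ultimately show ?thesis
        using \<sigma> P(1) Qc permutation_mat_congruence[OF \<sigma> H] by (metis mult_carrier_mat)
    next
      case False
      \<comment> \<open>The determinant of the matrix of size 0 is 1, so it cannot be -1.\<close>
      moreover have "n \<noteq> 0"
        using neg P det_dim_zero by (intro notI) simp
      ultimately have "n = 1"
        by linarith
      then have "odd n"
        by simp
      then have "det ((- 1) \<cdot>\<^sub>m P) = 1"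
        using neg P by auto
      moreover have "mat n n (\<lambda>(i, j). H $$ (id i, id j)) = H"
        using H by (intro eq_matI) auto
      ultimately show ?thesis
        using P congruence_uminus[OF P(1) H] permutes_id smult_carrier_mat[OF P(1)] by metis
    qed
  qed
  then show "canonical_form H ds"
    using H ds by (simp add: canonical_form_def Let_def)
qed

section \<open>Separating the zero blocks and cancelling them\<close>

lemma direct_sum_zero_mat: "direct_sum_mat (0\<^sub>m k k) (0\<^sub>m l l) = 0\<^sub>m (k + l) (k + l)"
  by (rule eq_matI) (auto simp: direct_sum_mat_def)

lemma skew_block_0: "skew_block 0 = 0\<^sub>m 2 2"
proof (rule eq_matI)
  fix i j assume "i < dim_row (0\<^sub>m 2 2 :: int mat)" "j < dim_col (0\<^sub>m 2 2 :: int mat)"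
  then show "skew_block 0 $$ (i, j) = (0\<^sub>m 2 2 :: int mat) $$ (i, j)"
    by (auto simp: less_2_cases_iff skew_block_index)
qed (use carrier_matD[OF skew_block_carrier[of 0]] in simp_all)

text \<open>The size is even, so \<open>canonical_matrix\<close> appends no 1 x 1 zero
  block.\<close>

abbreviation block_diagonal :: "int list \<Rightarrow> int mat" where
  "block_diagonal ds \<equiv> canonical_matrix (2 * length ds) ds"

text \<open>The blocks S(0) are moved to the end, where they merge with the 1 x 1 zero block of odd
  size into one zero summand.\<close>

lemma canonical_matrix_nonzero_blocks:
  assumes "length ds = n div 2"
  defines "f \<equiv> filter (\<lambda>d. d \<noteq> 0) ds"
  shows "congruent_mat n (canonical_matrix n ds)
    (direct_sum_mat (block_diagonal f) (0\<^sub>m (n - 2 * length f) (n - 2 * length f)))"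
  using assms(1) unfolding f_def
proof (induction ds arbitrary: n)
  case Nil
  then consider "n = 0" | "n = Suc 0"
    by force
  then show ?case
    using direct_sum_zero_mat[of 0 n]
    by cases (simp_all add: canonical_matrix_Nil_0 canonical_matrix_Nil_1 congruent_mat_refl)
next
  case (Cons d ds)
  then obtain k where n: "n = 2 + k" and k: "length ds = k div 2"
    using le_Suc_ex[of 2 n] by fastforce
  define f where "f = filter (\<lambda>d. d \<noteq> 0) ds"
  define r where "r = k - 2 * length f"
  have "length f \<le> k div 2"
    unfolding f_def k[symmetric] by (rule length_filter_le)
  then have kr: "k = 2 * length f + r"
    by (simp add: r_def)
  let ?E = "block_diagonal f"
  have E: "?E \<in> carrier_mat (2 * length f) (2 * length f)"
    by simp
  have "congruent_mat n (canonical_matrix n (d # ds))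
      (direct_sum_mat (skew_block d) (direct_sum_mat ?E (0\<^sub>m r r)))"
    unfolding n canonical_matrix_Cons
    using congruent_mat_direct_sum[OF congruent_mat_refl[OF skew_block_carrier[of d]] Cons.IH[OF k]]
    by (simp add: f_def r_def)
  then have 1: "congruent_mat n (canonical_matrix n (d # ds))
      (direct_sum_mat (direct_sum_mat (skew_block d) ?E) (0\<^sub>m r r))"
    using direct_sum_mat_assoc[OF skew_block_carrier E zero_carrier_mat[of r r]] by simp
  show ?case
  proof (cases "d = 0")
    case False
    moreover have "direct_sum_mat (skew_block d) ?E = block_diagonal (d # f)"
      using canonical_matrix_Cons[of "2 * length f" d f] by simp
    moreover have "n - 2 * length (d # f) = r"
      using n kr by simp
    ultimately show ?thesis
      using 1 by (simp add: f_def)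
  next
    case True
    have "congruent_mat (2 + 2 * length f + r)
        (direct_sum_mat (direct_sum_mat (skew_block d) ?E) (0\<^sub>m r r))
        (direct_sum_mat (direct_sum_mat ?E (skew_block d)) (0\<^sub>m r r))"
      by (intro congruent_mat_direct_sum congruent_direct_sum_commute congruent_mat_refl) auto
    moreover have "2 + 2 * length f + r = n"
      using n kr by simp
    moreover have "direct_sum_mat (direct_sum_mat ?E (skew_block d)) (0\<^sub>m r r) =
        direct_sum_mat ?E (0\<^sub>m (2 + r) (2 + r))"
      using direct_sum_mat_assoc[OF E skew_block_carrier[of 0] zero_carrier_mat[of r r]] True
      by (simp only: skew_block_0 direct_sum_zero_mat)
    moreover have "2 + r = n - 2 * length (filter (\<lambda>d. d \<noteq> 0) (d # ds))"
      using n kr True by (simp add: f_def)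
    ultimately show ?thesis
      using congruent_mat_trans[OF 1] True by (simp add: f_def)
  qed
qed

lemma det_direct_sum_mat:
  assumes "A \<in> carrier_mat k k" "B \<in> carrier_mat l l"
  shows "det (direct_sum_mat A B) = det A * det B"
  using det_four_block_mat_upper_right_zero[of A k _ l _ B] assms by (auto simp: direct_sum_mat_def)

text \<open>S(d) S(-d) is d^2 times the identity.\<close>

lemma det_skew_block: "d \<noteq> 0 \<Longrightarrow> det (skew_block d) \<noteq> 0"
proof
  assume d: "d \<noteq> 0" and "det (skew_block d) = 0"
  then have "det (skew_block d * skew_block (- d)) = 0"
    by (simp add: det_mult[OF skew_block_carrier skew_block_carrier])
  moreover have "skew_block d * skew_block (- d) = (d * d) \<cdot>\<^sub>m 1\<^sub>m 2"
  proof (rule eq_matI)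
    fix i j assume "i < dim_row ((d * d) \<cdot>\<^sub>m 1\<^sub>m 2)" "j < dim_col ((d * d) \<cdot>\<^sub>m 1\<^sub>m 2)"
    then show "(skew_block d * skew_block (- d)) $$ (i, j) = ((d * d) \<cdot>\<^sub>m 1\<^sub>m 2) $$ (i, j)"
      using carrier_matD[OF skew_block_carrier[of d]] carrier_matD[OF skew_block_carrier[of "- d"]]
      by (auto simp: less_Suc_eq scalar_prod_def numeral_2_eq_2 skew_block_index)
  qed (use carrier_matD[OF skew_block_carrier[of d]] carrier_matD[OF skew_block_carrier[of "- d"]] in simp_all)
  ultimately show False
    using d by simp
qed

lemma det_block_diagonal:
  assumes "\<forall>d\<in>set ds. d \<noteq> 0"
  shows "det (block_diagonal ds) \<noteq> 0"
  using assms
proof (induction ds)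
  case Nil
  then show ?case
    by (simp add: canonical_matrix_Nil_0)
next
  case (Cons d ds)
  have "block_diagonal (d # ds) = direct_sum_mat (skew_block d) (block_diagonal ds)"
    using canonical_matrix_Cons[of "2 * length ds" d ds] by simp
  then show ?case
    using Cons det_skew_block
    by (simp add: det_direct_sum_mat[OF skew_block_carrier canonical_matrix_carrier])
qed

text \<open>With P in blocks P1, P2, P3, P4, comparison gives P1 C P1^t = D and P3 C P1^t = 0. As
  det D is nonzero, so is det (C P1^t), which forces P3 = 0. Then det P = det P1 det P4, and P1 is
  unimodular.\<close>

lemma congruent_direct_sum_zero:
  assumes C: "C \<in> carrier_mat l l" and D: "D \<in> carrier_mat l l" and detD: "det D \<noteq> 0"
    and cong: "congruent_mat (l + s) (direct_sum_mat C (0\<^sub>m s s)) (direct_sum_mat D (0\<^sub>m s s))"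
  shows "det C \<noteq> 0" "congruent_mat l C D"
proof -
  obtain P where P: "P \<in> carrier_mat (l + s) (l + s)" and detP: "det P = 1 \<or> det P = - 1"
    and PC: "P * direct_sum_mat C (0\<^sub>m s s) * transpose_mat P = direct_sum_mat D (0\<^sub>m s s)"
    using cong by (auto simp: congruent_mat_def unimodular_def)
  obtain P1 P2 P3 P4 where "split_block P l l = (P1, P2, P3, P4)"
    by (metis prod_cases4)
  note split_block[OF this, of s s]
  then have car: "P1 \<in> carrier_mat l l" "P2 \<in> carrier_mat l s" "P3 \<in> carrier_mat s l" "P4 \<in> carrier_mat s s"
    and Pb: "P = four_block_mat P1 P2 P3 P4"
    using P by auto
  have "P * direct_sum_mat C (0\<^sub>m s s) = four_block_mat (P1 * C + P2 * 0\<^sub>m s l) (P1 * 0\<^sub>m l s + P2 * 0\<^sub>m s s)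
      (P3 * C + P4 * 0\<^sub>m s l) (P3 * 0\<^sub>m l s + P4 * 0\<^sub>m s s)"
    unfolding Pb direct_sum_mat_def using C car
    by (subst mult_four_block_mat[of _ l l _ s _ s _ _ l _ s]) auto
  also have "\<dots> = four_block_mat (P1 * C) (0\<^sub>m l s) (P3 * C) (0\<^sub>m s s)"
    using C car by simp
  finally have 1: "P * direct_sum_mat C (0\<^sub>m s s) = \<dots>" .
  have "transpose_mat P = four_block_mat (transpose_mat P1) (transpose_mat P3) (transpose_mat P2) (transpose_mat P4)"
    unfolding Pb using car by (subst transpose_four_block_mat[of _ l l _ s _ s]) auto
  then have "direct_sum_mat D (0\<^sub>m s s) =
      four_block_mat (P1 * C * transpose_mat P1 + 0\<^sub>m l s * transpose_mat P2)
        (P1 * C * transpose_mat P3 + 0\<^sub>m l s * transpose_mat P4)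
        (P3 * C * transpose_mat P1 + 0\<^sub>m s s * transpose_mat P2)
        (P3 * C * transpose_mat P3 + 0\<^sub>m s s * transpose_mat P4)"
    unfolding PC[symmetric] 1 using C car
    by (simp only:, subst mult_four_block_mat[of _ l l _ s _ s _ _ l _ s]) auto
  then have E: "direct_sum_mat D (0\<^sub>m s s) = four_block_mat (P1 * C * transpose_mat P1) (P1 * C * transpose_mat P3)
        (P3 * C * transpose_mat P1) (P3 * C * transpose_mat P3)" (is "_ = ?R")
    using C car by simp
  have D1: "P1 * C * transpose_mat P1 = D"
  proof (rule eq_matI)
    fix i j assume "i < dim_row D" "j < dim_col D"
    then show "(P1 * C * transpose_mat P1) $$ (i, j) = D $$ (i, j)"
      using arg_cong[OF E, of "\<lambda>M. M $$ (i, j)"] C D car by (simp add: direct_sum_mat_def)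
  qed (use C D car in auto)
  have Z1: "P3 * C * transpose_mat P1 = 0\<^sub>m s l"
  proof (rule eq_matI)
    fix i j assume ij: "i < dim_row (0\<^sub>m s l :: int mat)" "j < dim_col (0\<^sub>m s l :: int mat)"
    then show "(P3 * C * transpose_mat P1) $$ (i, j) = 0\<^sub>m s l $$ (i, j)"
      using arg_cong[OF E, of "\<lambda>M. M $$ (l + i, j)"] C D car by (simp add: direct_sum_mat_def)
  qed (use C D car in auto)
  have det: "det P1 * det C * det P1 = det D"
    using C car det_mult[of "P1 * C" l "transpose_mat P1"] det_mult[of P1 l C] det_transpose[of P1 l] D1
    by simp
  then show "det C \<noteq> 0"
    using detD by auto
  define M where "M = C * transpose_mat P1"
  have M: "M \<in> carrier_mat l l"
    using C car by (simp add: M_def)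
  have detM: "det M \<noteq> 0"
    using det detD C car det_transpose[of P1 l] by (auto simp: M_def det_mult[of C l])
  have "P3 * M = 0\<^sub>m s l"
    using Z1 C car by (simp add: M_def assoc_mult_mat[of P3 s l C l _ l])
  \<comment> \<open>The adjugate cancels \<open>M\<close> within the integers, up to the nonzero
    factor det M.\<close>
  then have "P3 * (M * adj_mat M) = 0\<^sub>m s l"
    using car M adj_mat(1)[OF M] by (simp flip: assoc_mult_mat[of P3 s l M l "adj_mat M" l])
  then have DP: "det M \<cdot>\<^sub>m P3 = 0\<^sub>m s l"
    using car by (simp add: adj_mat(2)[OF M] mult_smult_distrib[of P3 s l "1\<^sub>m l" l])
  have "det M * P3 $$ (i, j) = 0" if "i < s" "j < l" for i j
  proof -
    have "(det M \<cdot>\<^sub>m P3) $$ (i, j) = 0"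
      unfolding DP using that by simp
    then show ?thesis
      using that car by simp
  qed
  then have "P3 = 0\<^sub>m s l"
    using car detM by (intro eq_matI) auto
  then have "det P1 * det P4 = 1 \<or> det P1 * det P4 = - 1"
    using detP car det_four_block_mat_lower_left_zero[of P1 l P2 s P3 P4] by (simp add: Pb)
  then have "unimodular l P1"
    using car by (auto simp: unimodular_def zmult_eq_1_iff) (metis zmult_eq_1_iff minus_mult_left minus_minus)
  then show "congruent_mat l C D"
    using C D1 by (rule_tac congruent_matI)
qed

text \<open>A comparison of ranks by determinants: if \<open>C\<close> were smaller, part of its
  zero summand could be joined to it to reach size \<open>l\<close>. The padded matrix would be
  singular, yet nonsingular by \<open>congruent_direct_sum_zero\<close>.\<close>

lemma congruent_nondegenerate_size:
  assumes C: "C \<in> carrier_mat k k" and D: "D \<in> carrier_mat l l" and detD: "det D \<noteq> 0"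
    and cong: "congruent_mat n (direct_sum_mat C (0\<^sub>m r r)) (direct_sum_mat D (0\<^sub>m s s))"
    and n: "n = k + r" "n = l + s"
  shows "l \<le> k"
proof (rule ccontr)
  assume "\<not> l \<le> k"
  then obtain t where t: "l = k + t" "0 < t"
    by (metis less_imp_add_positive not_le)
  define C' where "C' = direct_sum_mat C (0\<^sub>m t t)"
  have C': "C' \<in> carrier_mat l l"
    using C by (simp add: C'_def t)
  have "r = t + s"
    using n t by simp
  then have "direct_sum_mat C (0\<^sub>m r r) = direct_sum_mat C' (0\<^sub>m s s)"
    using direct_sum_mat_assoc[OF C zero_carrier_mat[of t t] zero_carrier_mat[of s s]]
    by (simp add: C'_def direct_sum_zero_mat)
  then have "det C' \<noteq> 0"
    using congruent_direct_sum_zero(1)[OF C' D detD, of s] cong n(2) by simp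
  moreover have "det C' = 0"
    using det_direct_sum_mat[OF C zero_carrier_mat[of t t]] t(2) by (simp add: C'_def)
  ultimately show False
    by simp
qed

lemma block_diagonal_cancel:
  assumes f: "\<forall>d\<in>set f. d \<noteq> 0" and g: "\<forall>d\<in>set g. d \<noteq> 0"
    and n: "n = 2 * length f + r" "n = 2 * length g + s"
    and cong: "congruent_mat n (direct_sum_mat (block_diagonal f) (0\<^sub>m r r))
      (direct_sum_mat (block_diagonal g) (0\<^sub>m s s))"
  shows "length f = length g" "congruent_mat (2 * length f) (block_diagonal f) (block_diagonal g)"
proof -
  have F: "block_diagonal f \<in> carrier_mat (2 * length f) (2 * length f)"
    and G: "block_diagonal g \<in> carrier_mat (2 * length g) (2 * length g)"
    by simp_all
  have "2 * length g \<le> 2 * length f"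
    by (rule congruent_nondegenerate_size[OF F G det_block_diagonal[OF g] cong n])
  moreover have "2 * length f \<le> 2 * length g"
    by (rule congruent_nondegenerate_size[OF G F det_block_diagonal[OF f] congruent_mat_sym[OF cong] n(2,1)])
  ultimately show len: "length f = length g"
    by simp
  then show "congruent_mat (2 * length f) (block_diagonal f) (block_diagonal g)"
    using congruent_direct_sum_zero(2)[OF F _ det_block_diagonal[OF g], of s] G cong n by simp
qed

text \<open>As \<open>n\<close> is odd, a canonical form of \<open>F\<close> has one 2 x 2 block
  more than one of \<open>H\<close>: the 1 x 1 zero block of \<open>H\<close> and the new zero
  together form S(0). Conversely, a given form of \<open>F\<close> is compared by cancellation with
  some form \<open>c\<close> of \<open>H\<close>.\<close>

lemma nonzero_blocks_direct_sum_zero: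
  assumes H: "H \<in> carrier_mat n n" "skew_mat H" and n: "odd n"
    and F: "congruent_mat (n + 1) F (direct_sum_mat H (0\<^sub>m 1 1))"
  shows "nonzero_blocks F = nonzero_blocks H" "nonzero_blocks H \<noteq> {}"
proof -
  have n2: "(n + 1) div 2 = Suc (n div 2)"
    using n by (elim oddE) simp
  have canonF: "congruent_mat (n + 1) F
      (direct_sum_mat (block_diagonal f) (0\<^sub>m (n + 1 - 2 * length f) (n + 1 - 2 * length f)))"
    and len: "2 * length f \<le> n"
    if ds: "canonical_form H ds" and f: "f = filter (\<lambda>d. d \<noteq> 0) ds" for ds f
  proof -
    have ds': "length ds = n div 2" "congruent_mat n H (canonical_matrix n ds)"
      using ds H(1) by (simp_all add: canonical_form_iff)
    have "length f \<le> n div 2"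
      unfolding f ds'(1)[symmetric] by (rule length_filter_le)
    then show l: "2 * length f \<le> n"
      by simp
    have "congruent_mat n H (direct_sum_mat (block_diagonal f) (0\<^sub>m (n - 2 * length f) (n - 2 * length f)))"
      unfolding f using congruent_mat_trans[OF ds'(2) canonical_matrix_nonzero_blocks[OF ds'(1)]] .
    then have "congruent_mat (n + 1) F (direct_sum_mat (direct_sum_mat (block_diagonal f)
        (0\<^sub>m (n - 2 * length f) (n - 2 * length f))) (0\<^sub>m 1 1))"
      using congruent_mat_trans[OF F congruent_mat_direct_sum] congruent_mat_refl zero_carrier_mat by blast
    moreover have "n - 2 * length f + 1 = n + 1 - 2 * length f"
      using l by simp
    ultimately show "congruent_mat (n + 1) F
      (direct_sum_mat (block_diagonal f) (0\<^sub>m (n + 1 - 2 * length f) (n + 1 - 2 * length f)))"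
      by (simp add: direct_sum_mat_assoc[of _ "2 * length f" _ "n - 2 * length f" _ 1] direct_sum_zero_mat
          del: One_nat_def)
  qed
  have Fc: "F \<in> carrier_mat (n + 1) (n + 1)"
    using congruent_mat_carrier(1)[OF F] .
  obtain c where c: "canonical_form H c"
    using skew_mat_canonical[OF H] canonical_form_iff[OF H(1)] by blast
  then show "nonzero_blocks H \<noteq> {}"
    by (auto simp: nonzero_blocks_def)
  show "nonzero_blocks F = nonzero_blocks H"
  proof (intro equalityI subsetI)
    fix M assume "M \<in> nonzero_blocks H"
    then obtain ds where M: "M = filter_mset (\<lambda>d. d \<noteq> 0) (mset ds)" and ds: "canonical_form H ds"
      by (auto simp: nonzero_blocks_def)
    have l: "length (ds @ [0]) = (n + 1) div 2"
      using ds canonical_form_iff[OF H(1)] n2 by simp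
    have "congruent_mat (n + 1) F (canonical_matrix (n + 1) (ds @ [0]))"
      using canonF[OF ds refl] congruent_mat_sym[OF canonical_matrix_nonzero_blocks[OF l]]
      by (auto intro: congruent_mat_trans)
    then have "canonical_form F (ds @ [0])"
      using l canonical_form_iff[OF Fc] by simp
    moreover have "M = filter_mset (\<lambda>d. d \<noteq> 0) (mset (ds @ [0]))"
      using M by simp
    ultimately show "M \<in> nonzero_blocks F"
      unfolding nonzero_blocks_def by blast
  next
    fix M assume "M \<in> nonzero_blocks F"
    then obtain ds where M: "M = filter_mset (\<lambda>d. d \<noteq> 0) (mset ds)" and "canonical_form F ds"
      by (auto simp: nonzero_blocks_def)
    then have ds: "length ds = (n + 1) div 2" "congruent_mat (n + 1) F (canonical_matrix (n + 1) ds)"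
      using canonical_form_iff[OF Fc] by simp_all
    define f g where "f = filter (\<lambda>d. d \<noteq> 0) ds" and "g = filter (\<lambda>d. d \<noteq> 0) c"
    let ?z = "\<lambda>k. 0\<^sub>m k k :: int mat"
    have lf: "2 * length f \<le> n + 1"
      using length_filter_le[of "\<lambda>d. d \<noteq> 0" ds] ds(1) unfolding f_def by linarith
    have lg: "2 * length g \<le> n"
      using len[OF c g_def] .
    have "congruent_mat (n + 1) F (direct_sum_mat (block_diagonal f) (?z (n + 1 - 2 * length f)))"
      unfolding f_def using congruent_mat_trans[OF ds(2) canonical_matrix_nonzero_blocks[OF ds(1)]] .
    then have "congruent_mat (n + 1) (direct_sum_mat (block_diagonal g) (?z (n + 1 - 2 * length g)))
        (direct_sum_mat (block_diagonal f) (?z (n + 1 - 2 * length f)))"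
      by (rule congruent_mat_trans[OF congruent_mat_sym[OF canonF[OF c g_def]]])
    note block_diagonal_cancel[OF _ _ _ _ this]
    moreover have "\<forall>d\<in>set g. d \<noteq> 0" "\<forall>d\<in>set f. d \<noteq> 0"
      by (simp_all add: f_def g_def)
    moreover have "n + 1 = 2 * length g + (n + 1 - 2 * length g)" "n + 1 = 2 * length f + (n + 1 - 2 * length f)"
      using lf lg by simp_all
    ultimately have gf: "length g = length f" "congruent_mat (2 * length g) (block_diagonal g) (block_diagonal f)"
      by blast+
    \<comment> \<open>Padding with zeros to the number of blocks that size \<open>n\<close>
      requires. There is room for \<open>f\<close>, since it has the same length as the nonzero part
      \<open>g\<close> of a form of \<open>H\<close>.\<close>
    define e where "e = f @ replicate (n div 2 - length f) 0"
    have e: "length e = n div 2" "filter (\<lambda>d. d \<noteq> 0) e = f"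
      using lg gf(1) by (simp_all add: e_def f_def)
    have c': "length c = n div 2" "congruent_mat n H (canonical_matrix n c)"
      using c canonical_form_iff[OF H(1)] by simp_all
    have "congruent_mat n H (direct_sum_mat (block_diagonal g) (?z (n - 2 * length g)))"
      unfolding g_def using congruent_mat_trans[OF c'(2) canonical_matrix_nonzero_blocks[OF c'(1)]] .
    moreover have "congruent_mat (2 * length g + (n - 2 * length g))
        (direct_sum_mat (block_diagonal g) (?z (n - 2 * length g)))
        (direct_sum_mat (block_diagonal f) (?z (n - 2 * length g)))"
      by (intro congruent_mat_direct_sum gf(2) congruent_mat_refl) simp
    ultimately have "congruent_mat n H (direct_sum_mat (block_diagonal f) (?z (n - 2 * length f)))"
      using lg gf(1) by (auto intro: congruent_mat_trans)
    moreover have "congruent_mat n (canonical_matrix n e) (direct_sum_mat (block_diagonal f) (?z (n - 2 * length f)))"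
      using canonical_matrix_nonzero_blocks[OF e(1)] e(2) by simp
    ultimately have "canonical_form H e"
      using canonical_form_iff[OF H(1)] e(1) congruent_mat_trans congruent_mat_sym by blast
    moreover have "M = filter_mset (\<lambda>d. d \<noteq> 0) (mset e)"
      using M e(2) by (metis f_def mset_filter)
    ultimately show "M \<in> nonzero_blocks H"
      unfolding nonzero_blocks_def by blast
  qed
qed

section \<open>The defining matrices\<close>

lemma Fbar_matrix_carrier: "Fbar_matrix N \<in> carrier_mat (N + N) (N + N)"
  by (simp add: Fbar_matrix_def defining_matrix_def F_gens_def)

lemma L_matrix_carrier: "L_matrix N \<in> carrier_mat (N + (N - 1)) (N + (N - 1))"
  by (simp add: L_matrix_def defining_matrix_def L_gens_def del: upt_Suc)

lemma Fbar_matrix_index: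
  assumes "i < N" "j < N"
  shows "Fbar_matrix N $$ (i, j) = (if i < j then -1 else if j < i then 1 else 0)"
    "Fbar_matrix N $$ (i, N + j) = (if i = j then 0 else -1)"
    "Fbar_matrix N $$ (N + i, j) = (if i = j then 0 else 1)"
    "Fbar_matrix N $$ (N + i, N + j) = (if i < j then 1 else if j < i then -1 else 0)"
  using assms
  by (auto simp: Fbar_matrix_def defining_matrix_def F_gens_def nth_append Fbar_rels_def F_common_rels_def
      intro!: the_equality)

text \<open>The generators of L are numbered from 1 and the indices from 0: index \<open>i\<close>
  is z_(i+1) and index \<open>N + k\<close> is Omega_(k+1), so the condition a \<le> j of the
  relations reads \<open>i \<le> k\<close>.\<close>

lemma L_matrix_index:
  "i < N \<Longrightarrow> j < N \<Longrightarrow> L_matrix N $$ (i, j) = (if i < j then -1 else if j < i then 1 else 0)"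
  "i < N \<Longrightarrow> k < N - 1 \<Longrightarrow> L_matrix N $$ (i, N + k) = (if i \<le> k then -2 else 0)"
  "i < N \<Longrightarrow> k < N - 1 \<Longrightarrow> L_matrix N $$ (N + k, i) = (if i \<le> k then 2 else 0)"
  "k < N - 1 \<Longrightarrow> l < N - 1 \<Longrightarrow> L_matrix N $$ (N + k, N + l) = 0"
  by (auto simp: L_matrix_def defining_matrix_def L_gens_def nth_append L_rels_def
      intro!: the_equality simp del: upt_Suc)

lemma skew_L_matrix: "skew_mat (L_matrix N)"
proof (rule skew_matI[OF L_matrix_carrier])
  fix i j assume ij: "i < N + (N - 1)" "j < N + (N - 1)"
  have x: "x < N \<or> (\<exists>k<N - 1. x = N + k)" if "x < N + (N - 1)" for x
  proof -
    have "x - N < N - 1" "x = N + (x - N)" if "\<not> x < N"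
      using that \<open>x < N + (N - 1)\<close> by auto
    then show ?thesis
      by blast
  qed
  show "L_matrix N $$ (j, i) = - L_matrix N $$ (i, j)"
    using x[OF ij(1)] x[OF ij(2)] by (elim disjE exE conjE) (simp_all add: L_matrix_index)
qed

text \<open>In terms of the generators, the new basis of the exponent lattice is \<open>z\<^sub>i\<close>, \<open>z\<^sub>i z\<^sub>i\<^sup>*\<close>: the
  monomial \<open>z\<^sub>i z\<^sub>i\<^sup>*\<close> behaves like \<open>\<Omega>\<^sub>i\<close>, and \<open>z\<^sub>0 z\<^sub>0\<^sup>*\<close> is central.\<close>

lemma Fbar_congruent_L:
  assumes "N \<ge> 1"
  shows "congruent_mat (N + (N - 1) + 1) (Fbar_matrix N) (direct_sum_mat (L_matrix N) (0\<^sub>m 1 1))"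
proof -
  let ?F = "Fbar_matrix N"
  define A B C D where "A = mat N N (\<lambda>(i, j). ?F $$ (i, j))" and "B = mat N N (\<lambda>(i, j). ?F $$ (i, N + j))"
    and "C = mat N N (\<lambda>(i, j). ?F $$ (N + i, j))" and "D = mat N N (\<lambda>(i, j). ?F $$ (N + i, N + j))"
  have car: "A \<in> carrier_mat N N" "B \<in> carrier_mat N N" "C \<in> carrier_mat N N" "D \<in> carrier_mat N N"
    by (simp_all add: A_def B_def C_def D_def)
  have F: "?F = four_block_mat A B C D"
    using Fbar_matrix_carrier[of N] by (intro eq_matI) (auto simp: A_def B_def C_def D_def)
  \<comment> \<open>Adding row \<open>i\<close> to row \<open>N + i\<close>, and likewise for
    columns, replaces z_i^* by the monomial z_i z_i^* in the basis.\<close>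
  define P where "P = four_block_mat (1\<^sub>m N) (0\<^sub>m N N) (1\<^sub>m N) (1\<^sub>m N :: int mat)"
  have "unimodular (N + N) P"
    unfolding unimodular_def P_def
    by (subst det_four_block_mat_upper_right_zero[of _ N _ N]) (auto intro!: four_block_carrier_mat)
  then have cong: "congruent_mat (N + N) ?F (P * ?F * transpose_mat P)"
    by (rule congruent_matI[OF Fbar_matrix_carrier _ refl])
  have "P * ?F = four_block_mat A B (A + C) (B + D)"
    unfolding P_def F using car by (subst mult_four_block_mat[of _ N N _ N _ N _ _ N _ N]) auto
  moreover have "transpose_mat P = four_block_mat (1\<^sub>m N) (1\<^sub>m N) (0\<^sub>m N N) (1\<^sub>m N)"
    unfolding P_def by (subst transpose_four_block_mat[of _ N N _ N _ N]) auto
  ultimately have M: "P * ?F * transpose_mat P = four_block_mat A (A + B) (A + C) (A + C + (B + D))"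
    using car by (simp only:, subst mult_four_block_mat[of _ N N _ N _ N _ _ N _ N]) auto
  \<comment> \<open>Position \<open>N + k\<close> receives z_(k+1) z_(k+1)^*, to be matched with
    Omega_(k+1); the last position receives z_0 z_0^*, the zero summand.\<close>
  define \<sigma> where "\<sigma> i = (if i < N then i else if i = N + N - 1 then N else if i < N + N then i + 1 else i)" for i
  have \<sigma>: "\<sigma> permutes {..<N + N}"
    by (rule bij_imp_permutes[OF bij_betw_byWitness[where f' =
            "\<lambda>i. if i < N then i else if i = N then N + N - 1 else i - 1"]])
      (use assms in \<open>auto simp: \<sigma>_def\<close>)
  have "mat (N + N) (N + N) (\<lambda>(i, j). four_block_mat A (A + B) (A + C) (A + C + (B + D)) $$ (\<sigma> i, \<sigma> j)) =
      direct_sum_mat (L_matrix N) (0\<^sub>m 1 1)"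
  proof (rule eq_matI)
    fix i j
    assume "i < dim_row (direct_sum_mat (L_matrix N) (0\<^sub>m 1 1))" "j < dim_col (direct_sum_mat (L_matrix N) (0\<^sub>m 1 1))"
    then have ij: "i < N + N" "j < N + N"
      using L_matrix_carrier[of N] assms by (simp_all add: direct_sum_mat_def)
    have x: "x < N \<or> (\<exists>k<N - 1. x = N + k) \<or> x = N + N - 1" if "x < N + N" for x
    proof -
      have "x - N < N - 1" "x = N + (x - N)" if "\<not> x < N" "x \<noteq> N + N - 1"
        using that \<open>x < N + N\<close> by auto
      then show ?thesis
        by blast
    qed
    have lhs: "mat (N + N) (N + N) (\<lambda>(i, j). four_block_mat A (A + B) (A + C) (A + C + (B + D)) $$ (\<sigma> i, \<sigma> j)) $$ (i, j) =
        four_block_mat A (A + B) (A + C) (A + C + (B + D)) $$ (\<sigma> i, \<sigma> j)"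
      using ij by simp
    have \<sigma>1: "\<sigma> x = x" if "x < N" for x
      using that by (simp add: \<sigma>_def)
    have \<sigma>2: "\<sigma> (N + k) = N + Suc k" "Suc k < N" if "k < N - 1" for k
      using that by (auto simp: \<sigma>_def)
    have \<sigma>3: "\<sigma> (N + N - 1) = N + 0"
      using assms by (simp add: \<sigma>_def)
    have R: "direct_sum_mat (L_matrix N) (0\<^sub>m 1 1) $$ (x, y) =
        (if x < N + (N - 1) \<and> y < N + (N - 1) then L_matrix N $$ (x, y) else 0)"
      if "x < N + N" "y < N + N" for x y
      using that L_matrix_carrier[of N] by (auto simp: direct_sum_mat_def)
    \<comment> \<open>Against z_x, the exponents of z_y and z_y^* are both -1 for x < y and add up
      to -2; for y < x they are 1 and -1 and cancel.\<close>
    have M1: "four_block_mat A (A + B) (A + C) (A + C + (B + D)) $$ (x, y) = ?F $$ (x, y)"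
      "four_block_mat A (A + B) (A + C) (A + C + (B + D)) $$ (x, N + y) = (if x < y then -2 else 0)"
      "four_block_mat A (A + B) (A + C) (A + C + (B + D)) $$ (N + x, y) = (if y < x then 2 else 0)"
      "four_block_mat A (A + B) (A + C) (A + C + (B + D)) $$ (N + x, N + y) = 0"
      if "x < N" "y < N" for x y
      using that by (auto simp: A_def B_def C_def D_def Fbar_matrix_index)
    show "mat (N + N) (N + N) (\<lambda>(i, j). four_block_mat A (A + B) (A + C) (A + C + (B + D)) $$ (\<sigma> i, \<sigma> j)) $$ (i, j) =
        direct_sum_mat (L_matrix N) (0\<^sub>m 1 1) $$ (i, j)"
      unfolding lhs R[OF ij]
    proof (rule disjE[OF x[OF ij(1)]], goal_cases)
      case i: 1
      show ?case
        using x[OF ij(2)]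
      proof (elim disjE exE conjE)
        fix k assume "k < N - 1" "j = N + k"
        then show ?thesis
          using i M1(2)[of i "Suc k"] \<sigma>2[of k] by (auto simp: \<sigma>1 L_matrix_index)
      next
        assume "j = N + N - 1"
        then show ?thesis
          using i M1(2)[of i 0] \<sigma>3 by (auto simp: \<sigma>1)
      qed (use i M1(1)[of i j] in \<open>auto simp: \<sigma>1 L_matrix_index Fbar_matrix_index\<close>)
    next
      case 2
      then show ?case
      proof (elim disjE exE conjE)
        fix k assume k: "k < N - 1" "i = N + k"
        show ?thesis
          using x[OF ij(2)]
        proof (elim disjE exE conjE)
          fix l assume "l < N - 1" "j = N + l"
          then show ?thesis
            using k M1(4)[of "Suc k" "Suc l"] \<sigma>2[of k] \<sigma>2[of l] by (auto simp: L_matrix_index)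
        next
          assume "j = N + N - 1"
          then show ?thesis
            using k M1(4)[of "Suc k" 0] \<sigma>2[of k] \<sigma>3 by auto
        qed (use k M1(3)[of "Suc k" j] \<sigma>2[of k] in \<open>auto simp: \<sigma>1 L_matrix_index less_Suc_eq_le\<close>)
      next
        assume i: "i = N + N - 1"
        show ?thesis
          using x[OF ij(2)]
        proof (elim disjE exE conjE)
          fix l assume "l < N - 1" "j = N + l"
          then show ?thesis
            using i M1(4)[of 0 "Suc l"] \<sigma>2[of l] \<sigma>3 by auto
        next
          assume "j = N + N - 1"
          then show ?thesis
            using i M1(4)[of 0 0] \<sigma>3 assms by auto
        qed (use i M1(3)[of 0 j] \<sigma>3 in \<open>auto simp: \<sigma>1\<close>)
      qed
    qed
  qed (use L_matrix_carrier[of N] assms in \<open>auto simp: direct_sum_mat_def\<close>)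
  moreover have "N + (N - 1) + 1 = N + N"
    using assms by simp
  ultimately show ?thesis
    using congruent_mat_trans[OF cong congruent_permuted_mat[OF \<sigma> congruent_mat_carrier(2)[OF cong]]]
    by (simp only: M)
qed

lemma nonzero_blocks_Fbar_L:
  assumes "N \<ge> 1"
  shows "nonzero_blocks (Fbar_matrix N) = nonzero_blocks (L_matrix N)" "nonzero_blocks (L_matrix N) \<noteq> {}"
  using nonzero_blocks_direct_sum_zero[OF L_matrix_carrier skew_L_matrix _ Fbar_congruent_L[OF assms]] assms
  by auto

section \<open>Commutation up to a scalar\<close>

text \<open>A complex algebra, given by a homomorphism \<open>sc\<close> from the scalars into the
  center. The same lemmas thus serve the presented algebra, its localization and any division ring
  of fractions.\<close>

locale central_scalars = ring R for R (structure) +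
  fixes sc :: "complex \<Rightarrow> 'a"
  assumes sc_closed [simp]: "sc c \<in> carrier R"
    and sc_add: "sc (c + d) = sc c \<oplus> sc d"
    and sc_mult: "sc (c * d) = sc c \<otimes> sc d"
    and sc_one: "sc 1 = \<one>"
    and sc_central: "x \<in> carrier R \<Longrightarrow> x \<otimes> sc c = sc c \<otimes> x"
begin

definition qcomm :: "complex \<Rightarrow> 'a \<Rightarrow> 'a \<Rightarrow> bool" where
  "qcomm c x y \<longleftrightarrow> x \<otimes> y = sc c \<otimes> (y \<otimes> x)"

lemma sc_zero: "sc 0 = \<zero>"
  using sc_add[of 0 0] add.l_cancel_one'[of "sc 0" "sc 0"] by simp

lemma sc_left_commute:
  "x \<in> carrier R \<Longrightarrow> y \<in> carrier R \<Longrightarrow> x \<otimes> (sc c \<otimes> y) = sc c \<otimes> (x \<otimes> y)"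
  by (metis m_assoc sc_central sc_closed)

lemma sc_cancel: "c \<noteq> 0 \<Longrightarrow> x \<in> carrier R \<Longrightarrow> sc (inverse c) \<otimes> (sc c \<otimes> x) = x"
  by (simp add: sc_one flip: m_assoc sc_mult)

lemma qcomm_1_iff: "x \<in> carrier R \<Longrightarrow> y \<in> carrier R \<Longrightarrow> qcomm 1 x y \<longleftrightarrow> x \<otimes> y = y \<otimes> x"
  by (simp add: qcomm_def sc_one)

lemma qcomm_refl: "x \<in> carrier R \<Longrightarrow> qcomm 1 x x"
  by (simp add: qcomm_1_iff)

lemma qcomm_sym:
  assumes "qcomm c x y" "c \<noteq> 0" "x \<in> carrier R" "y \<in> carrier R"
  shows "qcomm (inverse c) y x"
  using assms sc_cancel[of c "y \<otimes> x"] by (simp add: qcomm_def)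

lemma qcomm_zero: "x \<in> carrier R \<Longrightarrow> qcomm c x \<zero>"
  by (simp add: qcomm_def)

lemma qcomm_add_right:
  "\<lbrakk>qcomm c x y; qcomm c x w; x \<in> carrier R; y \<in> carrier R; w \<in> carrier R\<rbrakk> \<Longrightarrow> qcomm c x (y \<oplus> w)"
  by (simp add: qcomm_def r_distr l_distr)

lemma qcomm_mult_right:
  assumes "qcomm c x y" "qcomm d x w" "x \<in> carrier R" "y \<in> carrier R" "w \<in> carrier R"
  shows "qcomm (c * d) x (y \<otimes> w)"
proof -
  have "x \<otimes> (y \<otimes> w) = (x \<otimes> y) \<otimes> w"
    using assms by (simp add: m_assoc)
  also have "\<dots> = (sc c \<otimes> (y \<otimes> x)) \<otimes> w"
    using assms(1) by (simp only: qcomm_def)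
  also have "\<dots> = sc c \<otimes> (y \<otimes> (x \<otimes> w))"
    using assms by (simp add: m_assoc)
  also have "\<dots> = sc c \<otimes> (y \<otimes> (sc d \<otimes> (w \<otimes> x)))"
    using assms(2) by (simp only: qcomm_def)
  finally show ?thesis
    using assms by (simp add: qcomm_def sc_mult m_assoc sc_left_commute[of y])
qed

lemma qcomm_pow_right:
  "qcomm c x y \<Longrightarrow> x \<in> carrier R \<Longrightarrow> y \<in> carrier R \<Longrightarrow> qcomm (c ^ n) x (y [^] n)"
proof (induction n)
  case 0
  then show ?case
    by (simp add: qcomm_def sc_one)
next
  case (Suc n)
  then show ?case
    using qcomm_mult_right[of "c ^ n" x "y [^] n" c y] by (simp add: mult.commute)
qed

lemma qcomm_inv_right:
  assumes "qcomm c x y" "c \<noteq> 0" "x \<in> carrier R" "y \<in> Units R"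
  shows "qcomm (inverse c) x (inv y)"
proof -
  note y = Units_closed[OF assms(4)] Units_inv_closed[OF assms(4)]
  have "sc c \<otimes> (x \<otimes> inv y) = (inv y \<otimes> y) \<otimes> (sc c \<otimes> (x \<otimes> inv y))"
    using assms y by simp
  also have "\<dots> = inv y \<otimes> (sc c \<otimes> (y \<otimes> x)) \<otimes> inv y"
    using assms y by (simp add: sc_left_commute[of y] m_assoc del: Units_l_inv)
  also have "\<dots> = inv y \<otimes> (x \<otimes> y) \<otimes> inv y"
    using assms(1) by (simp only: qcomm_def)
  also have "\<dots> = inv y \<otimes> x"
    using assms y by (simp add: m_assoc)
  finally show ?thesis
    using assms y sc_cancel[of c "x \<otimes> inv y"] by (simp add: qcomm_def)
qed

end

section \<open>The relations of the quantum sphere algebra in a ring\<close>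

text \<open>\<open>Om\<close> is a parameter, fixed by recursion downwards from
  \<open>Om N = \<zero>\<close>; in this form a ring homomorphism carries it along without finite
  sums.\<close>

locale quantum_relations = central_scalars R sc for R (structure) and sc +
  fixes z zs Om :: "nat \<Rightarrow> 'a" and q :: complex and N :: nat
  assumes q_nonzero: "q \<noteq> 0"
    and z_closed [simp]: "i < N \<Longrightarrow> z i \<in> carrier R"
    and zs_closed [simp]: "i < N \<Longrightarrow> zs i \<in> carrier R"
    and z_z: "i < j \<Longrightarrow> j < N \<Longrightarrow> qcomm (inverse q) (z i) (z j)"
    and zs_zs: "i < j \<Longrightarrow> j < N \<Longrightarrow> qcomm q (zs i) (zs j)"
    and z_zs: "i \<noteq> j \<Longrightarrow> i < N \<Longrightarrow> j < N \<Longrightarrow> qcomm (inverse q) (z i) (zs j)"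
    and Om_N: "Om N = \<zero>"
    and Om_step: "i < N \<Longrightarrow> Om i = z i \<otimes> zs i \<oplus> Om (Suc i)"
    and z_zs_same: "i < N \<Longrightarrow> z i \<otimes> zs i = zs i \<otimes> z i \<oplus> sc (q\<^sup>2 - 1) \<otimes> Om (Suc i)"
begin

lemma Om_closed [simp]: "j \<le> N \<Longrightarrow> Om j \<in> carrier R"
  by (induction rule: inc_induct) (simp_all add: Om_N Om_step)

lemma qcomm_Om:
  assumes "j \<le> N" "x \<in> carrier R" "\<And>k. j \<le> k \<Longrightarrow> k < N \<Longrightarrow> qcomm c x (z k \<otimes> zs k)"
  shows "qcomm c x (Om j)"
  using assms
proof (induction rule: inc_induct)
  case base
  then show ?case
    by (simp add: Om_N qcomm_zero)
next
  case (step n)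
  then show ?case
    by (simp add: Om_step qcomm_add_right)
qed

lemma z_Om_greater: "l < j \<Longrightarrow> j \<le> N \<Longrightarrow> qcomm (inverse (q\<^sup>2)) (z l) (Om j)"
proof (rule qcomm_Om)
  fix k assume "l < j" "j \<le> k" "k < N"
  then show "qcomm (inverse (q\<^sup>2)) (z l) (z k \<otimes> zs k)"
    using qcomm_mult_right[OF z_z[of l k] z_zs[of l k]] by (simp add: power2_eq_square)
qed auto

lemma zs_z: "i \<noteq> j \<Longrightarrow> i < N \<Longrightarrow> j < N \<Longrightarrow> qcomm q (zs i) (z j)"
  using qcomm_sym[OF z_zs[of j i]] q_nonzero by simp

lemma zs_Om_greater: "l < j \<Longrightarrow> j \<le> N \<Longrightarrow> qcomm (q\<^sup>2) (zs l) (Om j)"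
proof (rule qcomm_Om)
  fix k assume "l < j" "j \<le> k" "k < N"
  then show "qcomm (q\<^sup>2) (zs l) (z k \<otimes> zs k)"
    using qcomm_mult_right[OF zs_z[of l k] zs_zs[of l k]] by (simp add: power2_eq_square)
qed auto

text \<open>Commuting z_l past z_l zs_l leaves (q^2 - 1) z_l Om_(l+1), by the last relation.
  Commuting it past Om_(l+1) leaves the opposite, as Om_(l+1) z_l = q^2 z_l Om_(l+1). The constant
  q^2 - 1 is just right for this.\<close>

lemma z_Om_same:
  assumes "l < N"
  shows "qcomm 1 (z l) (Om l)"
proof -
  let ?a = "z l" and ?s = "zs l" and ?o = "Om (Suc l)" and ?e = "sc (q\<^sup>2 - 1)"
  have c: "?a \<in> carrier R" "?s \<in> carrier R" "?o \<in> carrier R"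
    using assms by simp_all
  have "qcomm (q\<^sup>2) ?o ?a"
    using qcomm_sym[OF z_Om_greater[of l "Suc l"]] assms q_nonzero by simp
  then have oa: "?o \<otimes> ?a = ?e \<otimes> (?a \<otimes> ?o) \<oplus> ?a \<otimes> ?o"
    using c sc_add[of "q\<^sup>2 - 1" 1] by (simp add: qcomm_def sc_one l_distr)
  have "?a \<otimes> (?a \<otimes> ?s) = ?a \<otimes> (?s \<otimes> ?a) \<oplus> ?e \<otimes> (?a \<otimes> ?o)"
    using c by (simp add: z_zs_same[OF assms] r_distr sc_left_commute)
  then show ?thesis
    using c assms by (simp add: qcomm_1_iff Om_step oa r_distr l_distr m_assoc a_assoc)
qed

lemma zs_Om_same:
  assumes "l < N"
  shows "qcomm 1 (zs l) (Om l)"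
proof -
  let ?a = "z l" and ?s = "zs l" and ?o = "Om (Suc l)" and ?e = "sc (q\<^sup>2 - 1)"
  have c: "?a \<in> carrier R" "?s \<in> carrier R" "?o \<in> carrier R"
    using assms by simp_all
  have "qcomm (q\<^sup>2) ?s ?o"
    using zs_Om_greater[of l "Suc l"] assms by simp
  then have so: "?s \<otimes> ?o = ?e \<otimes> (?o \<otimes> ?s) \<oplus> ?o \<otimes> ?s"
    using c sc_add[of "q\<^sup>2 - 1" 1] by (simp add: qcomm_def sc_one l_distr)
  have "(?a \<otimes> ?s) \<otimes> ?s = ?s \<otimes> (?a \<otimes> ?s) \<oplus> ?e \<otimes> (?o \<otimes> ?s)"
    using c by (simp add: z_zs_same[OF assms] l_distr m_assoc)
  then show ?thesis
    using c assms by (simp add: qcomm_1_iff Om_step so r_distr l_distr a_assoc)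
qed

text \<open>The induction starts from \<open>Om l\<close>; each further summand z_k zs_k with k < l
  contributes the factors q and 1/q, which cancel.\<close>

lemma commute_Om_le:
  assumes "x = z \<or> x = zs" "j \<le> l" "l < N"
  shows "qcomm 1 (x l) (Om j)"
  using assms(2)
proof (induction rule: inc_induct)
  case base
  then show ?case
    using assms z_Om_same zs_Om_same by auto
next
  case (step k)
  have "qcomm 1 (x l) (z k \<otimes> zs k)"
  proof (cases "x = z")
    case True
    have "qcomm q (z l) (z k)"
      using qcomm_sym[OF z_z[of k l]] step q_nonzero assms(3) by simp
    then have "qcomm (q * inverse q) (z l) (z k \<otimes> zs k)"
      by (rule qcomm_mult_right) (use step assms(3) in \<open>simp_all add: z_zs\<close>)
    then show ?thesis
      using True q_nonzero by simp
  next
    case False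
    have "qcomm (inverse q) (zs l) (zs k)"
      using qcomm_sym[OF zs_zs[of k l]] step q_nonzero assms(3) by simp
    with zs_z[of l k] have "qcomm (q * inverse q) (zs l) (z k \<otimes> zs k)"
      using step assms(3) by (intro qcomm_mult_right) simp_all
    then show ?thesis
      using False assms(1) q_nonzero by simp
  qed
  moreover have "x l \<in> carrier R"
    using assms by auto
  ultimately show ?case
    using step assms(3) by (simp add: Om_step qcomm_add_right)
qed

lemmas z_Om_le = commute_Om_le[OF disjI1[OF refl]]
lemmas zs_Om_le = commute_Om_le[OF disjI2[OF refl]]

lemma Om_Om:
  assumes "i \<le> N" "j \<le> N"
  shows "qcomm 1 (Om i) (Om j)"
proof -
  have le: "qcomm 1 (Om i) (Om j)" if "i \<le> j" "j \<le> N" for i j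
  proof (rule qcomm_Om[OF that(2)])
    fix k assume k: "j \<le> k" "k < N"
    have "qcomm (1 * 1) (Om i) (z k \<otimes> zs k)"
      using qcomm_sym[OF z_Om_le[of i k]] qcomm_sym[OF zs_Om_le[of i k]] that k
      by (intro qcomm_mult_right) simp_all
    then show "qcomm 1 (Om i) (z k \<otimes> zs k)"
      by simp
  qed (use that in simp)
  show ?thesis
  proof (cases "i \<le> j")
    case False
    then show ?thesis
      using qcomm_sym[OF le[of j i]] assms by simp
  qed (use le assms in simp)
qed

end

section \<open>Dimensions and centralizers\<close>

lemma sum_powers_root_of_unity:
  fixes w :: complex
  assumes "w ^ m = 1" "w \<noteq> 1"
  shows "(\<Sum>k<m. w ^ k) = 0"
  using geometric_sum[OF assms(2), of m] assms(1) by simp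

text \<open>Regularity of \<open>y\<close> fits both uses: translating eigenspaces by a unit, and
  multiplying by a nonzero element of a domain.\<close>

lemma (in ring) dimension_image_left_mult:
  assumes K: "subfield K R" and central: "\<And>k. k \<in> K \<Longrightarrow> y \<otimes> k = k \<otimes> y"
    and y: "y \<in> carrier R" and inj: "\<And>d. d \<in> carrier R \<Longrightarrow> y \<otimes> d = \<zero> \<Longrightarrow> d = \<zero>"
    and dim: "dimension n K E"
  shows "dimension n K ((\<otimes>) y ` E)"
  using dim K central
proof (induction rule: dimension.induct)
  case (zero_dim K)
  then show ?case
    using y by simp
next
  case (Suc_dim v E n K)
  note Kc = subfieldE(3)[OF Suc_dim.prems(1)]
  note E = space_subgroup_props[OF Suc_dim.prems(1) Suc_dim.hyps(3)]
  have "(\<otimes>) y ` line_extension K v E = line_extension K (y \<otimes> v) ((\<otimes>) y ` E)"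
  proof -
    have "y \<otimes> (k \<otimes> v \<oplus> e) = k \<otimes> (y \<otimes> v) \<oplus> y \<otimes> e" if "k \<in> K" "e \<in> E" for k e
    proof -
      have c: "k \<in> carrier R" "e \<in> carrier R"
        using that Kc E(1) by auto
      then have "y \<otimes> (k \<otimes> v) = k \<otimes> (y \<otimes> v)"
        using Suc_dim.prems(2)[OF that(1)] Suc_dim.hyps(1) y by (metis m_assoc)
      then show ?thesis
        using c y Suc_dim.hyps(1) by (simp add: r_distr)
    qed
    note eq = this
    show ?thesis
    proof (intro equalityI subsetI)
      fix u assume "u \<in> (\<otimes>) y ` line_extension K v E"
      then obtain k e where "k \<in> K" "e \<in> E" "u = y \<otimes> (k \<otimes> v \<oplus> e)"
        by (auto simp: line_extension_mem_iff)
      then show "u \<in> line_extension K (y \<otimes> v) ((\<otimes>) y ` E)"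
        unfolding line_extension_mem_iff using eq by blast
    next
      fix u assume "u \<in> line_extension K (y \<otimes> v) ((\<otimes>) y ` E)"
      then obtain k e where ke: "k \<in> K" "e \<in> E" "u = k \<otimes> (y \<otimes> v) \<oplus> y \<otimes> e"
        by (auto simp: line_extension_mem_iff)
      then have "k \<otimes> v \<oplus> e \<in> line_extension K v E"
        by (auto simp: line_extension_mem_iff)
      then show "u \<in> (\<otimes>) y ` line_extension K v E"
        using eq[OF ke(1,2)] ke(3) by (intro image_eqI) auto
    qed
  qed
  moreover have "y \<otimes> v \<notin> (\<otimes>) y ` E"
  proof
    assume "y \<otimes> v \<in> (\<otimes>) y ` E"
    then obtain e where e: "e \<in> E" "y \<otimes> v = y \<otimes> e"
      by auto
    then have "y \<otimes> (v \<ominus> e) = \<zero>"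
      using y E(1) Suc_dim.hyps(1) by (auto simp: minus_eq r_distr r_minus r_neg)
    then have "v \<ominus> e = \<zero>"
      using inj E(1) e(1) Suc_dim.hyps(1) by auto
    then have "v = e"
      using E(1) e(1) Suc_dim.hyps(1) by (auto simp: r_right_minus_eq)
    then show False
      using e(1) Suc_dim.hyps(2) by simp
  qed
  ultimately show ?case
    using dimension.Suc_dim[of "y \<otimes> v" "(\<otimes>) y ` E" n K] Suc_dim y by simp
qed

text \<open>Recursion at the upper end suits \<open>partial_sum_shift\<close>, by which a sum over a
  cycle of indices is rotated.\<close>

primrec (in ring) partial_sum :: "(nat \<Rightarrow> 'a) \<Rightarrow> nat \<Rightarrow> 'a" where
  "partial_sum t 0 = \<zero>"
| "partial_sum t (Suc n) = partial_sum t n \<oplus> t n"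

context ring
begin

lemma partial_sum_closed [simp]:
  "(\<And>k. k < n \<Longrightarrow> t k \<in> carrier R) \<Longrightarrow> partial_sum t n \<in> carrier R"
  by (induction n) simp_all

lemma partial_sum_add:
  assumes "\<And>k. k < n \<Longrightarrow> t k \<in> carrier R" "\<And>k. k < n \<Longrightarrow> u k \<in> carrier R"
  shows "partial_sum (\<lambda>k. t k \<oplus> u k) n = partial_sum t n \<oplus> partial_sum u n"
  using assms by (induction n) (simp_all add: a_ac)

lemma partial_sum_mult_left:
  assumes "\<And>k. k < n \<Longrightarrow> t k \<in> carrier R" "x \<in> carrier R"
  shows "x \<otimes> partial_sum t n = partial_sum (\<lambda>k. x \<otimes> t k) n"
  using assms by (induction n) (simp_all add: r_distr)

lemma partial_sum_mult_right:
  assumes "\<And>k. k < n \<Longrightarrow> t k \<in> carrier R" "x \<in> carrier R"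
  shows "partial_sum t n \<otimes> x = partial_sum (\<lambda>k. t k \<otimes> x) n"
  using assms by (induction n) (simp_all add: l_distr)

lemma partial_sum_shift:
  assumes "\<And>k. k \<le> n \<Longrightarrow> t k \<in> carrier R"
  shows "t 0 \<oplus> partial_sum (\<lambda>k. t (Suc k)) n = partial_sum t n \<oplus> t n"
  using assms
proof (induction n)
  case (Suc n)
  have "t 0 \<oplus> partial_sum (\<lambda>k. t (Suc k)) (Suc n) = (t 0 \<oplus> partial_sum (\<lambda>k. t (Suc k)) n) \<oplus> t (Suc n)"
    using Suc.prems by (simp add: a_assoc)
  also have "t 0 \<oplus> partial_sum (\<lambda>k. t (Suc k)) n = partial_sum t n \<oplus> t n"
    using Suc by simp
  finally show ?case
    by simp
qed simp

definition centralizer :: "'a set \<Rightarrow> 'a set" where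
  "centralizer S = {d \<in> carrier R. \<forall>s\<in>S. s \<otimes> d = d \<otimes> s}"

lemma centralizer_closed: "d \<in> centralizer S \<Longrightarrow> d \<in> carrier R"
  by (simp add: centralizer_def)

lemma centralizer_mult:
  assumes "S \<subseteq> carrier R" "d \<in> centralizer S" "e \<in> centralizer S"
  shows "d \<otimes> e \<in> centralizer S"
proof -
  have "s \<otimes> (d \<otimes> e) = d \<otimes> e \<otimes> s" if "s \<in> S" for s
  proof -
    have c: "s \<in> carrier R" "d \<in> carrier R" "e \<in> carrier R" and sd: "s \<otimes> d = d \<otimes> s" and se: "s \<otimes> e = e \<otimes> s"
      using assms that by (auto simp: centralizer_def)
    have "s \<otimes> (d \<otimes> e) = d \<otimes> (s \<otimes> e)"
      using c by (simp add: sd flip: m_assoc)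
    then show ?thesis
      using c by (simp add: se m_assoc)
  qed
  then show ?thesis
    using assms by (simp add: centralizer_def)
qed

lemma centralizer_add:
  assumes "S \<subseteq> carrier R" "d \<in> centralizer S" "e \<in> centralizer S"
  shows "d \<oplus> e \<in> centralizer S"
proof -
  have "s \<otimes> (d \<oplus> e) = (d \<oplus> e) \<otimes> s" if "s \<in> S" for s
  proof -
    have c: "s \<in> carrier R" "d \<in> carrier R" "e \<in> carrier R" and sd: "s \<otimes> d = d \<otimes> s" and se: "s \<otimes> e = e \<otimes> s"
      using assms that by (auto simp: centralizer_def)
    then show ?thesis
      by (simp add: r_distr l_distr)
  qed
  then show ?thesis
    using assms by (simp add: centralizer_def)
qed

lemma centralizer_zero: "S \<subseteq> carrier R \<Longrightarrow> \<zero> \<in> centralizer S"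
  by (auto simp: centralizer_def)

lemma centralizer_one: "S \<subseteq> carrier R \<Longrightarrow> \<one> \<in> centralizer S"
  by (auto simp: centralizer_def)

lemma centralizer_pow:
  "S \<subseteq> carrier R \<Longrightarrow> d \<in> centralizer S \<Longrightarrow> d [^] (n::nat) \<in> centralizer S"
  by (induction n) (simp_all add: centralizer_one centralizer_mult)

lemma centralizer_inv:
  assumes "S \<subseteq> carrier R" "d \<in> centralizer S" "d \<in> Units R"
  shows "inv d \<in> centralizer S"
proof -
  have "s \<otimes> inv d = inv d \<otimes> s" if "s \<in> S" for s
  proof -
    have s: "s \<in> carrier R" and d: "d \<in> carrier R" "inv d \<in> carrier R" and sd: "s \<otimes> d = d \<otimes> s"
      using assms that by (auto simp: centralizer_def)
    have "s \<otimes> inv d = (inv d \<otimes> d) \<otimes> s \<otimes> inv d"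
      using s assms(3) by simp
    also have "\<dots> = inv d \<otimes> (s \<otimes> d) \<otimes> inv d"
      using s d by (simp only: sd m_assoc m_closed)
    also have "\<dots> = inv d \<otimes> s"
      using s d assms(3) by (simp add: m_assoc)
    finally show ?thesis .
  qed
  then show ?thesis
    using assms by (simp add: centralizer_def)
qed

lemma centralizer_insert: "centralizer (insert x S) = {d \<in> centralizer S. x \<otimes> d = d \<otimes> x}"
  by (auto simp: centralizer_def)

lemma pow_inv_Units:
  assumes "x \<in> Units R"
  shows "x [^] (k::nat) \<in> Units R" "inv x [^] k = inv (x [^] k)"
proof -
  have c: "x \<in> carrier R" "inv x \<in> carrier R"
    using assms by auto
  have 1: "x [^] k \<otimes> inv x [^] k = \<one>"
  proof (induction k)
    case (Suc k)
    have "x [^] Suc k \<otimes> inv x [^] Suc k = x [^] k \<otimes> x \<otimes> (inv x \<otimes> inv x [^] k)"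
      using c nat_pow_Suc2[of "inv x" k] by simp
    also have "\<dots> = x [^] k \<otimes> ((x \<otimes> inv x) \<otimes> inv x [^] k)"
      using c by (simp add: m_assoc del: Units_r_inv)
    finally show ?case
      using Suc c assms by simp
  qed simp
  have 2: "inv x [^] k \<otimes> x [^] k = \<one>"
  proof (induction k)
    case (Suc k)
    have "inv x [^] Suc k \<otimes> x [^] Suc k = inv x [^] k \<otimes> inv x \<otimes> (x \<otimes> x [^] k)"
      using c nat_pow_Suc2[of x k] by simp
    also have "\<dots> = inv x [^] k \<otimes> ((inv x \<otimes> x) \<otimes> x [^] k)"
      using c by (simp add: m_assoc del: Units_l_inv)
    finally show ?case
      using Suc c assms by simp
  qed simp
  show "x [^] k \<in> Units R"
    unfolding Units_def using c 1 2 by (auto intro!: bexI[of _ "inv x [^] k"])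
  show "inv x [^] k = inv (x [^] k)"
    using c 1 2 inv_unique'[of "x [^] k" "inv x [^] k"] by simp
qed

end

section \<open>Eigenspaces of the conjugation by a unit\<close>

locale central_subfield = central_scalars R sc for R (structure) and sc +
  fixes K :: "'a set"
  assumes K_subfield: "subfield K R"
    and K_center: "K \<subseteq> ring_center R"
    and sc_in_K: "sc c \<in> K"
begin

lemma K_carrier: "k \<in> K \<Longrightarrow> k \<in> carrier R"
  using subfieldE(3)[OF K_subfield] by auto

lemma K_commute: "k \<in> K \<Longrightarrow> x \<in> carrier R \<Longrightarrow> x \<otimes> k = k \<otimes> x"
  using K_center by (auto simp: ring_center_def)

lemma centralizer_smult:
  assumes "S \<subseteq> carrier R" "d \<in> centralizer S" "k \<in> K"
  shows "k \<otimes> d \<in> centralizer S"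
  by (rule centralizer_mult[OF assms(1) _ assms(2)])
    (use assms K_carrier K_commute in \<open>auto simp: centralizer_def\<close>)

end

text \<open>Conjugation by \<open>x\<close> maps the centralizer of \<open>S\<close> to itself by
  \<open>xS\<close>, and its m-th power is the identity by \<open>xm\<close>, so it is
  diagonalizable with eigenvalues among the powers of \<open>w\<close>. By \<open>yS\<close> and
  \<open>xy\<close>, left multiplication by \<open>y\<close> shifts each eigenspace onto the
  next.\<close>

locale conjugation_step = central_subfield R sc K for R (structure) and sc and K +
  fixes S :: "'a set" and x y :: 'a and w :: complex and m :: nat
  assumes S: "S \<subseteq> carrier R"
    and x: "x \<in> Units R" and y: "y \<in> Units R" and yS: "y \<in> centralizer S"
    and xS: "\<And>s. s \<in> S \<Longrightarrow> \<exists>c. c \<noteq> 0 \<and> qcomm c s x"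
    and xm: "\<And>d. d \<in> carrier R \<Longrightarrow> x [^] m \<otimes> d = d \<otimes> x [^] m"
    and xy: "qcomm w x y"
    and m: "0 < m" and wm: "w ^ m = 1" and w_primitive: "\<And>k. 0 < k \<Longrightarrow> k < m \<Longrightarrow> w ^ k \<noteq> 1"
begin

abbreviation C where "C \<equiv> centralizer S"

definition eigenspace :: "nat \<Rightarrow> 'a set" where
  "eigenspace c = {d \<in> C. qcomm (w ^ c) x d}"

lemma w0: "w \<noteq> 0"
  using wm m by (auto simp: zero_power)

lemma x_closed: "x \<in> carrier R" "inv x \<in> carrier R"
  using x by auto

lemma y_closed: "y \<in> carrier R" "inv y \<in> carrier R"
  using y by auto

lemma C_closed: "d \<in> C \<Longrightarrow> d \<in> carrier R"
  by (rule centralizer_closed)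

lemma eigenspace_0: "eigenspace 0 = centralizer (insert x S)"
  using x_closed by (auto simp: eigenspace_def centralizer_insert qcomm_1_iff C_closed)

lemma eigenspace_image: "eigenspace c = (\<otimes>) (y [^] c) ` eigenspace 0"
proof (intro equalityI subsetI)
  fix d assume "d \<in> (\<otimes>) (y [^] c) ` eigenspace 0"
  then obtain e where e: "e \<in> C" "qcomm 1 x e" "d = y [^] c \<otimes> e"
    by (auto simp: eigenspace_def)
  then have "qcomm (w ^ c * 1) x d"
    unfolding e(3) using xy x_closed y_closed C_closed by (intro qcomm_mult_right qcomm_pow_right) auto
  then show "d \<in> eigenspace c"
    using e centralizer_mult[OF S centralizer_pow[OF S yS] e(1)] by (simp add: eigenspace_def)
next
  fix d assume d: "d \<in> eigenspace c"
  let ?u = "y [^] c"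
  note u = pow_inv_Units(1)[OF y, of c]
  have dC: "d \<in> C" "d \<in> carrier R"
    using d C_closed by (auto simp: eigenspace_def)
  have "qcomm (inverse (w ^ c) * w ^ c) x (inv ?u \<otimes> d)"
    using d xy x_closed y_closed u w0 dC
    by (intro qcomm_mult_right qcomm_inv_right qcomm_pow_right) (auto simp: eigenspace_def)
  then have "inv ?u \<otimes> d \<in> eigenspace 0"
    using w0 centralizer_mult[OF S centralizer_inv[OF S centralizer_pow[OF S yS] u] dC(1)]
    by (simp add: eigenspace_def)
  moreover have "d = ?u \<otimes> (inv ?u \<otimes> d)"
    using u dC m_assoc[of ?u "inv ?u" d] Units_closed[OF u] by simp
  ultimately show "d \<in> (\<otimes>) ?u ` eigenspace 0"
    by blast
qed

lemma dimension_eigenspace: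
  assumes "dimension n K (eigenspace 0)"
  shows "dimension n K (eigenspace c)"
  unfolding eigenspace_image[of c]
proof (rule dimension_image_left_mult[OF K_subfield _ _ _ assms])
  fix d assume d: "d \<in> carrier R" "y [^] c \<otimes> d = \<zero>"
  then have "inv (y [^] c) \<otimes> (y [^] c \<otimes> d) = \<zero>"
    using pow_inv_Units(1)[OF y, of c] by simp
  then show "d = \<zero>"
    using d pow_inv_Units(1)[OF y, of c] m_assoc[of "inv (y [^] c)" "y [^] c" d] y_closed by simp
qed (use y_closed K_commute in auto)

definition conj_pow :: "nat \<Rightarrow> 'a \<Rightarrow> 'a" where
  "conj_pow k d = x [^] k \<otimes> d \<otimes> inv x [^] k"

text \<open>For the coefficients w^(-ck) this is m times the projection onto eigenspace
  \<open>c\<close>. General coefficients allow these projections to be summed over c inside the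
  argument \<open>a\<close>.\<close>

definition average :: "(nat \<Rightarrow> complex) \<Rightarrow> 'a \<Rightarrow> 'a" where
  "average a d = partial_sum (\<lambda>k. sc (a k) \<otimes> conj_pow k d) m"

lemma conj_pow_closed [simp]: "d \<in> carrier R \<Longrightarrow> conj_pow k d \<in> carrier R"
  using x_closed by (simp add: conj_pow_def)

lemma average_closed [simp]: "d \<in> carrier R \<Longrightarrow> average a d \<in> carrier R"
  by (simp add: average_def)

lemma conj_pow_Suc:
  assumes "d \<in> carrier R"
  shows "conj_pow (Suc k) d = x \<otimes> conj_pow k d \<otimes> inv x"
  using assms x_closed nat_pow_Suc2[of x k] by (simp add: conj_pow_def m_assoc)

lemma conj_pow_eigen:
  assumes "qcomm c x d" "d \<in> carrier R"
  shows "conj_pow k d = sc (c ^ k) \<otimes> d"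
proof (induction k)
  case (Suc k)
  have "conj_pow (Suc k) d = x \<otimes> (sc (c ^ k) \<otimes> d) \<otimes> inv x"
    by (simp add: conj_pow_Suc assms(2) Suc)
  also have "\<dots> = sc (c ^ k) \<otimes> (x \<otimes> d) \<otimes> inv x"
    using x_closed assms(2) by (simp add: sc_left_commute)
  also have "\<dots> = sc (c ^ k) \<otimes> (sc c \<otimes> d \<otimes> (x \<otimes> inv x))"
    using x_closed assms by (simp add: qcomm_def m_assoc del: Units_r_inv)
  finally show ?case
    using x assms(2) by (simp add: mult.commute[of c] sc_mult m_assoc)
qed (use assms in \<open>simp add: conj_pow_def sc_one\<close>)

lemma average_add_right:
  assumes "d \<in> carrier R" "e \<in> carrier R"
  shows "average a (d \<oplus> e) = average a d \<oplus> average a e"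
  unfolding average_def using assms x_closed
  by (subst partial_sum_add[symmetric]) (auto simp: conj_pow_def r_distr l_distr)

lemma average_add_left:
  assumes "d \<in> carrier R"
  shows "average (\<lambda>k. a k + b k) d = average a d \<oplus> average b d"
  unfolding average_def using assms
  by (subst partial_sum_add[symmetric]) (auto simp: sc_add l_distr)

lemma average_eigen:
  assumes "qcomm c x d" "d \<in> carrier R"
  shows "average a d = sc (\<Sum>k<m. a k * c ^ k) \<otimes> d"
proof -
  have "partial_sum (\<lambda>k. sc (a k) \<otimes> conj_pow k d) n = sc (\<Sum>k<n. a k * c ^ k) \<otimes> d" for n
    by (induction n) (use assms in \<open>simp_all add: conj_pow_eigen sc_zero sc_add sc_mult l_distr m_assoc\<close>)
  then show ?thesis
    by (simp add: average_def)
qed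

text \<open>Orthogonality of the characters k -> w^(ck) of the integers modulo m.\<close>

lemma eigen_ratio:
  assumes "c < m" "c' < m" "c \<noteq> c'"
  shows "(\<Sum>k<m. inverse (w ^ c) ^ k * (w ^ c') ^ k) = 0"
proof -
  have "inverse (w ^ c) * w ^ c' \<noteq> 1"
  proof
    assume "inverse (w ^ c) * w ^ c' = 1"
    then have eq: "w ^ c' = w ^ c"
      using w0 by (simp add: field_simps)
    show False
    proof (cases "c < c'")
      case True
      then have "w ^ c * w ^ (c' - c) = w ^ c * 1"
        using eq True power_add[of w c "c' - c"] by simp
      then show False
        using w_primitive[of "c' - c"] w0 True assms by simp
    next
      case False
      then have "w ^ c' * w ^ (c - c') = w ^ c' * 1"
        using eq False power_add[of w c' "c - c'"] by simp
      then show False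
        using w_primitive[of "c - c'"] w0 False assms by simp
    qed
  qed
  moreover have "(inverse (w ^ c) * w ^ c') ^ m = 1"
    using wm by (simp add: power_mult_distrib power_inverse flip: power_mult) (simp add: mult.commute[of _ m] power_mult)
  ultimately show ?thesis
    using sum_powers_root_of_unity by (simp flip: power_mult_distrib)
qed

lemma conjugate_C:
  assumes "d \<in> C"
  shows "x \<otimes> d \<otimes> inv x \<in> C"
proof -
  have "s \<otimes> (x \<otimes> d \<otimes> inv x) = x \<otimes> d \<otimes> inv x \<otimes> s" if s: "s \<in> S" for s
  proof -
    obtain c where c: "c \<noteq> 0" "qcomm c s x"
      using xS[OF s] by blast
    have sc: "s \<in> carrier R" and dc: "d \<in> carrier R"
      using S s assms C_closed by auto
    have "qcomm 1 s d"
      using assms s sc dc by (simp add: qcomm_1_iff centralizer_def)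
    then have "qcomm (c * 1 * inverse c) s (x \<otimes> d \<otimes> inv x)"
      using c x x_closed sc dc by (intro qcomm_mult_right qcomm_inv_right) auto
    then show ?thesis
      using c(1) sc dc x_closed by (simp add: qcomm_1_iff)
  qed
  moreover have "x \<otimes> d \<otimes> inv x \<in> carrier R"
    using C_closed[OF assms] x_closed by simp
  ultimately show ?thesis
    unfolding centralizer_def by blast
qed

lemma conj_pow_C: "d \<in> C \<Longrightarrow> conj_pow k d \<in> C"
proof (induction k)
  case 0
  then show ?case
    using C_closed by (simp add: conj_pow_def)
next
  case (Suc k)
  then show ?case
    by (simp add: conj_pow_Suc C_closed conjugate_C)
qed

lemma average_C: "d \<in> C \<Longrightarrow> average a d \<in> C"
proof -
  assume d: "d \<in> C"
  have "partial_sum (\<lambda>k. sc (a k) \<otimes> conj_pow k d) n \<in> C" for n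
    by (induction n) (use d S in \<open>simp_all add: centralizer_zero centralizer_add centralizer_smult conj_pow_C sc_in_K\<close>)
  then show ?thesis
    by (simp add: average_def)
qed

lemma conj_pow_m: "d \<in> carrier R \<Longrightarrow> conj_pow m d = d"
  using xm[of d] pow_inv_Units[OF x, of m] x_closed by (simp add: conj_pow_def m_assoc)

text \<open>Conjugating the sum by \<open>x\<close> raises every index by one and takes out w^c.
  This rotation leaves the sum unchanged because its terms for m and 0 agree, x^m being central and
  w^m = 1.\<close>

lemma average_eigenspace:
  assumes d: "d \<in> C"
  shows "average (\<lambda>k. inverse (w ^ c) ^ k) d \<in> eigenspace c"
proof -
  note dc = C_closed[OF d]
  let ?a = "\<lambda>k. inverse (w ^ c) ^ k"
  let ?t = "\<lambda>k. sc (?a k) \<otimes> conj_pow k d"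
  let ?A = "average ?a d"
  have 1: "?t m = ?t 0"
  proof -
    have "inverse (w ^ c) ^ m = 1"
      using wm by (simp add: power_inverse flip: power_mult) (simp add: mult.commute[of _ m] power_mult)
    then show ?thesis
      using dc conj_pow_m[OF dc] by (simp add: conj_pow_def)
  qed
  have "?t 0 \<oplus> partial_sum (\<lambda>k. ?t (Suc k)) m = ?t 0 \<oplus> ?A"
    using partial_sum_shift[of m ?t] dc 1 by (simp add: average_def a_comm)
  then have 2: "partial_sum (\<lambda>k. ?t (Suc k)) m = ?A"
    using dc by (simp add: add.l_cancel)
  have 3: "x \<otimes> ?t k \<otimes> inv x = sc (w ^ c) \<otimes> ?t (Suc k)" for k
  proof -
    have a: "w ^ c * ?a (Suc k) = ?a k"
      using w0 by simp
    have "sc (w ^ c) \<otimes> ?t (Suc k) = sc (w ^ c * ?a (Suc k)) \<otimes> conj_pow (Suc k) d"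
      using dc by (simp add: sc_mult m_assoc del: power_Suc)
    then have "sc (w ^ c) \<otimes> ?t (Suc k) = sc (?a k) \<otimes> conj_pow (Suc k) d"
      by (simp only: a)
    moreover have "x \<otimes> ?t k \<otimes> inv x = sc (?a k) \<otimes> conj_pow (Suc k) d"
      using dc x_closed by (simp add: sc_left_commute[of x] conj_pow_Suc m_assoc)
    ultimately show ?thesis
      by (simp only:)
  qed
  have "x \<otimes> ?A \<otimes> inv x = partial_sum (\<lambda>k. x \<otimes> ?t k \<otimes> inv x) m"
    using dc x_closed by (simp add: average_def partial_sum_mult_left partial_sum_mult_right)
  also have "\<dots> = partial_sum (\<lambda>k. sc (w ^ c) \<otimes> ?t (Suc k)) m"
    by (simp only: 3)
  also have "\<dots> = sc (w ^ c) \<otimes> partial_sum (\<lambda>k. ?t (Suc k)) m"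
    using dc by (intro partial_sum_mult_left[symmetric]) auto
  finally have "x \<otimes> ?A \<otimes> inv x = sc (w ^ c) \<otimes> ?A"
    by (simp only: 2)
  then have "x \<otimes> ?A \<otimes> inv x \<otimes> x = sc (w ^ c) \<otimes> ?A \<otimes> x"
    by simp
  then have "qcomm (w ^ c) x ?A"
    using dc x x_closed by (simp add: qcomm_def m_assoc)
  then show ?thesis
    using average_C[OF d] by (simp add: eigenspace_def)
qed

primrec eigen_sum :: "nat \<Rightarrow> 'a set" where
  "eigen_sum 0 = {\<zero>}"
| "eigen_sum (Suc c) = eigen_sum c <+> eigenspace c"

lemma eigen_sum_subset: "eigen_sum c \<subseteq> C"
  by (induction c) (auto simp: set_add_def' eigenspace_def centralizer_zero[OF S] intro: centralizer_add[OF S])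

lemma average_eigen_sum:
  "j \<le> c \<Longrightarrow> c < m \<Longrightarrow> d \<in> eigen_sum j \<Longrightarrow> average (\<lambda>k. inverse (w ^ c) ^ k) d = \<zero>"
proof (induction j arbitrary: d)
  case 0
  have "average (\<lambda>k. inverse (w ^ c) ^ k) \<zero> = \<zero>"
    using average_eigen[OF qcomm_zero[of x 1]] x_closed by simp
  then show ?case
    using 0 by simp
next
  case (Suc j)
  then obtain e f where d: "d = e \<oplus> f" "e \<in> eigen_sum j" "f \<in> eigenspace j"
    by (auto simp: set_add_def')
  have c: "e \<in> carrier R" "f \<in> carrier R" and f: "qcomm (w ^ j) x f"
    using d eigen_sum_subset C_closed by (auto simp: eigenspace_def)
  have "average (\<lambda>k. inverse (w ^ c) ^ k) f = \<zero>"
    unfolding average_eigen[OF f c(2)] using Suc.prems c by (subst eigen_ratio) (auto simp: sc_zero)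
  then show ?case
    using Suc c d by (simp add: average_add_right)
qed

lemma sc_of_nat_cancel:
  assumes "d \<in> carrier R" "sc (of_nat m) \<otimes> d = e"
  shows "d = sc (inverse (of_nat m)) \<otimes> e"
  using assms m by (auto simp: sc_cancel)

text \<open>The average belonging to \<open>c\<close> multiplies eigenspace \<open>c\<close> by m
  and kills the earlier ones; m is an invertible scalar.\<close>

lemma eigen_sum_Int: "c < m \<Longrightarrow> eigen_sum c \<inter> eigenspace c = {\<zero>}"
proof (intro equalityI subsetI)
  fix d assume c: "c < m" and d: "d \<in> eigen_sum c \<inter> eigenspace c"
  then have dc: "d \<in> carrier R" "qcomm (w ^ c) x d"
    using C_closed by (auto simp: eigenspace_def)
  have "(inverse (w ^ c)) ^ k * (w ^ c) ^ k = 1" for k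
    using w0 by (simp flip: power_mult_distrib)
  then have "sc (of_nat m) \<otimes> d = \<zero>"
    using average_eigen[OF dc(2,1), of "\<lambda>k. inverse (w ^ c) ^ k"] average_eigen_sum[OF order_refl c, of d] d by simp
  then show "d \<in> {\<zero>}"
    using sc_of_nat_cancel[OF dc(1)] by auto
next
  fix d assume "d \<in> {\<zero>}"
  moreover have "\<zero> \<in> eigen_sum c"
  proof (induction c)
    case (Suc c)
    have "\<zero> \<in> eigenspace c"
      using x_closed by (simp add: eigenspace_def centralizer_zero[OF S] qcomm_zero)
    then show ?case
      using Suc by (auto simp: set_add_def' intro!: bexI[of _ \<zero>])
  qed simp
  ultimately show "d \<in> eigen_sum c \<inter> eigenspace c"
    using x_closed by (simp add: eigenspace_def centralizer_zero[OF S] qcomm_zero)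
qed

lemma dimension_eigen_sum:
  assumes "dimension n K (eigenspace 0)"
  shows "c \<le> m \<Longrightarrow> dimension (c * n) K (eigen_sum c)"
proof (induction c)
  case (Suc c)
  have "dimension (c * n + n) K (eigen_sum c <+> eigenspace c)"
    by (rule dimension_direct_sum_space[OF K_subfield])
      (use Suc dimension_eigenspace[OF assms] eigen_sum_Int in auto)
  then show ?case
    by (simp add: add.commute)
qed simp

text \<open>The averages of \<open>d\<close> for all c < m add up to m d, since the sum of all
  characters is m at k = 0 and vanishes for 0 < k < m.\<close>

lemma eigen_sum_m:
  assumes "dimension n K (eigenspace 0)"
  shows "eigen_sum m = C"
proof (intro equalityI subsetI)
  fix d assume d: "d \<in> C"
  note dc = C_closed[OF d]
  have "average (\<lambda>k. \<Sum>c<j. inverse (w ^ c) ^ k) d \<in> eigen_sum j" for j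
  proof (induction j)
    case 0
    have "partial_sum (\<lambda>k. sc 0 \<otimes> conj_pow k d) n = \<zero>" for n
      by (induction n) (use dc in \<open>simp_all add: sc_zero\<close>)
    then show ?case
      by (simp add: average_def)
  next
    case (Suc j)
    then show ?case
      using average_eigenspace[OF d, of j] dc by (auto simp: average_add_left set_add_def')
  qed
  moreover have "average (\<lambda>k. \<Sum>c<m. inverse (w ^ c) ^ k) d = sc (of_nat m) \<otimes> d"
  proof -
    have a: "(\<Sum>c<m. inverse (w ^ c) ^ k) = (if k = 0 then of_nat m else 0)" if "k < m" for k
    proof (cases "k = 0")
      case False
      \<comment> \<open>The roles of \<open>c\<close> and \<open>k\<close> are exchanged: this is
        orthogonality of the characters \<open>k\<close> and 0.\<close>
      have "(\<Sum>c<m. inverse (w ^ c) ^ k) = (\<Sum>c<m. inverse (w ^ k) ^ c * (w ^ 0) ^ c)"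
        by (simp add: power_inverse mult.commute flip: power_mult)
      then show ?thesis
        using eigen_ratio[of k 0] m that False by simp
    qed simp
    have "partial_sum (\<lambda>k. sc (\<Sum>c<m. inverse (w ^ c) ^ k) \<otimes> conj_pow k d) (Suc j) = sc (of_nat m) \<otimes> d" if "Suc j \<le> m" for j
      using that
    proof (induction j)
      case 0
      then show ?case
        using dc by (simp add: conj_pow_def)
    next
      case (Suc j)
      then show ?case
        using dc a[of "Suc j"] by (simp add: sc_zero)
    qed
    from this[of "m - 1"] show ?thesis
      using m by (simp add: average_def)
  qed
  ultimately have "sc (of_nat m) \<otimes> d \<in> eigen_sum m"
    by metis
  then show "d \<in> eigen_sum m"
    using space_subgroup_props(5)[OF K_subfield dimension_eigen_sum[OF assms order_refl] sc_in_K]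
      sc_of_nat_cancel[OF dc refl] by metis
qed (use eigen_sum_subset in auto)

lemma dimension_centralizer:
  assumes "dimension n K (centralizer (insert x S))"
  shows "dimension (m * n) K (centralizer S)"
  using dimension_eigen_sum[of n m] eigen_sum_m[of n] assms by (simp add: eigenspace_0)

end

section \<open>Central elements, and the dimension over the center\<close>

lemma ring_center_iff: "x \<in> ring_center R \<longleftrightarrow> x \<in> carrier R \<and> (\<forall>y\<in>carrier R. x \<otimes>\<^bsub>R\<^esub> y = y \<otimes>\<^bsub>R\<^esub> x)"
  by (simp add: ring_center_def)

text \<open>\<open>generated\<close> expresses generation by the z_i and zs_i through a consequence:
  what commutes with them is central. In this form it passes from the algebra to its rings of
  fractions, where inverses are present too.\<close>

locale generated_quantum_relations = quantum_relations R sc z zs Om q N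
  for R (structure) and sc z zs Om q N +
  fixes m :: nat
  assumes generated: "\<lbrakk>x \<in> carrier R; \<And>i. i < N \<Longrightarrow> qcomm 1 (z i) x; \<And>i. i < N \<Longrightarrow> qcomm 1 (zs i) x\<rbrakk>
      \<Longrightarrow> x \<in> ring_center R"
    and z_regular: "\<lbrakk>i < N; x \<in> carrier R; z i \<otimes> x = \<zero>\<rbrakk> \<Longrightarrow> x = \<zero>"
    and odd_m: "odd m"
    and q_m: "q ^ m = 1"
    and q_primitive: "0 < k \<Longrightarrow> k < m \<Longrightarrow> q ^ k \<noteq> 1"
begin

lemma z_left_cancel:
  assumes "i < N" "a \<in> carrier R" "b \<in> carrier R" "z i \<otimes> a = z i \<otimes> b"
  shows "a = b"
proof -
  have "z i \<otimes> (a \<ominus> b) = \<zero>"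
    using assms by (simp add: minus_eq r_distr r_minus r_neg)
  then have "a \<ominus> b = \<zero>"
    using z_regular assms by simp
  then show ?thesis
    using assms by (simp add: r_right_minus_eq)
qed

text \<open>Commuting with Om_i and Om_(i+1) implies commuting with their difference z_i zs_i; then
  z_i is cancelled from z_i zs_i x = z_i x zs_i. So the \<open>Om j\<close> can replace the
  \<open>zs i\<close> as generators.\<close>

lemma centralI:
  assumes x: "x \<in> carrier R" and zx: "\<And>i. i < N \<Longrightarrow> qcomm 1 (z i) x"
    and Omx: "\<And>j. j < N \<Longrightarrow> qcomm 1 (Om j) x"
  shows "x \<in> ring_center R"
proof (rule generated[OF x zx])
  fix i assume i: "i < N"
  have Om: "Om j \<otimes> x = x \<otimes> Om j" if "j \<le> N" for j
    using Omx[of j] that x by (cases "j = N") (simp_all add: Om_N qcomm_1_iff)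
  define w where "w = z i \<otimes> zs i"
  have c: "w \<in> carrier R" "z i \<in> carrier R" "zs i \<in> carrier R" "Om (Suc i) \<in> carrier R"
    using i by (simp_all add: w_def)
  have "w \<otimes> x \<oplus> Om (Suc i) \<otimes> x = Om i \<otimes> x"
    using c x i by (simp add: Om_step w_def l_distr)
  also have "\<dots> = x \<otimes> w \<oplus> Om (Suc i) \<otimes> x"
    using c x i by (simp add: Om[of i] Om[of "Suc i"]) (simp add: Om_step w_def r_distr)
  finally have wx: "w \<otimes> x = x \<otimes> w"
    using c x by simp
  have "z i \<otimes> (zs i \<otimes> x) = w \<otimes> x"
    using c x by (simp add: w_def m_assoc)
  also have "\<dots> = (x \<otimes> z i) \<otimes> zs i"
    using c x by (simp only: wx) (simp add: w_def m_assoc)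
  also have "\<dots> = (z i \<otimes> x) \<otimes> zs i"
    using zx[OF i] c x by (simp add: qcomm_1_iff)
  also have "\<dots> = z i \<otimes> (x \<otimes> zs i)"
    using c x by (simp add: m_assoc)
  finally show "qcomm 1 (zs i) x"
    using z_left_cancel[OF i] c x by (simp add: qcomm_1_iff)
qed auto

lemma power_root:
  assumes "c \<in> {1, q, inverse q, q\<^sup>2, inverse (q\<^sup>2)}"
  shows "c ^ m = 1"
  using assms q_m
  by (auto simp: power_inverse simp flip: power_mult) (simp_all add: mult.commute[of 2] power_mult)

lemma z_z_any:
  assumes "i < N" "j < N"
  obtains c where "c \<in> {1, q, inverse q, q\<^sup>2, inverse (q\<^sup>2)}" "qcomm c (z i) (z j)"
proof (cases i j rule: linorder_cases)
  case greater
  then have "qcomm (inverse (inverse q)) (z i) (z j)"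
    using qcomm_sym[OF z_z[of j i]] assms q_nonzero by auto
  then show ?thesis
    using that[of q] by simp
qed (use that[of 1] that[of "inverse q"] z_z[of i j] qcomm_refl[of "z j"] assms in auto)

lemma z_Om_any:
  assumes "i < N" "j \<le> N"
  obtains c where "c \<in> {1, q, inverse q, q\<^sup>2, inverse (q\<^sup>2)}" "qcomm c (z i) (Om j)"
  by (cases "i < j")
    (use that[of 1] that[of "inverse (q\<^sup>2)"] z_Om_greater[of i j] z_Om_le[of j i] assms in auto)

lemma Om_z_any:
  assumes "i < N" "j \<le> N"
  obtains c where "c \<in> {1, q, inverse q, q\<^sup>2, inverse (q\<^sup>2)}" "qcomm c (Om j) (z i)"
proof -
  obtain c where c: "c \<in> {1, q, inverse q, q\<^sup>2, inverse (q\<^sup>2)}" "qcomm c (z i) (Om j)"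
    using z_Om_any[OF assms] .
  then have "qcomm (inverse c) (Om j) (z i)"
    using q_nonzero assms by (intro qcomm_sym) auto
  moreover have "inverse c \<in> {1, q, inverse q, q\<^sup>2, inverse (q\<^sup>2)}"
    using c(1) by auto
  ultimately show ?thesis
    using that by blast
qed

lemma root_nonzero: "c \<in> {1, q, inverse q, q\<^sup>2, inverse (q\<^sup>2)} \<Longrightarrow> c \<noteq> 0"
  using q_nonzero by auto

lemma z_pow_central: "i < N \<Longrightarrow> z i [^] m \<in> ring_center R"
proof (rule centralI)
  fix j assume i: "i < N" and j: "j < N"
  show "qcomm 1 (z j) (z i [^] m)"
    using z_z_any[OF j i] qcomm_pow_right[of _ "z j" "z i" m] power_root i j by (metis z_closed)
  show "qcomm 1 (Om j) (z i [^] m)"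
    using Om_z_any[OF i, of j] qcomm_pow_right[of _ "Om j" "z i" m] power_root i j
    by (metis z_closed Om_closed less_imp_le)
qed simp

lemma Om_pow_central: "i < N \<Longrightarrow> Om i [^] m \<in> ring_center R"
proof (rule centralI)
  fix j assume i: "i < N" and j: "j < N"
  show "qcomm 1 (z j) (Om i [^] m)"
    using z_Om_any[OF j, of i] qcomm_pow_right[of _ "z j" "Om i" m] power_root i j
    by (metis z_closed Om_closed less_imp_le)
  show "qcomm 1 (Om j) (Om i [^] m)"
    using qcomm_pow_right[OF Om_Om[of j i], of m] i j by simp
qed simp

text \<open>The exponent 2k lies strictly between 0 and 2m, where the only multiple of m is m
  itself, and that is odd.\<close>

lemma q2_primitive:
  assumes "0 < k" "k < m"
  shows "(q\<^sup>2) ^ k \<noteq> 1"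
proof
  assume "(q\<^sup>2) ^ k = 1"
  then have q2k: "q ^ (2 * k) = 1"
    by (simp add: power_mult)
  have "2 * k \<noteq> m"
    using odd_m by auto
  then consider "2 * k < m" | "m < 2 * k"
    by linarith
  then show False
  proof cases
    case 1
    then show False
      using q_primitive[of "2 * k"] assms q2k by simp
  next
    case 2
    have "q ^ (2 * k) = q ^ m * q ^ (2 * k - m)"
      using 2 by (simp flip: power_add)
    then show False
      using q_primitive[of "2 * k - m"] 2 assms q2k q_m by simp
  qed
qed

end

locale quantum_field = generated_quantum_relations +
  assumes N_pos: "0 < N"
    and z_unit: "i < N \<Longrightarrow> z i \<in> Units R"
    and Om_unit: "j < N \<Longrightarrow> Om j \<in> Units R"
    and center_subfield: "subfield (ring_center R) R"
begin

lemma sc_central_mem: "sc c \<in> ring_center R"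
  by (simp add: ring_center_iff sc_central)

sublocale central_subfield R sc "ring_center R"
  using center_subfield sc_central_mem central_scalars_axioms
  by (intro central_subfield.intro central_subfield_axioms.intro) auto

text \<open>The exponent (m + 1)/2 inverts 2 modulo m. For i < N - 1 this power of Om_(N-1) has the
  factor q^-(m+1) = q^-1 against z_i, the same as z_(N-1), so the factors cancel in the
  quotient.\<close>

lemma twisted_z_last_central:
  "z (N - 1) \<otimes> inv (Om (N - 1) [^] ((m + 1) div 2)) \<in> ring_center R"
proof (rule centralI)
  let ?p = "Om (N - 1)" and ?h = "(m + 1) div 2"
  let ?u = "inv (?p [^] ?h)"
  have N: "N - 1 < N"
    using N_pos by simp
  note p = Om_unit[OF N]
  note ph = pow_inv_Units(1)[OF p, of ?h]
  note pc = Units_closed[OF p] Units_closed[OF ph] Units_inv_closed[OF ph]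
  show "z (N - 1) \<otimes> ?u \<in> carrier R"
    using N pc by simp
  fix i assume i: "i < N"
  show "qcomm 1 (z i) (z (N - 1) \<otimes> ?u)"
  proof (cases "i = N - 1")
    case True
    have "qcomm (1 * inverse (1 ^ ?h)) (z i) (z (N - 1) \<otimes> ?u)"
      using i N pc ph True z_Om_le[of "N - 1" i]
      by (intro qcomm_mult_right qcomm_inv_right qcomm_pow_right) (auto simp: qcomm_refl)
    then show ?thesis
      by simp
  next
    case False
    then have "qcomm (inverse q * inverse (inverse (q\<^sup>2) ^ ?h)) (z i) (z (N - 1) \<otimes> ?u)"
      using i N pc ph z_Om_greater[of i "N - 1"] q_nonzero
      by (intro qcomm_mult_right qcomm_inv_right qcomm_pow_right) (auto simp: z_z)
    moreover have "2 * ?h = m + 1"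
      using odd_m by (elim oddE) simp
    then have "inverse q * inverse (inverse (q\<^sup>2) ^ ?h) = inverse q * q ^ (m + 1)"
      by (simp add: power_inverse flip: power_mult)
    then have "inverse q * inverse (inverse (q\<^sup>2) ^ ?h) = 1"
      using q_m q_nonzero by simp
    ultimately show ?thesis
      by simp
  qed
  have "qcomm (1 * inverse (1 ^ ?h)) (Om i) (z (N - 1) \<otimes> ?u)"
    using i N pc ph qcomm_sym[OF z_Om_le[of i "N - 1"]] Om_Om[of i "N - 1"]
    by (intro qcomm_mult_right qcomm_inv_right qcomm_pow_right) auto
  then show "qcomm 1 (Om i) (z (N - 1) \<otimes> ?u)"
    by simp
qed

lemma Om_0_central: "Om 0 \<in> ring_center R"
proof (rule centralI)
  fix i assume i: "i < N"
  show "qcomm 1 (z i) (Om 0)" "qcomm 1 (Om i) (Om 0)"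
    using z_Om_le[of 0 i] Om_Om[of i 0] i by auto
qed simp

text \<open>The elements \<open>\<Omega>\<^sub>1, \<dots>, \<Omega>\<^sub>N\<^sub>-\<^sub>1, z\<^sub>N\<^sub>-\<^sub>2, \<dots>, z\<^sub>0\<close>. The \<open>k\<close>-th one from the right commutes with all elements
  that come before the \<open>k\<close>-th one from the left, but not with the latter.\<close>

definition chain :: "nat \<Rightarrow> 'a" where
  "chain k = (if k < N - 1 then Om (Suc k) else z (2 * (N - 1) - Suc k))"

lemma chain_unit: "k < 2 * (N - 1) \<Longrightarrow> chain k \<in> Units R"
  unfolding chain_def using Om_unit[of "Suc k"] z_unit[of "2 * (N - 1) - Suc k"] by auto

lemma chain_qcomm:
  assumes "k < 2 * (N - 1)" "l < 2 * (N - 1)"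
  shows "\<exists>c. c \<noteq> 0 \<and> qcomm c (chain k) (chain l)"
proof -
  have 1: "2 * (N - 1) - Suc i < N" if "i < 2 * (N - 1)" "\<not> i < N - 1" for i
    using that by auto
  show ?thesis
  proof (cases "k < N - 1"; cases "l < N - 1")
    assume "k < N - 1" "l < N - 1"
    then show ?thesis
      using Om_Om[of "Suc k" "Suc l"] by (auto simp: chain_def intro!: exI[of _ 1])
  next
    assume kl: "k < N - 1" "\<not> l < N - 1"
    then have "Suc k \<le> N"
      by simp
    then obtain c where "c \<in> {1, q, inverse q, q\<^sup>2, inverse (q\<^sup>2)}" "qcomm c (Om (Suc k)) (z (2 * (N - 1) - Suc l))"
      by (rule Om_z_any[OF 1[OF assms(2) kl(2)]])
    then show ?thesis
      using kl root_nonzero by (auto simp: chain_def)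
  next
    assume kl: "\<not> k < N - 1" "l < N - 1"
    then have "Suc l \<le> N"
      by simp
    then obtain c where "c \<in> {1, q, inverse q, q\<^sup>2, inverse (q\<^sup>2)}" "qcomm c (z (2 * (N - 1) - Suc k)) (Om (Suc l))"
      by (rule z_Om_any[OF 1[OF assms(1) kl(1)]])
    then show ?thesis
      using kl root_nonzero by (auto simp: chain_def)
  next
    assume kl: "\<not> k < N - 1" "\<not> l < N - 1"
    obtain c where "c \<in> {1, q, inverse q, q\<^sup>2, inverse (q\<^sup>2)}"
      "qcomm c (z (2 * (N - 1) - Suc k)) (z (2 * (N - 1) - Suc l))"
      by (rule z_z_any[OF 1[OF assms(1) kl(1)] 1[OF assms(2) kl(2)]])
    then show ?thesis
      using kl root_nonzero by (auto simp: chain_def)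
  qed
qed

text \<open>The partner of Om_(k+1) is z_k and conversely; the pairing is the reversal of the
  chain.\<close>

lemma chain_dual_twist:
  assumes "k < 2 * (N - 1)"
  obtains w where "qcomm w (chain k) (chain (2 * (N - 1) - Suc k))" "w = q\<^sup>2 \<or> w = inverse (q\<^sup>2)"
proof (cases "k < N - 1")
  case True
  then have k: "Suc k \<le> N" "k < N"
    by simp_all
  then have "qcomm (inverse (inverse (q\<^sup>2))) (Om (Suc k)) (z k)"
    using q_nonzero by (intro qcomm_sym z_Om_greater) auto
  moreover have "chain (2 * (N - 1) - Suc k) = z k"
    using True by (auto simp: chain_def)
  ultimately show ?thesis
    using True that[of "q\<^sup>2"] by (simp add: chain_def)
next
  case False
  define l where "l = 2 * (N - 1) - Suc k"
  have l: "l < N - 1"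
    using False assms by (auto simp: l_def)
  have "qcomm (inverse (q\<^sup>2)) (z l) (Om (Suc l))"
    using l by (intro z_Om_greater) auto
  moreover have "chain k = z l"
    using False by (simp add: chain_def l_def)
  moreover have "chain l = Om (Suc l)"
    using l by (simp add: chain_def)
  ultimately show ?thesis
    using that[of "inverse (q\<^sup>2)"] unfolding l_def by simp
qed

text \<open>This dictates the order of the chain: z_k commutes with Om_1, ..., Om_k, and Om_(l+1)
  commutes with each z_i for i > l, hence the z_i come with descending index.\<close>

lemma chain_dual_commute:
  assumes "k < 2 * (N - 1)" "i < k"
  shows "chain i \<otimes> chain (2 * (N - 1) - Suc k) = chain (2 * (N - 1) - Suc k) \<otimes> chain i"
proof -
  let ?l = "2 * (N - 1) - Suc k"
  have "qcomm 1 (chain i) (chain ?l)"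
  proof (cases "k < N - 1")
    case True
    then have "chain ?l = z k" "chain i = Om (Suc i)"
      using assms by (auto simp: chain_def)
    then show ?thesis
      using qcomm_sym[OF z_Om_le[of "Suc i" k]] assms True by simp
  next
    case False
    then have l: "?l < N - 1" "chain ?l = Om (Suc ?l)"
      using assms by (auto simp: chain_def)
    show ?thesis
    proof (cases "i < N - 1")
      case True
      then show ?thesis
        using l Om_Om[of "Suc i" "Suc ?l"] by (simp add: chain_def)
    next
      case i: False
      then have "qcomm 1 (z (2 * (N - 1) - Suc i)) (Om (Suc ?l))"
        using assms by (intro z_Om_le) auto
      then show ?thesis
        using i l by (simp add: chain_def)
    qed
  qed
  then show ?thesis
    using chain_unit[of i, THEN Units_closed] chain_unit[of ?l, THEN Units_closed] assms
    by (simp add: qcomm_1_iff)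
qed

text \<open>Among the \<open>z i\<close> and \<open>Om j\<close> only Om_0 and z_(N-1) are missing
  from the chain. The first is central, and the second is a central element times a power of
  Om_(N-1).\<close>

lemma centralizer_chain: "centralizer (chain ` {..<2 * (N - 1)}) = ring_center R"
proof (intro equalityI subsetI)
  fix c assume "c \<in> ring_center R"
  then show "c \<in> centralizer (chain ` {..<2 * (N - 1)})"
    using chain_unit[THEN Units_closed] by (auto simp: centralizer_def ring_center_iff)
next
  fix c assume c: "c \<in> centralizer (chain ` {..<2 * (N - 1)})"
  then have comm: "chain k \<otimes> c = c \<otimes> chain k" if "k < 2 * (N - 1)" for k
    using that by (auto simp: centralizer_def)
  have cc: "c \<in> carrier R"
    using c by (simp add: centralizer_def)
  have Om: "Om j \<otimes> c = c \<otimes> Om j" if "j < N" for j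
  proof (cases j)
    case 0
    then show ?thesis
      using Om_0_central cc by (simp add: ring_center_iff)
  next
    case (Suc k)
    then have k: "k < N - 1"
      using that by simp
    then have "k < 2 * (N - 1)"
      by simp
    then show ?thesis
      using comm[of k] k Suc by (simp add: chain_def)
  qed
  have z: "z i \<otimes> c = c \<otimes> z i" if i: "i < N" for i
  proof (cases "i < N - 1")
    case True
    moreover have "2 * (N - 1) - Suc i < 2 * (N - 1)" "\<not> 2 * (N - 1) - Suc i < N - 1"
      "2 * (N - 1) - Suc (2 * (N - 1) - Suc i) = i"
      using True by simp_all
    ultimately show ?thesis
      using comm[of "2 * (N - 1) - Suc i"] unfolding chain_def by metis
  next
    case False
    let ?p = "Om i [^] ((m + 1) div 2)"
    have iN: "i = N - 1"
      using False i by simp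
    note p = pow_inv_Units(1)[OF Om_unit[OF i], of "(m + 1) div 2"]
    note pc = Units_closed[OF p] Units_inv_closed[OF p]
    define t where "t = z i \<otimes> inv ?p"
    have t: "t \<in> ring_center R" and tc: "t \<in> carrier R"
      using twisted_z_last_central i pc by (simp_all add: t_def iN)
    have "z i = t \<otimes> ?p"
      using p pc i by (simp add: t_def m_assoc)
    moreover have "c \<in> centralizer {Om i}"
      using Om[OF i] cc by (simp add: centralizer_def)
    then have "Om i \<in> centralizer {c}"
      using Om[OF i] i by (simp add: centralizer_def)
    then have "?p \<in> centralizer {c}"
      using cc by (intro centralizer_pow) simp
    moreover have "t \<in> centralizer {c}"
      using t cc by (simp add: centralizer_def ring_center_iff)
    ultimately have "z i \<in> centralizer {c}"
      using centralizer_mult[of "{c}" t ?p] cc by simp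
    then show ?thesis
      by (simp add: centralizer_def)
  qed
  show "c \<in> ring_center R"
    by (rule centralI) (use cc z Om in \<open>simp_all add: qcomm_1_iff\<close>)
qed

lemma m_pos: "0 < m"
  using odd_m by (cases m) auto

lemma dimension_center: "dimension (m ^ (2 * (N - 1))) (ring_center R) (carrier R)"
proof -
  let ?M = "2 * (N - 1)"
  \<comment> \<open>With \<open>k = ?M\<close> the centralizer is the center; each element dropped
    multiplies the dimension by m; with \<open>k = 0\<close> it is the whole ring.\<close>
  have "dimension (m ^ (?M - k)) (ring_center R) (centralizer (chain ` {..<k}))" if "k \<le> ?M" for k
    using that
  proof (induction rule: inc_induct)
    case base
    then show ?case
      using dimension_one[OF center_subfield] unfolding centralizer_chain by simp
  next
    case (step k)
    let ?x = "chain k" and ?y = "chain (?M - Suc k)"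
    obtain w where w: "qcomm w ?x ?y" "w = q\<^sup>2 \<or> w = inverse (q\<^sup>2)"
      using chain_dual_twist step by auto
    have pow: "?x [^] m \<in> ring_center R"
      using step Om_pow_central[of "Suc k"] z_pow_central[of "?M - Suc k"] by (auto simp: chain_def)
    have carr: "chain ` {..<k} \<subseteq> carrier R"
      using chain_unit[THEN Units_closed] step by auto
    interpret conjugation_step R sc "ring_center R" "chain ` {..<k}" ?x ?y w m
    proof unfold_locales
      show "?y \<in> centralizer (chain ` {..<k})"
        using chain_dual_commute[of k] chain_unit[of "?M - Suc k", THEN Units_closed] step by (auto simp: centralizer_def)
      show "\<exists>c. c \<noteq> 0 \<and> qcomm c s ?x" if "s \<in> chain ` {..<k}" for s
        using that chain_qcomm step by auto
      show "?x [^] m \<otimes> d = d \<otimes> ?x [^] m" if "d \<in> carrier R" for d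
        using pow that by (simp add: ring_center_iff)
      show "w ^ m = 1"
        using w(2) power_root by auto
      show "w ^ k \<noteq> 1" if "0 < k" "k < m" for k
        using w(2) q2_primitive[OF that] by (auto simp: power_inverse)
    qed (use carr w m_pos chain_unit step in auto)
    have "chain ` {..<Suc k} = insert ?x (chain ` {..<k})"
      by (simp add: lessThan_Suc)
    then have "dimension (m * m ^ (?M - Suc k)) (ring_center R) (centralizer (chain ` {..<k}))"
      using dimension_centralizer[of "m ^ (?M - Suc k)"] step by simp
    moreover have "m * m ^ (?M - Suc k) = m ^ (?M - k)"
      using step by (metis Suc_diff_Suc power_Suc less_le_trans)
    ultimately show ?case
      by simp
  qed
  from this[of 0] show ?thesis
    by (simp add: centralizer_def)
qed

end

section \<open>Localization at the nonzero central elements\<close>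

context ring
begin

lemma center_carrier: "k \<in> ring_center R \<Longrightarrow> k \<in> carrier R"
  by (simp add: ring_center_iff)

lemma center_commute: "k \<in> ring_center R \<Longrightarrow> y \<in> carrier R \<Longrightarrow> y \<otimes> k = k \<otimes> y"
  by (simp add: ring_center_iff)

lemma center_subring: "subring (ring_center R) R"
proof (rule subringI)
  show "ring_center R \<subseteq> carrier R" "\<one> \<in> ring_center R"
    by (auto simp: ring_center_iff)
  fix h1 h2 assume h: "h1 \<in> ring_center R" "h2 \<in> ring_center R"
  then have e: "h1 \<otimes> y = y \<otimes> h1" "h2 \<otimes> y = y \<otimes> h2" if "y \<in> carrier R" for y
    using that by (auto simp: ring_center_iff)
  have c: "h1 \<in> carrier R" "h2 \<in> carrier R"
    using h by (auto simp: ring_center_iff)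
  show "\<ominus> h1 \<in> ring_center R"
    unfolding ring_center_iff using c(1) e(1) by (auto simp: l_minus r_minus)
  show "h1 \<oplus> h2 \<in> ring_center R"
    unfolding ring_center_iff using c e by (auto simp: l_distr r_distr)
  have "h1 \<otimes> h2 \<otimes> y = y \<otimes> (h1 \<otimes> h2)" if y: "y \<in> carrier R" for y
  proof -
    have "h1 \<otimes> h2 \<otimes> y = h1 \<otimes> y \<otimes> h2"
      using c y by (simp add: m_assoc e(2)[OF y])
    then show ?thesis
      using c y by (simp add: m_assoc e(1)[OF y])
  qed
  then show "h1 \<otimes> h2 \<in> ring_center R"
    using c by (simp add: ring_center_iff)
qed

lemma center_inv:
  assumes "k \<in> ring_center R" "k \<in> Units R"
  shows "inv k \<in> ring_center R"
proof -
  have "ring_center R = centralizer (carrier R)"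
    by (auto simp: ring_center_iff centralizer_def)
  then show ?thesis
    using centralizer_inv[of "carrier R" k] assms by simp
qed

lemma center_is_subfield:
  assumes "\<one> \<noteq> \<zero>" and unit: "\<And>k. k \<in> ring_center R \<Longrightarrow> k \<noteq> \<zero> \<Longrightarrow> k \<in> Units R"
  shows "subfield (ring_center R) R"
proof (rule subfieldI)
  show "subcring (ring_center R) R"
    by (rule subcringI[OF center_subring]) (meson ring_center_iff)
  show "Units (R\<lparr>carrier := ring_center R\<rparr>) = ring_center R - {\<zero>}"
  proof (intro equalityI subsetI)
    fix k assume "k \<in> Units (R\<lparr>carrier := ring_center R\<rparr>)"
    then obtain l where "k \<in> ring_center R" "l \<in> ring_center R" "l \<otimes> k = \<one>"
      by (auto simp: Units_def)
    moreover from this have "k \<noteq> \<zero>"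
      using assms(1) center_carrier[of l] by auto
    ultimately show "k \<in> ring_center R - {\<zero>}"
      by simp
  next
    fix k assume "k \<in> ring_center R - {\<zero>}"
    then show "k \<in> Units (R\<lparr>carrier := ring_center R\<rparr>)"
      using unit[of k] center_inv[of k] unfolding Units_def[of "R\<lparr>carrier := ring_center R\<rparr>"]
      by (auto intro!: bexI[of _ "inv k"])
  qed
qed

text \<open>Left multiplication by a nonzero \<open>s\<close> is injective and K-linear, hence onto,
  which yields a right inverse \<open>d\<close>. As \<open>d\<close> is nonzero it has a right
  inverse too, and this must be \<open>s\<close>.\<close>

lemma finite_dimension_division_ring:
  assumes K: "subfield K R" "K \<subseteq> ring_center R" and dim: "dimension n K (carrier R)"
    and one: "\<one> \<noteq> \<zero>"
    and domain: "\<And>a b. \<lbrakk>a \<in> carrier R; b \<in> carrier R; a \<otimes> b = \<zero>; a \<noteq> \<zero>\<rbrakk> \<Longrightarrow> b = \<zero>"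
  shows "Units R = carrier R - {\<zero>}"
proof -
  have right_inverse: "\<exists>d\<in>carrier R. s \<otimes> d = \<one>" if s: "s \<in> carrier R" "s \<noteq> \<zero>" for s
  proof -
    have "dimension n K ((\<otimes>) s ` carrier R)"
    proof (rule dimension_image_left_mult[OF K(1) _ s(1) _ dim])
      show "s \<otimes> k = k \<otimes> s" if "k \<in> K" for k
        using center_commute[OF subsetD[OF K(2) that] s(1)] .
      show "d = \<zero>" if "d \<in> carrier R" "s \<otimes> d = \<zero>" for d
        using domain[OF s(1) that s(2)] .
    qed
    then obtain Us where Us: "independent K Us" "length Us = n" "Span K Us = (\<otimes>) s ` carrier R"
      using exists_base[OF K(1)] by blast
    moreover have "set Us \<subseteq> carrier R"
      using independent_in_carrier[OF Us(1)] .
    ultimately have "carrier R = (\<otimes>) s ` carrier R"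
      using independent_length_eq_dimension[OF K(1) dim Us(1)] by simp
    then show ?thesis
      using one_closed by (metis imageE)
  qed
  show ?thesis
  proof (intro equalityI subsetI)
    fix s assume s: "s \<in> carrier R - {\<zero>}"
    then obtain d where d: "d \<in> carrier R" "s \<otimes> d = \<one>"
      using right_inverse by auto
    then have "d \<noteq> \<zero>"
      using s one by auto
    then obtain e where e: "e \<in> carrier R" "d \<otimes> e = \<one>"
      using right_inverse d by auto
    have "s = s \<otimes> (d \<otimes> e)"
      using s e by simp
    also have "\<dots> = e"
      using s d e m_assoc[of s d e] by simp
    finally show "s \<in> Units R"
      using s d e by (auto simp: Units_def)
  qed (use one in \<open>auto simp: Units_def\<close>)
qed

end

text \<open>Central denominators let fractions be multiplied componentwise, and no Ore condition
  enters. That all nonzero elements become invertible is a matter of finite dimension later.\<close>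

locale central_localization = ring A for A (structure) +
  assumes nontrivial: "\<one> \<noteq> \<zero>"
    and domain: "\<lbrakk>a \<in> carrier A; b \<in> carrier A; a \<otimes> b = \<zero>; a \<noteq> \<zero>\<rbrakk> \<Longrightarrow> b = \<zero>"
begin

definition denominators :: "'a set" where
  "denominators = ring_center A - {\<zero>}"

text \<open>The whole equivalence class of (a, s), so equality of fractions is equality of sets. The
  type is the one that \<open>has_degree\<close> quantifies over.\<close>

definition frac :: "'a \<Rightarrow> 'a \<Rightarrow> ('a \<times> 'a) set" where
  "frac a s = {(b, t). b \<in> carrier A \<and> t \<in> denominators \<and> a \<otimes> t = b \<otimes> s}"

text \<open>A representative picked by choice; the operations do not depend on it, by
  \<open>mult_frac\<close> and \<open>add_frac\<close>.\<close>

definition num :: "('a \<times> 'a) set \<Rightarrow> 'a" where "num u = fst (SOME p. p \<in> u)"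
definition den :: "('a \<times> 'a) set \<Rightarrow> 'a" where "den u = snd (SOME p. p \<in> u)"

definition fractions :: "('a \<times> 'a) set ring" where
  "fractions = \<lparr>carrier = {frac a s | a s. a \<in> carrier A \<and> s \<in> denominators},
     monoid.mult = (\<lambda>u v. frac (num u \<otimes> num v) (den u \<otimes> den v)),
     one = frac \<one> \<one>,
     zero = frac \<zero> \<one>,
     add = (\<lambda>u v. frac (num u \<otimes> den v \<oplus> num v \<otimes> den u) (den u \<otimes> den v))\<rparr>"

lemma den_closed: "s \<in> denominators \<Longrightarrow> s \<in> carrier A"
  by (simp add: denominators_def ring_center_iff)

lemma den_commute: "s \<in> denominators \<Longrightarrow> a \<in> carrier A \<Longrightarrow> s \<otimes> a = a \<otimes> s"
  by (simp add: denominators_def ring_center_iff)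

lemma den_one: "\<one> \<in> denominators"
  using nontrivial by (simp add: denominators_def ring_center_iff)

lemma den_mult:
  assumes "s \<in> denominators" "t \<in> denominators"
  shows "s \<otimes> t \<in> denominators"
  using assms subringE(6)[OF center_subring] domain den_closed unfolding denominators_def by blast

lemma den_cancel:
  assumes "s \<in> denominators" "a \<in> carrier A" "b \<in> carrier A" "a \<otimes> s = b \<otimes> s"
  shows "a = b"
proof -
  have "s \<otimes> (a \<ominus> b) = \<zero>"
    using assms den_closed[OF assms(1)]
    by (simp add: minus_eq r_distr r_minus den_commute r_neg)
  then have "a \<ominus> b = \<zero>"
    using domain[of s "a \<ominus> b"] assms den_closed by (auto simp: denominators_def)
  then show ?thesis
    using assms by (simp add: r_right_minus_eq)
qed

lemma frac_eq_iff:
  assumes "a \<in> carrier A" "b \<in> carrier A" "s \<in> denominators" "t \<in> denominators"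
  shows "frac a s = frac b t \<longleftrightarrow> a \<otimes> t = b \<otimes> s"
proof
  assume "frac a s = frac b t"
  moreover have "(a, s) \<in> frac a s"
    using assms by (simp add: frac_def)
  ultimately show "a \<otimes> t = b \<otimes> s"
    by (simp add: frac_def)
next
  have sub: "frac a s \<subseteq> frac b t"
    if a: "a \<in> carrier A" "b \<in> carrier A" "s \<in> denominators" "t \<in> denominators" and eq: "a \<otimes> t = b \<otimes> s" for a b s t
  proof
    fix p assume "p \<in> frac a s"
    then obtain c u where p: "p = (c, u)" "c \<in> carrier A" "u \<in> denominators" "a \<otimes> u = c \<otimes> s"
      by (auto simp: frac_def)
    note cl = a(1,2) den_closed[OF a(3)] den_closed[OF a(4)] p(2) den_closed[OF p(3)]
    have "(b \<otimes> u) \<otimes> s = (b \<otimes> s) \<otimes> u"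
      using cl by (simp add: m_assoc den_commute[OF a(3)])
    also have "\<dots> = (a \<otimes> u) \<otimes> t"
      using cl by (simp add: m_assoc den_commute[OF a(4)] flip: eq)
    also have "\<dots> = (c \<otimes> t) \<otimes> s"
      using cl by (simp add: m_assoc p(4) den_commute[OF a(4)])
    finally have "b \<otimes> u = c \<otimes> t"
      using den_cancel[OF a(3)] cl by simp
    then show "p \<in> frac b t"
      using p by (simp add: frac_def)
  qed
  assume "a \<otimes> t = b \<otimes> s"
  then show "frac a s = frac b t"
    using sub assms by (intro equalityI) auto
qed

lemma frac_scale:
  assumes "a \<in> carrier A" "s \<in> denominators" "t \<in> denominators"
  shows "frac (a \<otimes> t) (s \<otimes> t) = frac a s"
  using assms den_closed den_mult den_commute[of t]
  by (subst frac_eq_iff) (auto simp: m_assoc)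

lemma num_den:
  assumes "a \<in> carrier A" "s \<in> denominators"
  shows "num (frac a s) \<in> carrier A" "den (frac a s) \<in> denominators"
    "frac (num (frac a s)) (den (frac a s)) = frac a s"
proof -
  have "(a, s) \<in> frac a s"
    using assms by (simp add: frac_def)
  then have "(SOME p. p \<in> frac a s) \<in> frac a s"
    by (rule someI)
  then have *: "num (frac a s) \<in> carrier A" "den (frac a s) \<in> denominators"
    "a \<otimes> den (frac a s) = num (frac a s) \<otimes> s"
    by (auto simp: frac_def num_def den_def)
  then show "num (frac a s) \<in> carrier A" "den (frac a s) \<in> denominators"
    "frac (num (frac a s)) (den (frac a s)) = frac a s"
    using frac_eq_iff[of "num (frac a s)" a "den (frac a s)" s] assms by auto
qed

lemma frac_mem: "a \<in> carrier A \<Longrightarrow> s \<in> denominators \<Longrightarrow> frac a s \<in> carrier fractions"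
  by (auto simp: fractions_def)

lemma mult_frac:
  assumes "a \<in> carrier A" "b \<in> carrier A" "s \<in> denominators" "t \<in> denominators"
  shows "frac a s \<otimes>\<^bsub>fractions\<^esub> frac b t = frac (a \<otimes> b) (s \<otimes> t)"
proof -
  let ?u = "frac a s" and ?v = "frac b t"
  note u = num_den[OF assms(1,3)] and v = num_den[OF assms(2,4)]
  have ueq: "num ?u \<otimes> s = a \<otimes> den ?u" and veq: "num ?v \<otimes> t = b \<otimes> den ?v"
    using u(3) v(3) u(1,2) v(1,2) assms by (simp_all add: frac_eq_iff)
  note cl = u(1) v(1) assms(1,2) den_closed[OF u(2)] den_closed[OF v(2)] den_closed[OF assms(3)] den_closed[OF assms(4)]
  have "(num ?u \<otimes> num ?v) \<otimes> (s \<otimes> t) = (num ?u \<otimes> s) \<otimes> (num ?v \<otimes> t)"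
    using cl m_assoc[of "num ?v" s t] m_assoc[of s "num ?v" t] den_commute[OF assms(3) v(1)]
    by (simp add: m_assoc)
  also have "\<dots> = (a \<otimes> b) \<otimes> (den ?u \<otimes> den ?v)"
    unfolding ueq veq using cl m_assoc[of b "den ?u" "den ?v"] m_assoc[of "den ?u" b "den ?v"] den_commute[OF u(2) assms(2)]
    by (simp add: m_assoc)
  finally show ?thesis
    unfolding fractions_def using u v assms by (simp add: frac_eq_iff den_mult)
qed

text \<open>Equal denominators suffice, because \<open>common_denominator\<close> reduces the laws
  for sums to this case.\<close>

lemma add_frac:
  assumes "a \<in> carrier A" "b \<in> carrier A" "s \<in> denominators"
  shows "frac a s \<oplus>\<^bsub>fractions\<^esub> frac b s = frac (a \<oplus> b) s"
proof -
  let ?u = "frac a s" and ?v = "frac b s"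
  note u = num_den[OF assms(1,3)] and v = num_den[OF assms(2,3)]
  have ueq: "num ?u \<otimes> s = a \<otimes> den ?u" and veq: "num ?v \<otimes> s = b \<otimes> den ?v"
    using u(3) v(3) u(1,2) v(1,2) assms by (simp_all add: frac_eq_iff)
  note cl = u(1) v(1) assms(1,2) den_closed[OF u(2)] den_closed[OF v(2)] den_closed[OF assms(3)]
  have "(num ?u \<otimes> den ?v \<oplus> num ?v \<otimes> den ?u) \<otimes> s = (num ?u \<otimes> s) \<otimes> den ?v \<oplus> (num ?v \<otimes> s) \<otimes> den ?u"
    using cl by (simp add: l_distr m_assoc den_commute[OF assms(3)])
  also have "\<dots> = (a \<oplus> b) \<otimes> (den ?u \<otimes> den ?v)"
    unfolding ueq veq using cl den_commute[OF u(2) den_closed[OF v(2)]] by (simp add: l_distr m_assoc)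
  finally show ?thesis
    unfolding fractions_def using u v assms den_closed by (simp add: frac_eq_iff den_mult)
qed

lemma carrier_fractionsE:
  assumes "u \<in> carrier fractions"
  obtains a s where "a \<in> carrier A" "s \<in> denominators" "u = frac a s"
  using assms by (auto simp: fractions_def)

lemma common_denominator:
  assumes "u \<in> carrier fractions" "v \<in> carrier fractions"
  obtains a b s where "a \<in> carrier A" "b \<in> carrier A" "s \<in> denominators" "u = frac a s" "v = frac b s"
proof -
  obtain a s b t where u: "a \<in> carrier A" "s \<in> denominators" "u = frac a s"
    and v: "b \<in> carrier A" "t \<in> denominators" "v = frac b t"
    using assms by (elim carrier_fractionsE)
  have "u = frac (a \<otimes> t) (s \<otimes> t)" "v = frac (b \<otimes> s) (s \<otimes> t)"
    using u v frac_scale[of a s t] frac_scale[of b t s] den_commute[OF u(2) den_closed[OF v(2)]] by simp_all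
  then show ?thesis
    using that[of "a \<otimes> t" "b \<otimes> s" "s \<otimes> t"] u v den_mult den_closed by simp
qed

lemma common_denominator3:
  assumes "u \<in> carrier fractions" "v \<in> carrier fractions" "w \<in> carrier fractions"
  obtains a b c s where "a \<in> carrier A" "b \<in> carrier A" "c \<in> carrier A" "s \<in> denominators"
    "u = frac a s" "v = frac b s" "w = frac c s"
proof -
  obtain a b s where u: "a \<in> carrier A" "b \<in> carrier A" "s \<in> denominators" "u = frac a s" "v = frac b s"
    by (rule common_denominator[OF assms(1,2)])
  obtain c t where w: "c \<in> carrier A" "t \<in> denominators" "w = frac c t"
    by (rule carrier_fractionsE[OF assms(3)])
  have "u = frac (a \<otimes> t) (s \<otimes> t)" "v = frac (b \<otimes> t) (s \<otimes> t)" "w = frac (c \<otimes> s) (s \<otimes> t)"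
    using u w frac_scale[of a s t] frac_scale[of b s t] frac_scale[of c t s] den_commute[OF u(3) den_closed[OF w(2)]]
    by simp_all
  then show ?thesis
    using that[of "a \<otimes> t" "b \<otimes> t" "c \<otimes> s" "s \<otimes> t"] u w den_mult den_closed by simp
qed

lemma fractions_one_zero: "\<one>\<^bsub>fractions\<^esub> = frac \<one> \<one>" "\<zero>\<^bsub>fractions\<^esub> = frac \<zero> \<one>"
  by (simp_all add: fractions_def)

lemma frac_zero: "s \<in> denominators \<Longrightarrow> frac \<zero> s = \<zero>\<^bsub>fractions\<^esub>"
  using den_closed den_one by (simp add: fractions_one_zero frac_eq_iff)

lemma frac_one: "s \<in> denominators \<Longrightarrow> frac s s = \<one>\<^bsub>fractions\<^esub>"
  using den_closed den_one by (simp add: fractions_one_zero frac_eq_iff)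

lemma ring_fractions: "ring fractions"
proof (rule ringI)
  show "abelian_group fractions"
  proof (rule abelian_groupI)
    fix u v assume uv: "u \<in> carrier fractions" "v \<in> carrier fractions"
    obtain a b s where *: "a \<in> carrier A" "b \<in> carrier A" "s \<in> denominators" "u = frac a s" "v = frac b s"
      by (rule common_denominator[OF uv])
    show "u \<oplus>\<^bsub>fractions\<^esub> v \<in> carrier fractions" "u \<oplus>\<^bsub>fractions\<^esub> v = v \<oplus>\<^bsub>fractions\<^esub> u"
      using * by (simp_all add: add_frac frac_mem a_comm)
    fix w assume w: "w \<in> carrier fractions"
    obtain a b c s where "a \<in> carrier A" "b \<in> carrier A" "c \<in> carrier A" "s \<in> denominators"
      "u = frac a s" "v = frac b s" "w = frac c s"
      by (rule common_denominator3[OF uv w])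
    then show "(u \<oplus>\<^bsub>fractions\<^esub> v) \<oplus>\<^bsub>fractions\<^esub> w = u \<oplus>\<^bsub>fractions\<^esub> (v \<oplus>\<^bsub>fractions\<^esub> w)"
      by (simp add: add_frac a_assoc)
  next
    show "\<zero>\<^bsub>fractions\<^esub> \<in> carrier fractions"
      using den_one by (simp add: fractions_one_zero frac_mem)
  next
    fix u assume "u \<in> carrier fractions"
    then obtain a s where u: "a \<in> carrier A" "s \<in> denominators" "u = frac a s"
      by (elim carrier_fractionsE)
    show "\<zero>\<^bsub>fractions\<^esub> \<oplus>\<^bsub>fractions\<^esub> u = u"
      using u by (simp add: add_frac flip: frac_zero[OF u(2)])
    have "frac (\<ominus> a) s \<oplus>\<^bsub>fractions\<^esub> u = \<zero>\<^bsub>fractions\<^esub>"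
      using u by (simp add: add_frac l_neg frac_zero)
    then show "\<exists>v\<in>carrier fractions. v \<oplus>\<^bsub>fractions\<^esub> u = \<zero>\<^bsub>fractions\<^esub>"
      using u frac_mem by (meson a_inv_closed)
  qed
  show "monoid fractions"
  proof (rule monoidI)
    fix u v assume uv: "u \<in> carrier fractions" "v \<in> carrier fractions"
    obtain a b s where *: "a \<in> carrier A" "b \<in> carrier A" "s \<in> denominators" "u = frac a s" "v = frac b s"
      by (rule common_denominator[OF uv])
    show "u \<otimes>\<^bsub>fractions\<^esub> v \<in> carrier fractions"
      using * by (simp add: mult_frac frac_mem den_mult)
    fix w assume "w \<in> carrier fractions"
    then obtain c t where "c \<in> carrier A" "t \<in> denominators" "w = frac c t"
      by (elim carrier_fractionsE)
    then show "(u \<otimes>\<^bsub>fractions\<^esub> v) \<otimes>\<^bsub>fractions\<^esub> w = u \<otimes>\<^bsub>fractions\<^esub> (v \<otimes>\<^bsub>fractions\<^esub> w)"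
      using * by (simp add: mult_frac den_mult den_closed m_assoc)
  next
    show "\<one>\<^bsub>fractions\<^esub> \<in> carrier fractions"
      using den_one by (simp add: fractions_one_zero frac_mem)
    fix u assume "u \<in> carrier fractions"
    then obtain a s where "a \<in> carrier A" "s \<in> denominators" "u = frac a s"
      by (elim carrier_fractionsE)
    then show "\<one>\<^bsub>fractions\<^esub> \<otimes>\<^bsub>fractions\<^esub> u = u" "u \<otimes>\<^bsub>fractions\<^esub> \<one>\<^bsub>fractions\<^esub> = u"
      by (simp_all add: fractions_one_zero mult_frac den_one den_closed)
  qed
  fix u v w assume uvw: "u \<in> carrier fractions" "v \<in> carrier fractions" "w \<in> carrier fractions"
  obtain a b c s where "a \<in> carrier A" "b \<in> carrier A" "c \<in> carrier A" "s \<in> denominators"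
      "u = frac a s" "v = frac b s" "w = frac c s"
    by (rule common_denominator3[OF uvw])
  then show "(u \<oplus>\<^bsub>fractions\<^esub> v) \<otimes>\<^bsub>fractions\<^esub> w = u \<otimes>\<^bsub>fractions\<^esub> w \<oplus>\<^bsub>fractions\<^esub> v \<otimes>\<^bsub>fractions\<^esub> w"
    "w \<otimes>\<^bsub>fractions\<^esub> (u \<oplus>\<^bsub>fractions\<^esub> v) = w \<otimes>\<^bsub>fractions\<^esub> u \<oplus>\<^bsub>fractions\<^esub> w \<otimes>\<^bsub>fractions\<^esub> v"
    by (simp_all add: add_frac mult_frac den_mult l_distr r_distr)
qed

definition embed :: "'a \<Rightarrow> ('a \<times> 'a) set" where
  "embed a = frac a \<one>"

lemma embed_hom: "embed \<in> Ring.ring_hom A fractions"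
  by (rule ring_hom_memI) (simp_all add: embed_def frac_mem den_one mult_frac add_frac fractions_one_zero)

lemma embed_inj: "inj_on embed (carrier A)"
  by (rule inj_onI) (simp add: embed_def frac_eq_iff den_one)

lemma fractions_nontrivial: "\<one>\<^bsub>fractions\<^esub> \<noteq> \<zero>\<^bsub>fractions\<^esub>"
  using nontrivial by (simp add: fractions_one_zero frac_eq_iff den_one)

lemma frac_eq_zero_iff:
  assumes "a \<in> carrier A" "s \<in> denominators"
  shows "frac a s = \<zero>\<^bsub>fractions\<^esub> \<longleftrightarrow> a = \<zero>"
  using assms den_closed den_one by (simp add: fractions_one_zero frac_eq_iff)

lemma fractions_domain:
  assumes "u \<in> carrier fractions" "v \<in> carrier fractions" "u \<otimes>\<^bsub>fractions\<^esub> v = \<zero>\<^bsub>fractions\<^esub>" "u \<noteq> \<zero>\<^bsub>fractions\<^esub>"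
  shows "v = \<zero>\<^bsub>fractions\<^esub>"
proof -
  obtain a b s where "a \<in> carrier A" "b \<in> carrier A" "s \<in> denominators" "u = frac a s" "v = frac b s"
    by (rule common_denominator[OF assms(1,2)])
  then show ?thesis
    using assms(3,4) domain[of a b] by (simp add: mult_frac frac_eq_zero_iff den_mult)
qed

lemma embed_unit:
  assumes "s \<in> denominators"
  shows "embed s \<in> Units fractions" "inv\<^bsub>fractions\<^esub> (embed s) = frac \<one> s"
proof -
  interpret D: ring fractions
    by (rule ring_fractions)
  have 1: "embed s \<in> carrier fractions" "frac \<one> s \<in> carrier fractions"
    using assms by (simp_all add: embed_def frac_mem den_one den_closed)
  have 2: "embed s \<otimes>\<^bsub>fractions\<^esub> frac \<one> s = \<one>\<^bsub>fractions\<^esub>" "frac \<one> s \<otimes>\<^bsub>fractions\<^esub> embed s = \<one>\<^bsub>fractions\<^esub>"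
    using assms by (simp_all add: embed_def mult_frac den_one den_closed frac_one)
  show "embed s \<in> Units fractions"
    using 1 2 by (auto simp: Units_def)
  show "inv\<^bsub>fractions\<^esub> (embed s) = frac \<one> s"
    using D.inv_unique'[OF 1 2] by simp
qed

lemma frac_eq_embed:
  assumes "a \<in> carrier A" "s \<in> denominators"
  shows "frac a s = embed a \<otimes>\<^bsub>fractions\<^esub> inv\<^bsub>fractions\<^esub> (embed s)"
  unfolding embed_unit(2)[OF assms(2)] using assms by (simp add: embed_def mult_frac den_one den_closed)

text \<open>Commuting with the images of all elements makes the numerator central, hence itself a
  denominator.\<close>

lemma center_fractions:
  assumes "u \<in> ring_center fractions" "u \<noteq> \<zero>\<^bsub>fractions\<^esub>"
  shows "u \<in> Units fractions"
proof -
  interpret D: ring fractions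
    by (rule ring_fractions)
  obtain a s where u: "a \<in> carrier A" "s \<in> denominators" "u = frac a s"
    using carrier_fractionsE[OF D.center_carrier[OF assms(1)]] by metis
  have "a \<otimes> b = b \<otimes> a" if b: "b \<in> carrier A" for b
  proof -
    have "u \<otimes>\<^bsub>fractions\<^esub> embed b = embed b \<otimes>\<^bsub>fractions\<^esub> u"
      using assms(1) b by (simp add: ring_center_iff embed_def frac_mem den_one)
    then have "(a \<otimes> b) \<otimes> s = (b \<otimes> a) \<otimes> s"
      using u b by (simp add: embed_def mult_frac den_one den_closed frac_eq_iff)
    then show ?thesis
      using den_cancel[OF u(2)] u b by simp
  qed
  then have "a \<in> denominators"
    using u assms(2) by (simp add: denominators_def ring_center_iff frac_eq_zero_iff)
  then have "embed a \<in> Units fractions"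
    by (rule embed_unit)
  moreover have "inv\<^bsub>fractions\<^esub> (embed s) \<in> Units fractions"
    using embed_unit(1)[OF u(2)] by (rule D.Units_inv_Units)
  ultimately show ?thesis
    using D.Units_m_closed by (simp add: u frac_eq_embed)
qed

end

section \<open>Presented algebras and their actions\<close>

lemma carrier_free_algebra:
  "carrier (free_algebra S) = {p. \<forall>w\<in>Poly_Mapping.keys p. set (letters w) \<subseteq> S}"
  by (simp add: free_algebra_def)

lemma free_algebra_ops [simp]:
  "p \<otimes>\<^bsub>free_algebra S\<^esub> r = p * r" "p \<oplus>\<^bsub>free_algebra S\<^esub> r = p + r"
  "\<one>\<^bsub>free_algebra S\<^esub> = 1" "\<zero>\<^bsub>free_algebra S\<^esub> = 0"
  by (simp_all add: free_algebra_def ring_of_type_algebra_def)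

lemma letters_simps [simp]: "letters 0 = []" "letters (u + w) = letters u @ letters w"
  by (simp_all add: zero_free_monoid_def plus_free_monoid_def)

lemma free_algebra_closed [simp]:
  assumes "p \<in> carrier (free_algebra S)" "r \<in> carrier (free_algebra S)"
  shows "p + r \<in> carrier (free_algebra S)" "p - r \<in> carrier (free_algebra S)"
    "p * r \<in> carrier (free_algebra S)" "- p \<in> carrier (free_algebra S)"
proof -
  have pr: "\<forall>w\<in>Poly_Mapping.keys p. set (letters w) \<subseteq> S" "\<forall>w\<in>Poly_Mapping.keys r. set (letters w) \<subseteq> S"
    using assms by (simp_all add: carrier_free_algebra)
  show "p + r \<in> carrier (free_algebra S)"
    using pr keys_add[of p r] unfolding carrier_free_algebra by blast
  show "p - r \<in> carrier (free_algebra S)"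
    using pr keys_diff[of p r] unfolding carrier_free_algebra by blast
  show "- p \<in> carrier (free_algebra S)"
    using pr by (simp add: carrier_free_algebra)
  have "set (letters w) \<subseteq> S" if "w \<in> Poly_Mapping.keys (p * r)" for w
    using keys_mult[of p r] that pr by fastforce
  then show "p * r \<in> carrier (free_algebra S)"
    by (simp add: carrier_free_algebra)
qed

lemma free_algebra_closed_0_1 [simp]:
  "0 \<in> carrier (free_algebra S)" "1 \<in> carrier (free_algebra S)"
  by (simp_all add: carrier_free_algebra)

lemma scalar_closed [simp]: "scalar c \<in> carrier (free_algebra S)"
  by (simp add: scalar_def carrier_free_algebra)

lemma var_closed [simp]: "x \<in> S \<Longrightarrow> var x \<in> carrier (free_algebra S)"
  by (simp add: var_def carrier_free_algebra)

lemma free_algebra_UNIV [simp]: "p \<in> carrier (free_algebra UNIV)"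
  by (simp add: carrier_free_algebra)

lemma ring_free_algebra: "ring (free_algebra S)"
proof (rule ringI)
  show "abelian_group (free_algebra S)"
  proof (rule abelian_groupI)
    fix p assume "p \<in> carrier (free_algebra S)"
    then show "\<exists>r\<in>carrier (free_algebra S). r \<oplus>\<^bsub>free_algebra S\<^esub> p = \<zero>\<^bsub>free_algebra S\<^esub>"
      using free_algebra_closed(4)[of p S p] by (intro bexI[of _ "- p"]) simp_all
  qed (auto simp: algebra_simps)
  show "Group.monoid (free_algebra S)"
    by (rule monoidI) (auto simp: algebra_simps)
qed (auto simp: algebra_simps)

lemma single_word:
  "Poly_Mapping.single (Monomial []) c = scalar c"
  "Poly_Mapping.single (Monomial (x # xs)) c = var x * Poly_Mapping.single (Monomial xs) c"
  by (simp_all add: scalar_def var_def mult_single zero_free_monoid_def plus_free_monoid_def)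

text \<open>A polynomial is the sum of its terms, added one by one. For \<open>S = UNIV\<close> the
  carrier is the whole type.\<close>

lemma free_algebra_additive_induct:
  assumes p: "p \<in> carrier (free_algebra S)"
    and word: "\<And>ws c. set ws \<subseteq> S \<Longrightarrow> P (Poly_Mapping.single (Monomial ws) c)"
    and add: "\<And>p r. \<lbrakk>p \<in> carrier (free_algebra S); r \<in> carrier (free_algebra S); P p; P r\<rbrakk> \<Longrightarrow> P (p + r)"
  shows "P p"
proof -
  let ?f = "\<lambda>w. Poly_Mapping.single w (Poly_Mapping.lookup p w)"
  have "P (sum ?f K) \<and> sum ?f K \<in> carrier (free_algebra S)" if "K \<subseteq> Poly_Mapping.keys p" for K
    using finite_subset[OF that finite_keys] that
  proof (induction K rule: finite_induct)
    case empty
    \<comment> \<open>The empty sum is the empty word with coefficient 0.\<close>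
    show ?case
      using word[of "[]" 0] by simp
  next
    case (insert w K)
    obtain ws where w: "w = Monomial ws"
      by (cases w)
    have "set ws \<subseteq> S"
      using insert.prems p w by (fastforce simp: carrier_free_algebra)
    then have "P (?f w)" "?f w \<in> carrier (free_algebra S)"
      using word w by (auto simp: carrier_free_algebra)
    then show ?case
      using insert add free_algebra_closed(1) by simp
  qed
  moreover have "sum ?f (Poly_Mapping.keys p) = p"
    by (rule poly_mapping_eqI) (simp add: lookup_sum lookup_single when_def in_keys_iff)
  ultimately show ?thesis
    by force
qed

lemma free_algebra_induct [consumes 1, case_names scalar var add]:
  assumes p: "p \<in> carrier (free_algebra S)"
    and scalar: "\<And>c. P (scalar c)"
    and var: "\<And>x p. \<lbrakk>x \<in> S; p \<in> carrier (free_algebra S); P p\<rbrakk> \<Longrightarrow> P (var x * p)"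
    and add: "\<And>p r. \<lbrakk>p \<in> carrier (free_algebra S); r \<in> carrier (free_algebra S); P p; P r\<rbrakk> \<Longrightarrow> P (p + r)"
  shows "P p"
  using p
proof (rule free_algebra_additive_induct[where P = P, OF _ _ add])
  fix ws :: "'a list" and c
  assume "set ws \<subseteq> S"
  then have "P (Poly_Mapping.single (Monomial ws) c) \<and>
      Poly_Mapping.single (Monomial ws) c \<in> carrier (free_algebra S)"
  proof (induction ws)
    case Nil
    show ?case
      using scalar by (simp add: single_word)
  next
    case (Cons x ws)
    then show ?case
      using var[of x "Poly_Mapping.single (Monomial ws) c"] by (simp add: single_word)
  qed
  then show "P (Poly_Mapping.single (Monomial ws) c)"
    by simp
qed

locale presentation =
  fixes S :: "'g set" and Rels :: "'g free_poly set"
  assumes Rels: "Rels \<subseteq> carrier (free_algebra S)"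
begin

abbreviation "FA \<equiv> free_algebra S"
abbreviation "PA \<equiv> presented_algebra S Rels"

definition rel_ideal :: "'g free_poly set" where
  "rel_ideal = genideal FA Rels"

definition cls :: "'g free_poly \<Rightarrow> 'g free_poly set" where
  "cls p = rel_ideal +>\<^bsub>FA\<^esub> p"

sublocale rel: ideal rel_ideal FA
  unfolding rel_ideal_def by (rule ring.genideal_ideal[OF ring_free_algebra Rels])

lemma PA_Quot: "PA = FA Quot rel_ideal"
  by (simp add: presented_algebra_def rel_ideal_def)

sublocale PA: ring PA
  unfolding PA_Quot by (rule rel.quotient_is_ring)

lemma cls_hom: "cls \<in> Ring.ring_hom FA PA"
  using rel.rcos_ring_hom unfolding PA_Quot cls_def by simp

lemma cls_closed: "p \<in> carrier FA \<Longrightarrow> cls p \<in> carrier PA"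
  using ring_hom_memE(1)[OF cls_hom] by blast

lemma cls_mult: "p \<in> carrier FA \<Longrightarrow> r \<in> carrier FA \<Longrightarrow> cls (p * r) = cls p \<otimes>\<^bsub>PA\<^esub> cls r"
  using ring_hom_memE(2)[OF cls_hom, of p r] unfolding free_algebra_ops(1) by blast

lemma cls_add: "p \<in> carrier FA \<Longrightarrow> r \<in> carrier FA \<Longrightarrow> cls (p + r) = cls p \<oplus>\<^bsub>PA\<^esub> cls r"
  using ring_hom_memE(3)[OF cls_hom, of p r] unfolding free_algebra_ops(2) by blast

lemma cls_one: "cls 1 = \<one>\<^bsub>PA\<^esub>"
  using ring_hom_memE(4)[OF cls_hom] by simp

lemma carrier_PA: "carrier PA = cls ` carrier FA"
  unfolding PA_Quot FactRing_def A_RCOSETS_def' cls_def by auto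

lemma cls_ideal: "p \<in> rel_ideal \<Longrightarrow> cls p = \<zero>\<^bsub>PA\<^esub>"
  using rel.a_rcos_const[of p] by (simp add: PA_Quot FactRing_def cls_def)

lemma cls_Rels: "p \<in> Rels \<Longrightarrow> cls p = \<zero>\<^bsub>PA\<^esub>"
  using ring.genideal_self[OF ring_free_algebra Rels] cls_ideal unfolding rel_ideal_def by blast

lemma zero_rel_ideal: "0 \<in> rel_ideal"
  using additive_subgroup.zero_closed[OF rel.additive_subgroup_axioms] by simp

lemma cls_zero: "cls 0 = \<zero>\<^bsub>PA\<^esub>"
  using cls_ideal zero_rel_ideal by simp

lemma cls_eqI:
  assumes "p - r \<in> Rels" "p \<in> carrier FA" "r \<in> carrier FA"
  shows "cls p = cls r"
proof -
  have "cls p = cls ((p - r) + r)"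
    by simp
  also have "\<dots> = cls r"
    using assms by (subst cls_add) (auto simp: cls_Rels cls_closed intro: free_algebra_closed)
  finally show ?thesis .
qed

lemma mem_cls: "p' \<in> cls p \<longleftrightarrow> (\<exists>i\<in>rel_ideal. p' = i + p)"
  by (auto simp: cls_def a_r_coset_def')

definition csc :: "complex \<Rightarrow> 'g free_poly set" where
  "csc c = cls (scalar c)"

lemma scalar_simps:
  "scalar (c + d) = scalar c + (scalar d :: 'g free_poly)" "scalar (c * d) = scalar c * (scalar d :: 'g free_poly)"
  "scalar 1 = (1 :: 'g free_poly)"
  by (simp_all add: scalar_def single_add mult_single)

lemma scalar_commute: "p * scalar c = scalar c * (p :: 'g free_poly)"
proof -
  have "p \<in> carrier (free_algebra UNIV)"
    by simp
  then show ?thesis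
  proof (induction rule: free_algebra_induct)
    case (scalar d)
    then show ?case
      by (simp add: mult.commute[of c] flip: scalar_simps)
  next
    case (var x p)
    have xc: "var x * scalar c = scalar c * (var x :: 'g free_poly)"
      by (simp add: var_def scalar_def mult_single)
    have "var x * p * scalar c = var x * (p * scalar c)"
      by (simp only: mult.assoc)
    also have "\<dots> = (var x * scalar c) * p"
      by (simp only: var.IH mult.assoc)
    finally show ?case
      by (simp only: xc mult.assoc)
  next
    case (add p r)
    then show ?case
      by (simp only: distrib_left distrib_right)
  qed
qed

sublocale PA: central_scalars PA csc
proof
  fix c d :: complex
  show "csc c \<in> carrier PA" "csc (c + d) = csc c \<oplus>\<^bsub>PA\<^esub> csc d" "csc (c * d) = csc c \<otimes>\<^bsub>PA\<^esub> csc d"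
    "csc 1 = \<one>\<^bsub>PA\<^esub>"
    by (simp_all add: csc_def cls_closed scalar_simps cls_add cls_mult cls_one)
  fix x assume "x \<in> carrier PA"
  then obtain p where "p \<in> carrier FA" "x = cls p"
    unfolding carrier_PA by blast
  then show "x \<otimes>\<^bsub>PA\<^esub> csc c = csc c \<otimes>\<^bsub>PA\<^esub> x"
    using cls_mult[of p "scalar c"] cls_mult[of "scalar c" p] scalar_closed
    by (simp add: csc_def scalar_commute)
qed

lemma PA_induct [consumes 1, case_names scalar var add]:
  assumes "u \<in> carrier PA"
    and "\<And>c. P (csc c)"
    and "\<And>x u. \<lbrakk>x \<in> S; u \<in> carrier PA; P u\<rbrakk> \<Longrightarrow> P (cls (var x) \<otimes>\<^bsub>PA\<^esub> u)"
    and "\<And>u v. \<lbrakk>u \<in> carrier PA; v \<in> carrier PA; P u; P v\<rbrakk> \<Longrightarrow> P (u \<oplus>\<^bsub>PA\<^esub> v)"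
  shows "P u"
proof -
  obtain p where p: "p \<in> carrier FA" "u = cls p"
    using assms(1) unfolding carrier_PA by blast
  from p(1) have "P (cls p)"
  proof (induction rule: free_algebra_induct)
    case (scalar c)
    then show ?case
      using assms(2) by (simp add: csc_def)
  next
    case (var x p)
    then show ?case
      using assms(3)[of x "cls p"] by (simp add: cls_mult cls_closed)
  next
    case (add p r)
    then show ?case
      using assms(4)[of "cls p" "cls r"] by (simp add: cls_add cls_closed)
  qed
  then show ?thesis
    by (simp add: p(2))
qed

end

section \<open>Actions of a presented algebra on complex functions\<close>

locale linear_action =
  fixes lact :: "'g \<Rightarrow> ('h \<Rightarrow> complex) \<Rightarrow> 'h \<Rightarrow> complex"
  assumes lact_add: "lact x (\<lambda>g. v g + u g) = (\<lambda>g. lact x v g + lact x u g)"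
    and lact_scale: "lact x (\<lambda>g. c * v g) = (\<lambda>g. c * lact x v g)"
begin

text \<open>With \<open>foldr\<close> the last letter acts first, as a left action requires.\<close>

definition wact :: "'g list \<Rightarrow> ('h \<Rightarrow> complex) \<Rightarrow> 'h \<Rightarrow> complex" where
  "wact ws v = foldr lact ws v"

definition act :: "'g free_poly \<Rightarrow> ('h \<Rightarrow> complex) \<Rightarrow> 'h \<Rightarrow> complex" where
  "act p v g = (\<Sum>w\<in>Poly_Mapping.keys p. Poly_Mapping.lookup p w * wact (letters w) v g)"

lemma act_superset:
  assumes "finite K" "Poly_Mapping.keys p \<subseteq> K"
  shows "act p v g = (\<Sum>w\<in>K. Poly_Mapping.lookup p w * wact (letters w) v g)"
  unfolding act_def by (rule sum.mono_neutral_left) (use assms in \<open>auto simp: in_keys_iff\<close>)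

lemma act_add: "act (p + r) v = (\<lambda>g. act p v g + act r v g)"
proof
  fix g
  let ?K = "Poly_Mapping.keys p \<union> Poly_Mapping.keys r"
  show "act (p + r) v g = act p v g + act r v g"
    using act_superset[of ?K p] act_superset[of ?K r] act_superset[of ?K "p + r"] keys_add[of p r]
    by (simp add: lookup_add algebra_simps sum.distrib)
qed

lemma act_single: "act (Poly_Mapping.single w c) v = (\<lambda>g. c * wact (letters w) v g)"
  by (cases "c = 0") (auto simp: act_def)

lemma act_scalar: "act (scalar c) v = (\<lambda>g. c * v g)"
  by (simp add: scalar_def act_single wact_def)

lemma act_one: "act 1 v = v"
  using act_scalar[of 1 v] by (simp add: scalar_def)

lemma act_zero: "act 0 v = (\<lambda>g. 0)"
  by (simp add: act_def fun_eq_iff)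

lemma free_mult_induct:
  assumes "\<And>ws c. P (Poly_Mapping.single (Monomial ws) c)" "\<And>p r. P p \<Longrightarrow> P r \<Longrightarrow> P (p + r)"
  shows "P (p :: 'g free_poly)"
  by (rule free_algebra_additive_induct[of p UNIV P, OF free_algebra_UNIV assms])

lemma act_scalar_mult: "act (scalar c * p) v = (\<lambda>g. c * act p v g)"
proof (rule free_mult_induct[of _ p])
  fix ws :: "'g list" and d
  show "act (scalar c * Poly_Mapping.single (Monomial ws) d) v = (\<lambda>g. c * act (Poly_Mapping.single (Monomial ws) d) v g)"
    by (simp add: scalar_def mult_single act_single mult.assoc)
qed (simp add: act_add distrib_left)

lemma act_var_mult: "act (var x * p) v = lact x (act p v)"
proof (rule free_mult_induct[of _ p])
  fix ws :: "'g list" and d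
  show "act (var x * Poly_Mapping.single (Monomial ws) d) v = lact x (act (Poly_Mapping.single (Monomial ws) d) v)"
    by (simp add: var_def mult_single act_single plus_free_monoid_def wact_def lact_scale)
qed (simp add: act_add lact_add distrib_left)

lemma act_mult: "act (p * r) v = act p (act r v)"
proof -
  have "p \<in> carrier (free_algebra UNIV)"
    by simp
  then show ?thesis
    by (induction rule: free_algebra_induct)
      (simp_all add: act_scalar_mult act_scalar act_var_mult act_add distrib_right mult.assoc)
qed

lemma act_var: "act (var x) v = lact x v"
  using act_var_mult[of x 1 v] by (simp add: act_one)

lemma act_diff: "act (p - r) v = (\<lambda>g. act p v g - act r v g)"
  using act_add[of "p - r" r v] by (simp add: fun_eq_iff algebra_simps)

lemma act_vec_zero: "act p (\<lambda>g. 0) = (\<lambda>g. 0)"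
  using act_mult[of p 0 "\<lambda>g. 0"] by (simp add: act_zero)

end

locale presentation_action = presentation S Rels + linear_action lact
  for S :: "'g set" and Rels and lact :: "'g \<Rightarrow> ('h \<Rightarrow> complex) \<Rightarrow> 'h \<Rightarrow> complex" +
  assumes act_Rels: "p \<in> Rels \<Longrightarrow> act p v = (\<lambda>g. 0)"
begin

text \<open>The polynomials that annihilate every function form a two-sided ideal, and it contains
  the relations.\<close>

lemma act_rel_ideal: "p \<in> rel_ideal \<Longrightarrow> act p v = (\<lambda>g. 0)"
proof -
  let ?J = "{p \<in> carrier FA. \<forall>v. act p v = (\<lambda>g. 0)}"
  have uminus: "\<ominus>\<^bsub>FA\<^esub> p = - p" if "p \<in> carrier FA" for p
    using rel.add.inv_equality[of "- p" p] that by (simp add: a_inv_def)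
  have "ideal ?J FA"
  proof (rule idealI[OF ring_free_algebra])
    show "subgroup ?J (add_monoid FA)"
    proof (rule rel.add.subgroupI)
      have "0 \<in> ?J"
        by (simp add: act_zero)
      then show "?J \<noteq> {}"
        by blast
      fix p assume "p \<in> ?J"
      moreover have "act (- p) v = (\<lambda>g. - act p v g)" for v
        using act_diff[of 0 p v] by (simp add: act_zero)
      ultimately show "\<ominus>\<^bsub>FA\<^esub> p \<in> ?J"
        using uminus[of p] free_algebra_closed(4)[of p S p] by (simp add: a_inv_def)
    next
      fix p r assume "p \<in> ?J" "r \<in> ?J"
      then show "p \<oplus>\<^bsub>FA\<^esub> r \<in> ?J"
        using free_algebra_closed(1)[of p S r] by (simp add: act_add)
    qed auto
    fix p r assume "p \<in> ?J" "r \<in> carrier FA"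
    then show "r \<otimes>\<^bsub>FA\<^esub> p \<in> ?J" "p \<otimes>\<^bsub>FA\<^esub> r \<in> ?J"
      using free_algebra_closed(3)[of p S r] free_algebra_closed(3)[of r S p]
      by (simp_all add: act_mult act_vec_zero)
  qed
  moreover have "Rels \<subseteq> ?J"
    using Rels act_Rels by blast
  ultimately have "rel_ideal \<subseteq> ?J"
    unfolding rel_ideal_def by (rule rel.genideal_minimal)
  then show "p \<in> rel_ideal \<Longrightarrow> act p v = (\<lambda>g. 0)"
    by blast
qed

text \<open>Uses an arbitrary representative; by \<open>act_rel_ideal\<close> all of them act
  alike.\<close>

definition qact :: "'g free_poly set \<Rightarrow> ('h \<Rightarrow> complex) \<Rightarrow> 'h \<Rightarrow> complex" where
  "qact u v = act (SOME p. p \<in> u) v"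

lemma qact_cls: "p \<in> carrier FA \<Longrightarrow> qact (cls p) v = act p v"
proof -
  assume "p \<in> carrier FA"
  have "p \<in> cls p"
    using mem_cls[of p p] zero_rel_ideal by (metis add_0)
  then have "(SOME p'. p' \<in> cls p) \<in> cls p"
    by (rule someI)
  then obtain i where "i \<in> rel_ideal" "(SOME p'. p' \<in> cls p) = i + p"
    using mem_cls by auto
  then show ?thesis
    by (simp add: qact_def act_add act_rel_ideal)
qed

lemma qact_simps:
  assumes "u \<in> carrier PA" "u' \<in> carrier PA"
  shows "qact (u \<otimes>\<^bsub>PA\<^esub> u') v = qact u (qact u' v)" "qact (u \<oplus>\<^bsub>PA\<^esub> u') v = (\<lambda>g. qact u v g + qact u' v g)"
    "qact (csc c) v = (\<lambda>g. c * v g)" "qact \<one>\<^bsub>PA\<^esub> v = v" "qact \<zero>\<^bsub>PA\<^esub> v = (\<lambda>g. 0)"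
proof -
  obtain p p' where p: "p \<in> carrier FA" "u = cls p" "p' \<in> carrier FA" "u' = cls p'"
    using assms unfolding carrier_PA by blast
  then show "qact (u \<otimes>\<^bsub>PA\<^esub> u') v = qact u (qact u' v)" "qact (u \<oplus>\<^bsub>PA\<^esub> u') v = (\<lambda>g. qact u v g + qact u' v g)"
    using free_algebra_closed[of p S p']
    by (simp_all add: qact_cls act_mult act_add flip: cls_mult cls_add)
  show "qact (csc c) v = (\<lambda>g. c * v g)"
    using scalar_closed by (simp add: csc_def qact_cls act_scalar)
  have 1: "1 \<in> carrier FA" and 0: "0 \<in> carrier FA"
    by simp_all
  show "qact \<one>\<^bsub>PA\<^esub> v = v" "qact \<zero>\<^bsub>PA\<^esub> v = (\<lambda>g. 0)"
    using qact_cls[OF 1] qact_cls[OF 0] by (simp_all add: cls_one cls_zero act_one act_zero)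
qed

end

section \<open>Leading terms\<close>

text \<open>Functions may have infinite support and then need not have a leading exponent.\<close>

definition leads :: "('g::linordered_ab_group_add \<Rightarrow> complex) \<Rightarrow> 'g \<Rightarrow> bool" where
  "leads v g \<longleftrightarrow> v g \<noteq> 0 \<and> (\<forall>h>g. v h = 0)"

text \<open>The model is multiplication by an element with leading exponent \<open>d\<close>.
  Degrees add under composition, and sums of operators of different degrees take the greater one,
  which is what excludes zero divisors.\<close>

definition has_degree_shift :: "(('g::linordered_ab_group_add \<Rightarrow> complex) \<Rightarrow> 'g \<Rightarrow> complex) \<Rightarrow> 'g \<Rightarrow> bool" where
  "has_degree_shift T d \<longleftrightarrow> (\<forall>v g. leads v g \<longrightarrow> leads (T v) (g + d))"

lemma has_degree_shift_comp:
  "has_degree_shift T d \<Longrightarrow> has_degree_shift U e \<Longrightarrow> has_degree_shift (\<lambda>v. T (U v)) (d + e)"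
  unfolding has_degree_shift_def by (metis add.assoc add.commute)

lemma has_degree_shift_id: "has_degree_shift (\<lambda>v. v) 0"
  by (simp add: has_degree_shift_def)

lemma has_degree_shift_scale: "c \<noteq> 0 \<Longrightarrow> has_degree_shift T d \<Longrightarrow> has_degree_shift (\<lambda>v g. c * T v g) d"
  by (simp add: has_degree_shift_def leads_def)

lemma has_degree_shift_add_less:
  assumes "has_degree_shift T d" "has_degree_shift U e" "e < d"
  shows "has_degree_shift (\<lambda>v g. T v g + U v g) d"
proof -
  have "leads (\<lambda>h. T v h + U v h) (g + d)" if "leads v g" for v g
  proof -
    have "leads (T v) (g + d)" "leads (U v) (g + e)"
      using assms that by (auto simp: has_degree_shift_def)
    moreover have "g + e < g + d"
      using assms(3) by simp
    ultimately show ?thesis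
      unfolding leads_def by (metis add.right_neutral less_trans)
  qed
  then show ?thesis
    by (simp add: has_degree_shift_def)
qed

lemma has_degree_shift_add:
  assumes "has_degree_shift T d" "has_degree_shift U e" "d \<noteq> e"
  shows "has_degree_shift (\<lambda>v g. T v g + U v g) (max d e)"
proof (cases "e < d")
  case True
  then show ?thesis
    using has_degree_shift_add_less[OF assms(1,2)] by simp
next
  case False
  then have "d < e"
    using assms(3) by simp
  then show ?thesis
    using has_degree_shift_add_less[OF assms(2,1)] by (simp add: add.commute)
qed

lemma has_degree_shift_translation:
  assumes "\<And>v g. T v g = c g * v (g - d)" "\<And>g. c g \<noteq> 0"
  shows "has_degree_shift T d"
  unfolding has_degree_shift_def leads_def using assms by (simp add: less_diff_eq)

lemma has_degree_shift_nonzero: "has_degree_shift T d \<Longrightarrow> \<exists>v. T v \<noteq> (\<lambda>g. 0)"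
proof -
  assume "has_degree_shift T d"
  moreover have "leads (\<lambda>g. if g = 0 then 1 else 0) 0"
    by (simp add: leads_def)
  ultimately have "leads (T (\<lambda>g. if g = 0 then 1 else 0)) (0 + d)"
    unfolding has_degree_shift_def by blast
  then have "T (\<lambda>g. if g = 0 then 1 else 0) d \<noteq> 0"
    by (simp add: leads_def)
  then show ?thesis
    by metis
qed

section \<open>A faithful action of the quantum sphere algebra\<close>

text \<open>The exponent lattice of the quantum torus generated by \<open>z\<^sub>i\<close> (coordinate \<open>2 i\<close>) and \<open>\<Omega>\<^sub>i\<close>
  (coordinate \<open>2 i + 1\<close>), ordered lexicographically.\<close>

type_synonym lattice = "nat \<Rightarrow>\<^sub>0 int"

definition eps_z :: "nat \<Rightarrow> lattice" where "eps_z i = Poly_Mapping.single (2 * i) 1"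
definition eps_Om :: "nat \<Rightarrow> lattice" where "eps_Om i = Poly_Mapping.single (Suc (2 * i)) 1"

text \<open>Ordered monomials list z_0, Om_0, z_1, Om_1 and so on. Moving z_i from the left to its
  place costs q for each z_l with l < i and nothing for each Om_l; moving Om_j costs q^2 for each
  z_l with l < j. This is the origin of the powers of q in \<open>z_act\<close> and
  \<open>om_act\<close>.\<close>

definition zsum :: "nat \<Rightarrow> lattice \<Rightarrow> int" where
  "zsum i g = (\<Sum>l<i. Poly_Mapping.lookup g (2 * l))"

lemma zsum_add: "zsum i (g + h) = zsum i g + zsum i h"
  by (simp add: zsum_def lookup_add sum.distrib)

lemma zsum_diff: "zsum i (g - h) = zsum i g - zsum i h"
  by (simp add: zsum_def lookup_minus sum_subtractf)

lemma zsum_eps_z: "zsum i (eps_z j) = (if j < i then 1 else 0)"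
  by (simp add: zsum_def eps_z_def lookup_single when_def)

lemma zsum_eps_Om: "zsum i (eps_Om j) = 0"
proof -
  have "2 * l \<noteq> Suc (2 * j)" for l
    by presburger
  then show ?thesis
    by (simp add: zsum_def eps_Om_def lookup_single when_def)
qed

text \<open>In this order the lowest index decides, so Om_i dominates Om_(i+1) and is the leading
  part of z_i zs_i = Om_i - Om_(i+1).\<close>

lemma eps_Om_less: "i < j \<Longrightarrow> eps_Om j < eps_Om i"
  unfolding less_poly_mapping.rep_eq less_fun_def
  by (intro exI[of _ "Suc (2 * i)"]) (auto simp: eps_Om_def lookup_single when_def)

text \<open>Scaling and difference are named so that operator identities follow by rewriting with
  \<open>shift_linear\<close>.\<close>

definition scl :: "complex \<Rightarrow> (lattice \<Rightarrow> complex) \<Rightarrow> lattice \<Rightarrow> complex" where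
  "scl c v g = c * v g"

definition dif :: "(lattice \<Rightarrow> complex) \<Rightarrow> (lattice \<Rightarrow> complex) \<Rightarrow> lattice \<Rightarrow> complex" where
  "dif v u g = v g - u g"

definition z_act :: "complex \<Rightarrow> nat \<Rightarrow> (lattice \<Rightarrow> complex) \<Rightarrow> lattice \<Rightarrow> complex" where
  "z_act q i v g = q powi (zsum i g) * v (g - eps_z i)"

definition zinv_act :: "complex \<Rightarrow> nat \<Rightarrow> (lattice \<Rightarrow> complex) \<Rightarrow> lattice \<Rightarrow> complex" where
  "zinv_act q i v g = q powi (- zsum i g) * v (g + eps_z i)"

text \<open>The factor that vanishes from j = N on realizes Om_N = 0, so that
  \<open>Zs (N - 1)\<close> acts by the single term z_(N-1)^-1 Om_(N-1).\<close>

definition om_act :: "complex \<Rightarrow> nat \<Rightarrow> nat \<Rightarrow> (lattice \<Rightarrow> complex) \<Rightarrow> lattice \<Rightarrow> complex" where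
  "om_act q N j v g = (if j < N then 1 else 0) * q powi (2 * zsum j g) * v (g - eps_Om j)"

text \<open>In the quantum torus, \<open>z\<^sub>i\<^sup>* = z\<^sub>i\<^sup>-\<^sup>1 (\<Omega>\<^sub>i - \<Omega>\<^sub>i\<^sub>+\<^sub>1)\<close>.\<close>

fun F_act :: "complex \<Rightarrow> nat \<Rightarrow> F_gen \<Rightarrow> (lattice \<Rightarrow> complex) \<Rightarrow> lattice \<Rightarrow> complex" where
  "F_act q N (Z i) v = z_act q i v"
| "F_act q N (Zs i) v = zinv_act q i (dif (om_act q N i v) (om_act q N (Suc i) v))"

lemmas shift_defs = scl_def dif_def z_act_def zinv_act_def om_act_def

lemma linear_action_F: "linear_action (F_act q N)"
proof
  fix x c v u
  show "F_act q N x (\<lambda>g. v g + u g) = (\<lambda>g. F_act q N x v g + F_act q N x u g)"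
    by (cases x) (simp_all add: fun_eq_iff shift_defs algebra_simps)
  show "F_act q N x (\<lambda>g. c * v g) = (\<lambda>g. c * F_act q N x v g)"
    by (cases x) (simp_all add: fun_eq_iff shift_defs algebra_simps)
qed

lemma shift_linear:
  "z_act q i (scl c v) = scl c (z_act q i v)" "z_act q i (dif v u) = dif (z_act q i v) (z_act q i u)"
  "zinv_act q i (scl c v) = scl c (zinv_act q i v)" "zinv_act q i (dif v u) = dif (zinv_act q i v) (zinv_act q i u)"
  "om_act q N j (scl c v) = scl c (om_act q N j v)" "om_act q N j (dif v u) = dif (om_act q N j v) (om_act q N j u)"
  "scl c (dif v u) = dif (scl c v) (scl c u)" "scl c (scl d v) = scl (c * d) v" "scl 1 v = v"
  by (simp_all add: fun_eq_iff shift_defs algebra_simps)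

context
  fixes q :: complex and N :: nat
  assumes q: "q \<noteq> 0"
begin

lemma z_z_act: "i < j \<Longrightarrow> z_act q i (z_act q j v) = scl (inverse q) (z_act q j (z_act q i v))"
  using q by (simp add: fun_eq_iff shift_defs zsum_diff zsum_eps_z power_int_diff field_simps diff_diff_eq add.commute)

lemma z_zinv_act:
  "i < j \<Longrightarrow> z_act q i (zinv_act q j v) = scl q (zinv_act q j (z_act q i v))"
  "j < i \<Longrightarrow> z_act q i (zinv_act q j v) = scl (inverse q) (zinv_act q j (z_act q i v))"
  using q by (simp_all add: fun_eq_iff shift_defs zsum_diff zsum_add zsum_eps_z power_int_diff power_int_add
      power_int_minus field_simps)

lemma z_zinv_same: "z_act q i (zinv_act q i v) = v" "zinv_act q i (z_act q i v) = v"
  using q by (simp_all add: fun_eq_iff shift_defs zsum_diff zsum_add zsum_eps_z power_int_minus)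

lemma zinv_zinv_act: "i < j \<Longrightarrow> zinv_act q i (zinv_act q j v) = scl (inverse q) (zinv_act q j (zinv_act q i v))"
  using q by (simp add: fun_eq_iff shift_defs zsum_add zsum_eps_z power_int_add power_int_minus power_int_diff field_simps)

lemma q_powi_double: "q powi (2 * k + 2) = q\<^sup>2 * q powi (2 * k)" "q powi (2 * k - 2) = inverse (q\<^sup>2) * q powi (2 * k)"
  using q by (simp_all add: power_int_add power_int_diff field_simps)

lemma z_om_act:
  "i < k \<Longrightarrow> z_act q i (om_act q N k v) = scl (inverse (q\<^sup>2)) (om_act q N k (z_act q i v))"
  "\<not> i < k \<Longrightarrow> z_act q i (om_act q N k v) = om_act q N k (z_act q i v)"
  by (simp_all add: fun_eq_iff shift_defs zsum_diff zsum_eps_z zsum_eps_Om q_powi_double right_diff_distrib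
      diff_diff_eq add.commute mult.left_commute)

lemma om_zinv_act:
  "i < k \<Longrightarrow> om_act q N k (zinv_act q i v) = scl (inverse (q\<^sup>2)) (zinv_act q i (om_act q N k v))"
  "\<not> i < k \<Longrightarrow> om_act q N k (zinv_act q i v) = zinv_act q i (om_act q N k v)"
  using q by (simp_all add: fun_eq_iff shift_defs zsum_diff zsum_add zsum_eps_z zsum_eps_Om q_powi_double distrib_left
      add_diff_eq diff_add_eq mult.left_commute)

lemma om_om_act: "om_act q N j (om_act q N k v) = om_act q N k (om_act q N j v)"
  by (simp add: fun_eq_iff shift_defs zsum_diff zsum_eps_Om diff_diff_eq add.commute mult.left_commute)

lemma om_act_N: "om_act q N N v = scl 0 v"
  by (simp add: fun_eq_iff shift_defs)

lemma Z_Zs_act: "F_act q N (Z i) (F_act q N (Zs i) v) = dif (om_act q N i v) (om_act q N (Suc i) v)"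
  by (simp add: z_zinv_same)

text \<open>Om_i passes z_i freely and Om_(i+1) passes it with the factor q^2; the difference from
  \<open>Z_Zs_act\<close> is the right-hand side of the last relation.\<close>

lemma Zs_Z_act: "F_act q N (Zs i) (F_act q N (Z i) v) = dif (om_act q N i v) (scl (q\<^sup>2) (om_act q N (Suc i) v))"
proof -
  have "om_act q N (Suc i) (z_act q i v) = scl (q\<^sup>2) (z_act q i (om_act q N (Suc i) v))"
    using q by (simp add: z_om_act shift_linear)
  moreover have "om_act q N i (z_act q i v) = z_act q i (om_act q N i v)"
    by (simp add: z_om_act)
  ultimately show ?thesis
    by (simp add: shift_linear z_zinv_same)
qed

lemma q_inverse_inverse: "q * (inverse q * inverse q) = inverse q" "q * inverse (q * q) = inverse q"
  using q by (simp_all add: field_simps)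

text \<open>For i < j, passing z_j^-1 gives q and passing Om_j or Om_(j+1) gives q^-2, in total
  q^-1. For j < i both Om_j and Om_(j+1) commute with z_i, as j + 1 is at most i, and z_j^-1 alone
  gives q^-1.\<close>

lemma Z_Zs_act_diff:
  assumes "i \<noteq> j"
  shows "F_act q N (Z i) (F_act q N (Zs j) v) = scl (inverse q) (F_act q N (Zs j) (F_act q N (Z i) v))"
proof (cases "i < j")
  case True
  then show ?thesis
    using q by (simp add: shift_linear z_zinv_act z_om_act power2_eq_square q_inverse_inverse)
next
  case False
  then show ?thesis
    using q assms by (simp add: shift_linear z_zinv_act z_om_act)
qed

lemma Zs_Zs_act:
  assumes "i < j"
  shows "F_act q N (Zs i) (F_act q N (Zs j) v) = scl q (F_act q N (Zs j) (F_act q N (Zs i) v))"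
  using q assms om_om_act[of i j] om_om_act[of i "Suc j"] om_om_act[of "Suc i" j] om_om_act[of "Suc i" "Suc j"]
  by (simp add: shift_linear om_zinv_act zinv_zinv_act power2_eq_square q_inverse_inverse)
    (simp add: fun_eq_iff dif_def)

end

section \<open>Ordered monomials span\<close>

context central_scalars
begin

inductive_set lspan :: "'a set \<Rightarrow> 'a set" for B where
  zero: "\<zero> \<in> lspan B"
| add: "\<lbrakk>b \<in> B; u \<in> lspan B\<rbrakk> \<Longrightarrow> sc c \<otimes> b \<oplus> u \<in> lspan B"

lemma lspan_closed: "B \<subseteq> carrier R \<Longrightarrow> u \<in> lspan B \<Longrightarrow> u \<in> carrier R"
  by (erule lspan.induct) auto

lemma lspan_base: "B \<subseteq> carrier R \<Longrightarrow> b \<in> B \<Longrightarrow> b \<in> lspan B"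
  using lspan.add[of b B \<zero> 1, OF _ lspan.zero] by (auto simp: sc_one)

lemma lspan_add:
  assumes "B \<subseteq> carrier R" "u \<in> lspan B" "v \<in> lspan B"
  shows "u \<oplus> v \<in> lspan B"
  using assms(2)
proof (induction rule: lspan.induct)
  case zero
  then show ?case
    using assms lspan_closed by simp
next
  case (add b u c)
  have "sc c \<otimes> b \<oplus> u \<oplus> v = sc c \<otimes> b \<oplus> (u \<oplus> v)"
    using add assms lspan_closed[OF assms(1)] by (intro a_assoc) auto
  then show ?case
    using add lspan.add by simp
qed

lemma lspan_mult:
  assumes "B \<subseteq> carrier R" "B' \<subseteq> carrier R" "y \<in> carrier R" "u \<in> lspan B"
    and base: "\<And>b c. b \<in> B \<Longrightarrow> sc c \<otimes> (y \<otimes> b) \<in> lspan B'"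
  shows "y \<otimes> u \<in> lspan B'"
  using assms(4)
proof (induction rule: lspan.induct)
  case zero
  then show ?case
    using assms(3) lspan.zero by simp
next
  case (add b u c)
  have cl: "b \<in> carrier R" "u \<in> carrier R"
    using add assms(1) lspan_closed[OF assms(1)] by auto
  have "y \<otimes> (sc c \<otimes> b \<oplus> u) = sc c \<otimes> (y \<otimes> b) \<oplus> y \<otimes> u"
    using cl assms(3) by (simp add: r_distr sc_left_commute[of y])
  then show ?case
    using lspan_add[OF assms(2) base[OF add(1)] add(3)] by simp
qed

lemma lspan_scale:
  assumes "B \<subseteq> carrier R" "u \<in> lspan B"
  shows "sc c \<otimes> u \<in> lspan B"
proof (rule lspan_mult[OF assms(1,1) sc_closed assms(2)])
  fix b d assume b: "b \<in> B"
  have "sc (d * c) \<otimes> b \<oplus> \<zero> \<in> lspan B"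
    using b lspan.zero by (rule lspan.add)
  then show "sc d \<otimes> (sc c \<otimes> b) \<in> lspan B"
    using assms(1) b by (auto simp: sc_mult m_assoc subset_iff)
qed

text \<open>The inductive span may list the same \<open>b\<close> repeatedly. Once terms are
  collected, distinct terms belong to distinct monomials and so have distinct leading
  exponents.\<close>

lemma lspan_expansion:
  assumes B: "B \<subseteq> carrier R" and "u \<in> lspan B"
  shows "\<exists>W c. finite W \<and> W \<subseteq> B \<and> u = (\<Oplus>b\<in>W. sc (c b) \<otimes> b)"
  using assms(2)
proof (induction rule: lspan.induct)
  case zero
  show ?case
    by (intro exI[of _ "{}"]) simp
next
  case (add b u d)
  then obtain W c where W: "finite W" "W \<subseteq> B" "u = (\<Oplus>b\<in>W. sc (c b) \<otimes> b)"
    by blast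
  \<comment> \<open>The coefficient of \<open>b\<close> starts from 0 if \<open>b\<close> is new to
    the sum.\<close>
  let ?c = "c(b := (if b \<in> W then c b else 0) + d)" and ?Y = "W - {b}"
  have Y: "?Y \<subseteq> carrier R" "b \<in> carrier R" "finite ?Y"
    using W add B by auto
  have eq: "(\<Oplus>b\<in>?Y. sc (?c b) \<otimes> b) = (\<Oplus>b\<in>?Y. sc (c b) \<otimes> b)"
    by (rule finsum_cong') (use Y in auto)
  have cl: "(\<Oplus>b\<in>?Y. sc (c b) \<otimes> b) \<in> carrier R"
    by (rule finsum_closed) (use Y in auto)
  have u: "u = sc (if b \<in> W then c b else 0) \<otimes> b \<oplus> (\<Oplus>b\<in>?Y. sc (c b) \<otimes> b)"
  proof (cases "b \<in> W")
    case True
    then have "W = insert b ?Y"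
      by auto
    then have "u = (\<Oplus>b\<in>insert b ?Y. sc (c b) \<otimes> b)"
      using W(3) by simp
    also have "\<dots> = sc (c b) \<otimes> b \<oplus> (\<Oplus>b\<in>?Y. sc (c b) \<otimes> b)"
      by (rule finsum_insert) (use Y in auto)
    finally show ?thesis
      using True by simp
  next
    case False
    then show ?thesis
      using W Y cl by (simp add: sc_zero)
  qed
  have "(\<Oplus>b\<in>insert b ?Y. sc (?c b) \<otimes> b) = sc (?c b) \<otimes> b \<oplus> (\<Oplus>b\<in>?Y. sc (?c b) \<otimes> b)"
    by (rule finsum_insert) (use Y in auto)
  also have "\<dots> = sc d \<otimes> b \<oplus> u"
    unfolding eq u using Y cl by (simp add: sc_add l_distr a_ac)
  finally show ?case
    using W add(1) Y(3) by (intro exI[of _ "insert b ?Y"] exI[of _ ?c]) auto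
qed

end

lemma (in ring) nat_pow_Suc_mult:
  "x \<in> carrier R \<Longrightarrow> y \<in> carrier R \<Longrightarrow> x \<otimes> (x [^] (n::nat) \<otimes> y) = x [^] Suc n \<otimes> y"
  using nat_pow_Suc2[of x n] m_assoc[of x "x [^] n" y] by simp

section \<open>Ordered monomials in the z_i and zs_i, and their leading exponents\<close>

context quantum_relations
begin

text \<open>The second component is the exponent of the leading monomial of the ordered monomial \<open>u\<close>
  in the quantum torus, where the leading term of \<open>z\<^sub>i\<^sup>*\<close> is \<open>z\<^sub>i\<^sup>-\<^sup>1 \<Omega>\<^sub>i\<close>.\<close>

inductive pbw :: "nat \<Rightarrow> 'a \<Rightarrow> lattice \<Rightarrow> bool" where
  top: "pbw N \<one> 0"
| step: "\<lbrakk>i < N; pbw (Suc i) s g\<rbrakk> \<Longrightarrow> pbw i (z i [^] (a::nat) \<otimes> (zs i [^] (b::nat) \<otimes> s))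
    (Poly_Mapping.single (2 * i) (int a - int b) + Poly_Mapping.single (Suc (2 * i)) (int b) + g)"

lemma pbw_closed: "pbw i u g \<Longrightarrow> u \<in> carrier R"
  by (induction rule: pbw.induct) auto

lemma pbw_lookup: "pbw i u g \<Longrightarrow> k < 2 * i \<Longrightarrow> Poly_Mapping.lookup g k = 0"
  by (induction rule: pbw.induct) (auto simp: lookup_add lookup_single when_def)

text \<open>The tail of the monomial has no exponents below 2(i+1), so coordinate 2i+1 gives
  \<open>b\<close>, and then coordinate 2i, which is a - b, gives \<open>a\<close>.\<close>

lemma pbw_unique: "pbw i u g \<Longrightarrow> pbw i u' g \<Longrightarrow> u = u'"
proof (induction arbitrary: u' rule: pbw.induct)
  case top
  from top show ?case
    by (cases rule: pbw.cases) auto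
next
  case (step i s g a b)
  from step.prems show ?case
  proof (cases rule: pbw.cases)
    case top
    then show ?thesis
      using step.hyps by simp
  next
    case (step s' g' a' b')
    note eq = step(2)
    have g: "Poly_Mapping.lookup g k = 0" "Poly_Mapping.lookup g' k = 0" if "k < 2 * Suc i" for k
      using pbw_lookup \<open>pbw (Suc i) s g\<close> step(4) that by blast+
    have "b = b'"
      using arg_cong[OF eq, of "\<lambda>h. Poly_Mapping.lookup h (Suc (2 * i))"] g[of "Suc (2 * i)"]
      by (simp add: lookup_add lookup_single)
    moreover from this have "a = a'"
      using arg_cong[OF eq, of "\<lambda>h. Poly_Mapping.lookup h (2 * i)"] g[of "2 * i"]
      by (simp add: lookup_add lookup_single)
    ultimately show ?thesis
      using eq step(1,4) step.IH by auto
  qed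
qed

definition PB :: "nat \<Rightarrow> 'a set" where
  "PB i = {u. \<exists>g. pbw i u g}"

abbreviation M where "M i \<equiv> lspan (PB i)"

lemma PB_closed: "PB i \<subseteq> carrier R"
  by (auto simp: PB_def pbw_closed)

lemma M_closed: "u \<in> M i \<Longrightarrow> u \<in> carrier R"
  by (rule lspan_closed[OF PB_closed])

lemma block_M:
  assumes "i < N" "t \<in> M (Suc i)"
  shows "z i [^] (a::nat) \<otimes> (zs i [^] (b::nat) \<otimes> t) \<in> M i"
proof -
  let ?y = "z i [^] a \<otimes> zs i [^] b"
  have "?y \<otimes> t \<in> M i"
  proof (rule lspan_mult[OF PB_closed PB_closed _ assms(2)])
    fix s c assume "s \<in> PB (Suc i)"
    then obtain g where g: "pbw (Suc i) s g"
      by (auto simp: PB_def)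
    then have "z i [^] a \<otimes> (zs i [^] b \<otimes> s) \<in> PB i"
      using pbw.step[OF assms(1)] unfolding PB_def by blast
    then have "z i [^] a \<otimes> (zs i [^] b \<otimes> s) \<in> M i"
      by (rule lspan_base[OF PB_closed])
    then show "sc c \<otimes> (?y \<otimes> s) \<in> M i"
      using lspan_scale[OF PB_closed] pbw_closed[OF g] assms(1) by (simp add: m_assoc)
  qed (use assms in simp)
  then show ?thesis
    using M_closed[OF assms(2)] assms(1) by (simp add: m_assoc)
qed

lemma M_blocks:
  assumes "i < N" "y \<in> carrier R"
    and "\<And>a b t. t \<in> M (Suc i) \<Longrightarrow> y \<otimes> (z i [^] (a::nat) \<otimes> (zs i [^] (b::nat) \<otimes> t)) \<in> M i"
    and "u \<in> M i"
  shows "y \<otimes> u \<in> M i"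
proof (rule lspan_mult[OF PB_closed PB_closed assms(2,4)])
  fix s c assume "s \<in> PB i"
  then obtain g where "pbw i s g"
    by (auto simp: PB_def)
  then have "y \<otimes> s \<in> M i"
  proof (cases rule: pbw.cases)
    case top
    then show ?thesis
      using assms(1) by simp
  next
    case (step t g' a b)
    then have "t \<in> M (Suc i)"
      by (intro lspan_base[OF PB_closed]) (auto simp: PB_def)
    then show ?thesis
      using assms(3) step by simp
  qed
  then show "sc c \<otimes> (y \<otimes> s) \<in> M i"
    by (rule lspan_scale[OF PB_closed])
qed

lemma commuting_block:
  assumes i: "i < N" and y: "y \<in> carrier R" and t: "t \<in> M (Suc i)" and yt: "y \<otimes> t \<in> M (Suc i)"
    and c: "qcomm c y (z i)" and d: "qcomm d y (zs i)"
  shows "y \<otimes> (z i [^] (a::nat) \<otimes> (zs i [^] (b::nat) \<otimes> t)) \<in> M i"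
proof -
  let ?w = "z i [^] a \<otimes> zs i [^] b"
  have cl: "?w \<in> carrier R" "t \<in> carrier R"
    using i M_closed[OF t] by simp_all
  have "qcomm (c ^ a * d ^ b) y ?w"
    using i y c d by (intro qcomm_mult_right qcomm_pow_right) auto
  then have "y \<otimes> (?w \<otimes> t) = sc (c ^ a * d ^ b) \<otimes> (?w \<otimes> (y \<otimes> t))"
    using cl y by (simp add: qcomm_def m_assoc flip: m_assoc[of y ?w t])
  then show ?thesis
    using lspan_scale[OF PB_closed block_M[OF i yt, of a b]] i y cl(2) by (simp add: m_assoc)
qed

text \<open>Generators with k > i q-commute with z_i and zs_i and act on the tail. The one real case
  is zs_i against a power of z_i, where each exchange produces a multiple of Om_(i+1), which again
  acts on the tail.\<close>

lemma generators_M: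
  assumes "i \<le> N"
  shows "\<forall>k u. i \<le> k \<longrightarrow> k < N \<longrightarrow> u \<in> M i \<longrightarrow> z k \<otimes> u \<in> M i \<and> zs k \<otimes> u \<in> M i"
  using assms
proof (induction rule: inc_induct)
  case base
  show ?case
    by simp
next
  case (step i)
  have gen: "z k \<otimes> t \<in> M (Suc i)" "zs k \<otimes> t \<in> M (Suc i)" if "Suc i \<le> k" "k < N" "t \<in> M (Suc i)" for k t
    using step.IH that by blast+
  have Om: "Om j \<otimes> t \<in> M (Suc i)" if "Suc i \<le> j" "j \<le> N" "t \<in> M (Suc i)" for j t
    using that(2,1)
  proof (induction rule: inc_induct)
    case base
    then show ?case
      using M_closed[OF that(3)] by (simp add: Om_N lspan.zero)
  next
    case (step j)
    then have "z j \<otimes> (zs j \<otimes> t) \<oplus> Om (Suc j) \<otimes> t \<in> M (Suc i)"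
      using gen that(3) by (intro lspan_add[OF PB_closed]) auto
    then show ?case
      using step M_closed[OF that(3)] by (simp add: Om_step l_distr m_assoc)
  qed
  have i: "i < N" and c: "z i \<in> carrier R" "zs i \<in> carrier R" "Om (Suc i) \<in> carrier R"
    using step by auto
  have zi: "z i \<otimes> u \<in> M i" if "u \<in> M i" for u
  proof (rule M_blocks[OF i c(1) _ that])
    fix a b t assume t: "t \<in> M (Suc i)"
    show "z i \<otimes> (z i [^] (a::nat) \<otimes> (zs i [^] (b::nat) \<otimes> t)) \<in> M i"
      using block_M[OF i t, of "Suc a" b] M_closed[OF t] c by (simp add: nat_pow_Suc_mult del: nat_pow_Suc)
  qed
  have "qcomm (q\<^sup>2) (Om (Suc i)) (z i)"
    using qcomm_sym[OF z_Om_greater[of i "Suc i"]] i q_nonzero by simp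
  moreover have "qcomm (inverse (q\<^sup>2)) (Om (Suc i)) (zs i)"
    using qcomm_sym[OF zs_Om_greater[of i "Suc i"]] i q_nonzero by simp
  ultimately have Om_block: "Om (Suc i) \<otimes> (z i [^] (a::nat) \<otimes> (zs i [^] (b::nat) \<otimes> t)) \<in> M i"
    if "t \<in> M (Suc i)" for a b t
    using commuting_block[OF i c(3) that Om[OF _ _ that]] i by simp
  have zsi_block: "zs i \<otimes> (z i [^] (a::nat) \<otimes> (zs i [^] (b::nat) \<otimes> t)) \<in> M i" if t: "t \<in> M (Suc i)" for a b t
  proof (induction a)
    case 0
    show ?case
      using block_M[OF i t, of 0 "Suc b"] M_closed[OF t] c by (simp add: nat_pow_Suc_mult del: nat_pow_Suc)
  next
    case (Suc a)
    let ?v = "z i [^] a \<otimes> (zs i [^] b \<otimes> t)"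
    have v: "?v \<in> carrier R"
      using c M_closed[OF t] by simp
    \<comment> \<open>The last relation solved for zs_i z_i, which turns q^2 - 1 into 1 -
      q^2.\<close>
    have 1: "zs i \<otimes> (z i \<otimes> ?v) = z i \<otimes> (zs i \<otimes> ?v) \<oplus> sc (1 - q\<^sup>2) \<otimes> (Om (Suc i) \<otimes> ?v)"
    proof -
      have "z i \<otimes> (zs i \<otimes> ?v) = (zs i \<otimes> z i \<oplus> sc (q\<^sup>2 - 1) \<otimes> Om (Suc i)) \<otimes> ?v"
        using c v by (simp flip: z_zs_same[OF i] add: m_assoc)
      also have "\<dots> = zs i \<otimes> (z i \<otimes> ?v) \<oplus> sc (q\<^sup>2 - 1) \<otimes> (Om (Suc i) \<otimes> ?v)"
        using c v by (simp add: l_distr m_assoc)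
      finally have "z i \<otimes> (zs i \<otimes> ?v) \<oplus> sc (1 - q\<^sup>2) \<otimes> (Om (Suc i) \<otimes> ?v) =
          zs i \<otimes> (z i \<otimes> ?v) \<oplus> (sc (q\<^sup>2 - 1) \<oplus> sc (1 - q\<^sup>2)) \<otimes> (Om (Suc i) \<otimes> ?v)"
        using c v by (simp add: l_distr a_assoc)
      then show ?thesis
        using c v by (simp add: sc_zero flip: sc_add)
    qed
    have "zs i \<otimes> (z i \<otimes> ?v) \<in> M i"
      unfolding 1 by (intro lspan_add[OF PB_closed] lspan_scale[OF PB_closed] zi Suc Om_block t)
    then show ?case
      using c M_closed[OF t] by (simp add: nat_pow_Suc_mult del: nat_pow_Suc)
  qed
  have "z k \<otimes> u \<in> M i \<and> zs k \<otimes> u \<in> M i" if k: "i \<le> k" "k < N" and u: "u \<in> M i" for k u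
  proof (cases "k = i")
    case True
    then show ?thesis
      using zi[OF u] M_blocks[OF i c(2) zsi_block u] by simp
  next
    case False
    then have ik: "i < k"
      using k by simp
    have zz: "qcomm q (z k) (z i)"
      using qcomm_sym[OF z_z[OF ik k(2)]] i k q_nonzero by simp
    have ss: "qcomm (inverse q) (zs k) (zs i)"
      using qcomm_sym[OF zs_zs[OF ik k(2)]] i k q_nonzero by simp
    have zs: "qcomm (inverse q) (z k) (zs i)" and sz: "qcomm q (zs k) (z i)"
      using z_zs[of k i] zs_z[of k i] ik k by simp_all
    have "z k \<otimes> u \<in> M i"
      by (rule M_blocks[OF i _ commuting_block[OF i _ _ gen(1) zz zs] u]) (use ik k in auto)
    moreover have "zs k \<otimes> u \<in> M i"
      by (rule M_blocks[OF i _ commuting_block[OF i _ _ gen(2) sz ss] u]) (use ik k in auto)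
    ultimately show ?thesis
      by simp
  qed
  then show ?case
    by blast
qed

lemma one_M: "\<one> \<in> M 0"
proof -
  have "\<exists>g. pbw i \<one> g" if "i \<le> N" for i
    using that
  proof (induction rule: inc_induct)
    case base
    show ?case
      using pbw.top by blast
  next
    case (step i)
    then obtain g where "pbw (Suc i) \<one> g"
      by blast
    from pbw.step[OF _ this, of 0 0] show ?case
      using step by auto
  qed
  then show ?thesis
    by (intro lspan_base[OF PB_closed]) (auto simp: PB_def)
qed

end

section \<open>The algebra \<open>F\<^sub>q(N)\<close> is a domain\<close>

text \<open>x^(m-1) times the inverse of x^m inverts x on either side. This applies to z_i and Om_j,
  whose m-th powers are central.\<close>

lemma (in ring) Units_of_pow:
  assumes x: "x \<in> carrier R" and m: "0 < (m::nat)" and u: "x [^] m \<in> Units R"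
  shows "x \<in> Units R"
proof -
  let ?u = "x [^] m" and ?y = "x [^] (m - 1)"
  have cl: "?y \<in> carrier R" "inv ?u \<in> carrier R"
    using x u by auto
  have yx: "?y \<otimes> x = ?u" "x \<otimes> ?y = ?u"
    using m nat_pow_Suc[of x "m - 1"] nat_pow_Suc2[OF x, of "m - 1"] by simp_all
  let ?l = "inv ?u \<otimes> ?y" and ?r = "?y \<otimes> inv ?u"
  have r: "x \<otimes> ?r = \<one>"
    using x cl u yx(2) by (simp flip: m_assoc)
  have l: "?l \<otimes> x = \<one>"
    using x cl u yx(1) by (simp add: m_assoc)
  have "?l = ?l \<otimes> (x \<otimes> ?r)"
    using r cl x by simp
  also have "\<dots> = (?l \<otimes> x) \<otimes> ?r"
    using cl x by (simp only: m_assoc m_closed)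
  also have "\<dots> = ?r"
    using l cl x by simp
  finally have "?r \<otimes> x = \<one>"
    using l by simp
  then show ?thesis
    using r x cl by (auto simp: Units_def)
qed

definition F_relations :: "complex \<Rightarrow> nat \<Rightarrow> F_gen free_poly set" where
  "F_relations q N = qrel_poly q ` F_common_rels N \<union>
      {var (Z i) * var (Zs i) - var (Zs i) * var (Z i)
         - scalar (q\<^sup>2 - 1) * (\<Sum>k\<in>{i<..<N}. var (Z k) * var (Zs k)) | i. i < N}"

lemma F_algebra_presented: "F_algebra q N = presented_algebra (set (F_gens N)) (F_relations q N)"
  by (simp add: F_algebra_def F_relations_def)

lemma F_gens_iff [simp]: "Z i \<in> set (F_gens N) \<longleftrightarrow> i < N" "Zs i \<in> set (F_gens N) \<longleftrightarrow> i < N"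
  by (auto simp: F_gens_def)

lemma F_gens_cases:
  assumes "x \<in> set (F_gens N)"
  obtains k where "k < N" "x = Z k \<or> x = Zs k"
  using assms by (auto simp: F_gens_def)

definition om_poly :: "nat \<Rightarrow> nat \<Rightarrow> F_gen free_poly" where
  "om_poly N j = (\<Sum>k\<in>{j..<N}. var (Z k) * var (Zs k))"

lemma om_poly_N: "om_poly N N = 0"
  by (simp add: om_poly_def)

lemma om_poly_step: "j < N \<Longrightarrow> om_poly N j = var (Z j) * var (Zs j) + om_poly N (Suc j)"
  by (simp add: om_poly_def sum.atLeast_Suc_lessThan)

lemma om_poly_closed [simp]: "j \<le> N \<Longrightarrow> om_poly N j \<in> carrier (free_algebra (set (F_gens N)))"
  by (induction rule: inc_induct) (simp_all add: om_poly_N om_poly_step)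

lemma F_relations_cases:
  assumes "p \<in> F_relations q N"
  obtains x y h where "(x, y, h) \<in> F_common_rels N" "p = var x * var y - scalar (q powi h) * var y * var x"
  | i where "i < N" "p = var (Z i) * var (Zs i) - var (Zs i) * var (Z i) - scalar (q\<^sup>2 - 1) * om_poly N (Suc i)"
  using assms unfolding F_relations_def om_poly_def by (force simp: atLeastSucLessThan_greaterThanLessThan)

lemma F_common_rels_gens:
  "(x, y, h) \<in> F_common_rels N \<Longrightarrow> x \<in> set (F_gens N) \<and> y \<in> set (F_gens N)"
  by (auto simp: F_common_rels_def)

lemma presentation_F: "presentation (set (F_gens N)) (F_relations q N)"
proof
  show "F_relations q N \<subseteq> carrier (free_algebra (set (F_gens N)))"
  proof
    fix p assume "p \<in> F_relations q N"
    then show "p \<in> carrier (free_algebra (set (F_gens N)))"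
      by (cases rule: F_relations_cases) (use F_common_rels_gens in \<open>auto intro!: free_algebra_closed\<close>)
  qed
qed

section \<open>F_q(N) at a root of unity: its action and its leading exponents\<close>

locale F_at_root_of_unity =
  fixes q :: complex and N m :: nat
  assumes N_pos: "0 < N" and m_odd: "odd m" and qm: "q ^ m = 1"
    and primitive: "0 < k \<Longrightarrow> k < m \<Longrightarrow> q ^ k \<noteq> 1"
begin

lemma q_neq_0: "q \<noteq> 0"
  using qm m_odd by (cases m) auto

sublocale linear_action "F_act q N"
  by (rule linear_action_F)

sublocale F: presentation "set (F_gens N)" "F_relations q N"
  by (rule presentation_F)

text \<open>The summands act as Om_k - Om_(k+1), so the sum telescopes and ends at Om_N = 0.\<close>

lemma act_om_poly: "j \<le> N \<Longrightarrow> act (om_poly N j) v = om_act q N j v"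
proof (induction rule: inc_induct)
  case base
  show ?case
    by (simp add: om_poly_N act_zero om_act_N[OF q_neq_0] scl_def fun_eq_iff)
next
  case (step j)
  then show ?case
    using Z_Zs_act[OF q_neq_0, of N j v]
    by (simp add: om_poly_step act_add act_mult act_var fun_eq_iff dif_def)
qed

sublocale F: presentation_action "set (F_gens N)" "F_relations q N" "F_act q N"
proof
  fix p v assume "p \<in> F_relations q N"
  then show "act p v = (\<lambda>g. 0)"
  proof (cases rule: F_relations_cases)
    case (1 x y h)
    have "F_act q N x (F_act q N y v) = scl (q powi h) (F_act q N y (F_act q N x v))"
      using 1(1) unfolding F_common_rels_def
      by (auto simp: power_int_minus z_z_act[OF q_neq_0] simp del: F_act.simps
          intro: Z_Zs_act_diff[OF q_neq_0] Zs_Zs_act[OF q_neq_0]) (simp add: z_z_act[OF q_neq_0])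
    then show ?thesis
      by (simp add: 1(2) act_diff act_mult act_var act_scalar mult.assoc scl_def del: F_act.simps)
  next
    case (2 i)
    then show ?thesis
      unfolding 2(2) using Z_Zs_act[OF q_neq_0, of N i v] Zs_Z_act[OF q_neq_0, of N i v]
      by (simp add: act_diff act_mult act_var act_scalar act_om_poly dif_def scl_def fun_eq_iff
          left_diff_distrib del: F_act.simps)
  qed
qed

abbreviation "FF \<equiv> presented_algebra (set (F_gens N)) (F_relations q N)"
abbreviation "zF i \<equiv> F.cls (var (Z i))"
abbreviation "zsF i \<equiv> F.cls (var (Zs i))"
abbreviation "OmF j \<equiv> F.cls (om_poly N j)"

lemma qcomm_gens:
  assumes "(x, y, h) \<in> F_common_rels N"
  shows "F.PA.qcomm (q powi h) (F.cls (var x)) (F.cls (var y))"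
proof -
  have xy: "x \<in> set (F_gens N)" "y \<in> set (F_gens N)"
    using F_common_rels_gens[OF assms] by auto
  have "qrel_poly q (x, y, h) \<in> F_relations q N"
    using assms unfolding F_relations_def by blast
  then have "F.cls (var x * var y) = F.cls (scalar (q powi h) * (var y * var x))"
    using xy by (intro F.cls_eqI) (auto simp: mult.assoc intro!: free_algebra_closed)
  then show ?thesis
    using xy by (simp add: F.PA.qcomm_def F.csc_def F.cls_mult)
qed

sublocale F: quantum_relations FF F.csc zF zsF OmF q N
proof
  show "q \<noteq> 0"
    by (rule q_neq_0)
  show "zF i \<in> carrier FF" "zsF i \<in> carrier FF" if "i < N" for i
    using that by (auto intro: F.cls_closed)
  show "F.PA.qcomm (inverse q) (zF i) (zF j)" if "i < j" "j < N" for i j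
    using qcomm_gens[of "Z i" "Z j" "-1"] that by (simp add: F_common_rels_def power_int_minus)
  show "F.PA.qcomm q (zsF i) (zsF j)" if "i < j" "j < N" for i j
    using qcomm_gens[of "Zs i" "Zs j" 1] that by (simp add: F_common_rels_def)
  show "F.PA.qcomm (inverse q) (zF i) (zsF j)" if "i \<noteq> j" "i < N" "j < N" for i j
    using qcomm_gens[of "Z i" "Zs j" "-1"] that by (simp add: F_common_rels_def power_int_minus)
  show "OmF N = \<zero>\<^bsub>FF\<^esub>"
    by (simp add: om_poly_N F.cls_zero)
  show "OmF i = zF i \<otimes>\<^bsub>FF\<^esub> zsF i \<oplus>\<^bsub>FF\<^esub> OmF (Suc i)" if "i < N" for i
    using that by (simp add: om_poly_step F.cls_add F.cls_mult)
  show "zF i \<otimes>\<^bsub>FF\<^esub> zsF i = zsF i \<otimes>\<^bsub>FF\<^esub> zF i \<oplus>\<^bsub>FF\<^esub> F.csc (q\<^sup>2 - 1) \<otimes>\<^bsub>FF\<^esub> OmF (Suc i)" if "i < N" for i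
  proof -
    have "var (Z i) * var (Zs i) - (var (Zs i) * var (Z i) + scalar (q\<^sup>2 - 1) * om_poly N (Suc i)) \<in> F_relations q N"
      using that unfolding F_relations_def om_poly_def atLeastSucLessThan_greaterThanLessThan diff_diff_eq by blast
    then have "F.cls (var (Z i) * var (Zs i)) = F.cls (var (Zs i) * var (Z i) + scalar (q\<^sup>2 - 1) * om_poly N (Suc i))"
      using that by (intro F.cls_eqI) auto
    then show ?thesis
      using that by (simp add: F.cls_add F.cls_mult F.csc_def)
  qed
qed

lemma carrier_M: "u \<in> carrier FF \<Longrightarrow> u \<in> F.M 0"
proof (induction rule: F.PA_induct)
  case (scalar c)
  have "F.csc c \<otimes>\<^bsub>FF\<^esub> \<one>\<^bsub>FF\<^esub> \<in> F.M 0"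
    by (rule F.PA.lspan_scale[OF F.PB_closed F.one_M])
  then show ?case
    by simp
next
  case (var x u)
  then obtain k where "k < N" "x = Z k \<or> x = Zs k"
    using F_gens_cases by metis
  then show ?case
    using F.generators_M[of 0] var(3) by auto
next
  case (add u v)
  then show ?case
    using F.PA.lspan_add[OF F.PB_closed] by simp
qed

lemma qact_gen: "x \<in> set (F_gens N) \<Longrightarrow> F.qact (F.cls (var x)) v = F_act q N x v"
  by (simp add: F.qact_cls act_var)

lemma om_act_degree: "j < N \<Longrightarrow> has_degree_shift (om_act q N j) (eps_Om j)"
  by (rule has_degree_shift_translation[where c = "\<lambda>g. q powi (2 * zsum j g)"])
    (use q_neq_0 in \<open>auto simp: om_act_def\<close>)

lemma z_degree: "i < N \<Longrightarrow> has_degree_shift (F.qact (zF i)) (eps_z i)"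
  by (rule has_degree_shift_translation[where c = "\<lambda>g. q powi (zsum i g)"])
    (use q_neq_0 in \<open>auto simp: qact_gen z_act_def\<close>)

text \<open>Om_i dominates Om_(i+1), which for i = N - 1 is 0, so z_i^-1 Om_i is the leading term in
  either case.\<close>

lemma zs_degree:
  assumes i: "i < N"
  shows "has_degree_shift (F.qact (zsF i)) (- eps_z i + eps_Om i)"
proof -
  have zinv: "has_degree_shift (zinv_act q i) (- eps_z i)"
    by (rule has_degree_shift_translation[where c = "\<lambda>g. q powi (- zsum i g)"])
      (use q_neq_0 in \<open>auto simp: zinv_act_def\<close>)
  have "has_degree_shift (\<lambda>v. dif (om_act q N i v) (om_act q N (Suc i) v)) (eps_Om i)"
  proof (cases "Suc i < N")
    case True
    have "has_degree_shift (\<lambda>v g. om_act q N i v g + (- 1) * om_act q N (Suc i) v g) (eps_Om i)"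
      by (rule has_degree_shift_add_less[OF om_act_degree[OF i] has_degree_shift_scale[OF _ om_act_degree[OF True]]])
        (simp_all add: eps_Om_less)
    moreover have "(\<lambda>v. dif (om_act q N i v) (om_act q N (Suc i) v)) =
        (\<lambda>v g. om_act q N i v g + (- 1) * om_act q N (Suc i) v g)"
      by (simp add: fun_eq_iff dif_def)
    ultimately show ?thesis
      by simp
  next
    case False
    then have "(\<lambda>v. dif (om_act q N i v) (om_act q N (Suc i) v)) = om_act q N i"
      by (simp add: fun_eq_iff dif_def om_act_def)
    then show ?thesis
      using om_act_degree[OF i] by simp
  qed
  from has_degree_shift_comp[OF zinv this] show ?thesis
    using i by (simp add: qact_gen has_degree_shift_def)
qed

lemma pow_degree:
  assumes u: "u \<in> carrier FF" and d: "has_degree_shift (F.qact u) d"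
  shows "has_degree_shift (F.qact (u [^]\<^bsub>FF\<^esub> (n::nat))) (\<Sum>k<n. d)"
proof (induction n)
  case 0
  show ?case
    using has_degree_shift_id F.qact_simps(4)[OF u u] by (simp add: has_degree_shift_def)
next
  case (Suc n)
  have "has_degree_shift (\<lambda>v. F.qact (u [^]\<^bsub>FF\<^esub> n) (F.qact u v)) ((\<Sum>k<n. d) + d)"
    by (rule has_degree_shift_comp[OF Suc d])
  then show ?case
    using F.qact_simps(1)[of "u [^]\<^bsub>FF\<^esub> n" u] u by (simp del: sum_constant)
qed

lemma sum_single_const: "(\<Sum>l<n. Poly_Mapping.single k c) = (Poly_Mapping.single k (int n * c) :: lattice)"
  by (induction n) (simp_all add: distrib_right add.commute del: sum_constant flip: single_add)

lemma pbw_degree: "F.pbw i u g \<Longrightarrow> has_degree_shift (F.qact u) g"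
proof (induction rule: F.pbw.induct)
  case top
  show ?case
    using has_degree_shift_id F.qact_simps(4)[of "\<one>\<^bsub>FF\<^esub>" "\<one>\<^bsub>FF\<^esub>"] by (simp add: has_degree_shift_def)
next
  case (step i s g a b)
  let ?z = "zF i [^]\<^bsub>FF\<^esub> a" and ?s = "zsF i [^]\<^bsub>FF\<^esub> b"
  have cl: "zF i \<in> carrier FF" "zsF i \<in> carrier FF" "s \<in> carrier FF"
    using step F.pbw_closed by auto
  have deg: "has_degree_shift (\<lambda>v. F.qact ?z (F.qact ?s (F.qact s v)))
      ((\<Sum>k<a. eps_z i) + ((\<Sum>k<b. - eps_z i + eps_Om i) + g))"
    by (intro has_degree_shift_comp pow_degree z_degree zs_degree cl step)
  have eq: "(\<Sum>k<a. eps_z i) + ((\<Sum>k<b. - eps_z i + eps_Om i) + g) =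
      Poly_Mapping.single (2 * i) (int a - int b) + Poly_Mapping.single (Suc (2 * i)) (int b) + g"
  proof -
    have 1: "(\<Sum>k<b. - eps_z i + eps_Om i) = - (\<Sum>k<b. eps_z i) + (\<Sum>k<b. eps_Om i)"
      by (simp add: sum_subtractf del: sum_constant)
    have 2: "(\<Sum>k<n. eps_z i) = Poly_Mapping.single (2 * i) (int n)"
      "(\<Sum>k<n. eps_Om i) = Poly_Mapping.single (Suc (2 * i)) (int n)" for n
      by (simp_all only: eps_z_def eps_Om_def sum_single_const mult_1_right)
    have 3: "Poly_Mapping.single (2 * i) (int a - int b) =
        Poly_Mapping.single (2 * i) (int a) - (Poly_Mapping.single (2 * i) (int b) :: lattice)"
      by (simp flip: single_diff)
    show ?thesis
      unfolding 1 2 3 by simp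
  qed
  have "(\<lambda>v. F.qact ?z (F.qact ?s (F.qact s v))) = F.qact (?z \<otimes>\<^bsub>FF\<^esub> (?s \<otimes>\<^bsub>FF\<^esub> s))"
    using cl by (simp add: F.qact_simps(1) fun_eq_iff)
  with deg show ?case
    by (simp only: eq)
qed

text \<open>Distinct ordered monomials have distinct exponents, so the greatest one in a linear
  combination cannot cancel. The induction also records that the degree belongs to a monomial of
  \<open>W\<close>, which makes it differ from the exponent of the monomial added next.\<close>

lemma zero_or_degree:
  assumes "u \<in> carrier FF"
  shows "u = \<zero>\<^bsub>FF\<^esub> \<or> (\<exists>d. has_degree_shift (F.qact u) d)"
proof -
  obtain W c where W: "finite W" "W \<subseteq> F.PB 0" "u = (\<Oplus>\<^bsub>FF\<^esub>b\<in>W. F.csc (c b) \<otimes>\<^bsub>FF\<^esub> b)"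
    using F.PA.lspan_expansion[OF F.PB_closed carrier_M[OF assms]] by blast
  let ?u = "\<lambda>W. (\<Oplus>\<^bsub>FF\<^esub>b\<in>W. F.csc (c b) \<otimes>\<^bsub>FF\<^esub> b)"
  have "?u W = \<zero>\<^bsub>FF\<^esub> \<or> (\<exists>b\<in>W. \<exists>g. F.pbw 0 b g \<and> has_degree_shift (F.qact (?u W)) g)"
    using W(1,2)
  proof (induction W rule: finite_induct)
    case (insert b W)
    obtain g where g: "F.pbw 0 b g"
      using insert.prems by (auto simp: F.PB_def)
    have Wc: "W \<subseteq> carrier FF" "b \<in> carrier FF"
      using insert.prems F.PB_closed by auto
    have cl: "?u W \<in> carrier FF"
      by (rule F.PA.finsum_closed) (use Wc in auto)
    have ins: "?u (insert b W) = F.csc (c b) \<otimes>\<^bsub>FF\<^esub> b \<oplus>\<^bsub>FF\<^esub> ?u W"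
      by (rule F.PA.finsum_insert) (use insert.hyps Wc in auto)
    have qact: "F.qact (?u (insert b W)) = (\<lambda>v g. c b * F.qact b v g + F.qact (?u W) v g)"
      unfolding ins using Wc cl F.qact_simps[of "F.csc (c b)" b] F.qact_simps(2)[of "F.csc (c b) \<otimes>\<^bsub>FF\<^esub> b" "?u W"]
      by (simp add: fun_eq_iff)
    have IH: "?u W = \<zero>\<^bsub>FF\<^esub> \<or> (\<exists>b\<in>W. \<exists>g. F.pbw 0 b g \<and> has_degree_shift (F.qact (?u W)) g)"
      using insert by blast
    show ?case
    proof (cases "c b = 0")
      case True
      then have "?u (insert b W) = ?u W"
        unfolding ins using cl Wc by (simp add: F.PA.sc_zero)
      then show ?thesis
        using IH by auto
    next
      case cb: False
      then have deg_b: "has_degree_shift (\<lambda>v h. c b * F.qact b v h) g"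
        by (intro has_degree_shift_scale pbw_degree[OF g])
      show ?thesis
        using IH
      proof
        assume "?u W = \<zero>\<^bsub>FF\<^esub>"
        then have "F.qact (?u (insert b W)) = (\<lambda>v h. c b * F.qact b v h)"
          using qact F.qact_simps(5)[of b b] Wc by (simp add: fun_eq_iff)
        then show ?thesis
          using deg_b g by auto
      next
        assume "\<exists>b\<in>W. \<exists>g. F.pbw 0 b g \<and> has_degree_shift (F.qact (?u W)) g"
        then obtain b' g' where b': "b' \<in> W" "F.pbw 0 b' g'" "has_degree_shift (F.qact (?u W)) g'"
          by blast
        have "g \<noteq> g'"
          using F.pbw_unique[OF g] b' insert.hyps by auto
        then have "has_degree_shift (F.qact (?u (insert b W))) (max g g')"
          unfolding qact by (intro has_degree_shift_add deg_b b')
        then show ?thesis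
          using g b' by (auto simp: max_def split: if_splits)
      qed
    qed
  qed simp
  then show ?thesis
    using W(3) by blast
qed

lemma degree_nonzero: "has_degree_shift (F.qact u) d \<Longrightarrow> u \<noteq> \<zero>\<^bsub>FF\<^esub>"
  using has_degree_shift_nonzero F.qact_simps(5)[of "\<zero>\<^bsub>FF\<^esub>" "\<zero>\<^bsub>FF\<^esub>"] by force

text \<open>Degrees add under multiplication, so a product of nonzero elements has a degree and is
  nonzero.\<close>

sublocale F: central_localization FF
proof
  show "\<one>\<^bsub>FF\<^esub> \<noteq> \<zero>\<^bsub>FF\<^esub>"
    by (rule degree_nonzero[OF pbw_degree[OF F.pbw.top]])
  fix a b assume ab: "a \<in> carrier FF" "b \<in> carrier FF" "a \<otimes>\<^bsub>FF\<^esub> b = \<zero>\<^bsub>FF\<^esub>" "a \<noteq> \<zero>\<^bsub>FF\<^esub>"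
  show "b = \<zero>\<^bsub>FF\<^esub>"
  proof (rule ccontr)
    assume "b \<noteq> \<zero>\<^bsub>FF\<^esub>"
    then obtain d e where "has_degree_shift (F.qact a) d" "has_degree_shift (F.qact b) e"
      using zero_or_degree ab by metis
    then have "has_degree_shift (\<lambda>v. F.qact a (F.qact b v)) (d + e)"
      by (rule has_degree_shift_comp)
    then have "has_degree_shift (F.qact (a \<otimes>\<^bsub>FF\<^esub> b)) (d + e)"
      using F.qact_simps(1)[OF ab(1,2)] by (simp add: has_degree_shift_def)
    then show False
      using degree_nonzero ab(3) by blast
  qed
qed

lemma z_nonzero: "i < N \<Longrightarrow> zF i \<noteq> \<zero>\<^bsub>FF\<^esub>"
  using degree_nonzero z_degree by blast

lemma Om_nonzero: "j < N \<Longrightarrow> OmF j \<noteq> \<zero>\<^bsub>FF\<^esub>"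
proof -
  assume j: "j < N"
  then have "F.qact (OmF j) = om_act q N j"
    by (simp add: fun_eq_iff F.qact_cls act_om_poly)
  then show ?thesis
    using degree_nonzero om_act_degree[OF j] by metis
qed

lemma pow_nonzero: "u \<in> carrier FF \<Longrightarrow> u \<noteq> \<zero>\<^bsub>FF\<^esub> \<Longrightarrow> u [^]\<^bsub>FF\<^esub> (n::nat) \<noteq> \<zero>\<^bsub>FF\<^esub>"
proof (induction n)
  case 0
  then show ?case
    using F.nontrivial by simp
next
  case (Suc n)
  then show ?case
    using F.domain[of "u [^]\<^bsub>FF\<^esub> n" u] by auto
qed

section \<open>Passing from the algebra to its rings of fractions\<close>

lemma commute_generated:
  assumes D: "ring D" and hom: "\<phi> \<in> Ring.ring_hom FF D" and x: "x \<in> carrier D"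
    and sc: "\<And>c. x \<otimes>\<^bsub>D\<^esub> \<phi> (F.csc c) = \<phi> (F.csc c) \<otimes>\<^bsub>D\<^esub> x"
    and z: "\<And>i. i < N \<Longrightarrow> x \<otimes>\<^bsub>D\<^esub> \<phi> (zF i) = \<phi> (zF i) \<otimes>\<^bsub>D\<^esub> x"
    and zs: "\<And>i. i < N \<Longrightarrow> x \<otimes>\<^bsub>D\<^esub> \<phi> (zsF i) = \<phi> (zsF i) \<otimes>\<^bsub>D\<^esub> x"
    and u: "u \<in> carrier FF"
  shows "x \<otimes>\<^bsub>D\<^esub> \<phi> u = \<phi> u \<otimes>\<^bsub>D\<^esub> x"
proof -
  interpret D: ring D
    by (rule D)
  from u show ?thesis
  proof (induction rule: F.PA_induct)
    case (scalar c)
    show ?case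
      by (rule sc)
  next
    case (var g u)
    obtain k where "k < N" "g = Z k \<or> g = Zs k"
      using F_gens_cases[OF var(1)] .
    then have g: "F.cls (var g) \<in> carrier FF" and xg: "x \<otimes>\<^bsub>D\<^esub> \<phi> (F.cls (var g)) = \<phi> (F.cls (var g)) \<otimes>\<^bsub>D\<^esub> x"
      using z zs by (auto intro: F.cls_closed)
    note cl = ring_hom_closed[OF hom g] ring_hom_closed[OF hom var(2)]
    have "x \<otimes>\<^bsub>D\<^esub> (\<phi> (F.cls (var g)) \<otimes>\<^bsub>D\<^esub> \<phi> u) = \<phi> (F.cls (var g)) \<otimes>\<^bsub>D\<^esub> (x \<otimes>\<^bsub>D\<^esub> \<phi> u)"
      using cl x by (simp add: xg flip: D.m_assoc)
    then show ?case
      using cl x by (simp add: ring_hom_mult[OF hom g var(2)] var(3) D.m_assoc)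
  next
    case (add u v)
    then show ?case
      using x ring_hom_closed[OF hom add(1)] ring_hom_closed[OF hom add(2)] add
      by (simp add: ring_hom_add[OF hom] D.l_distr D.r_distr)
  qed
qed

sublocale F: generated_quantum_relations FF F.csc zF zsF OmF q N m
proof
  fix x assume x: "x \<in> carrier FF" and z: "\<And>i. i < N \<Longrightarrow> F.PA.qcomm 1 (zF i) x"
    and zs: "\<And>i. i < N \<Longrightarrow> F.PA.qcomm 1 (zsF i) x"
  have "x \<otimes>\<^bsub>FF\<^esub> id u = id u \<otimes>\<^bsub>FF\<^esub> x" if "u \<in> carrier FF" for u
    using commute_generated[of FF id x u] F.PA.ring_axioms that x z zs F.PA.sc_central[OF x]
    by (simp add: F.PA.qcomm_1_iff ring_hom_def)
  then show "x \<in> ring_center FF"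
    using x by (simp add: ring_center_iff)
next
  fix i x assume "i < N" "x \<in> carrier FF" "zF i \<otimes>\<^bsub>FF\<^esub> x = \<zero>\<^bsub>FF\<^esub>"
  then show "x = \<zero>\<^bsub>FF\<^esub>"
    using F.domain[of "zF i" x] z_nonzero by simp
qed (use m_odd qm primitive in auto)

text \<open>Covers both the central localization and an arbitrary division ring of fractions: each
  element is asked to have one expression as a fraction whose denominator has an invertible
  image.\<close>

lemma quantum_field_of_fractions:
  assumes D: "ring D" "\<one>\<^bsub>D\<^esub> \<noteq> \<zero>\<^bsub>D\<^esub>" and hom: "\<phi> \<in> Ring.ring_hom FF D"
    and frac: "\<And>d. d \<in> carrier D \<Longrightarrow> \<exists>a\<in>carrier FF. \<exists>s\<in>carrier FF. \<phi> s \<in> Units D \<and> d = \<phi> a \<otimes>\<^bsub>D\<^esub> inv\<^bsub>D\<^esub> (\<phi> s)"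
    and z_unit: "\<And>i. i < N \<Longrightarrow> \<phi> (zF i) \<in> Units D" and Om_unit: "\<And>j. j < N \<Longrightarrow> \<phi> (OmF j) \<in> Units D"
    and center_unit: "\<And>k. k \<in> ring_center D \<Longrightarrow> k \<noteq> \<zero>\<^bsub>D\<^esub> \<Longrightarrow> k \<in> Units D"
  shows "quantum_field D (\<lambda>c. \<phi> (F.csc c)) (\<lambda>i. \<phi> (zF i)) (\<lambda>i. \<phi> (zsF i)) (\<lambda>j. \<phi> (OmF j)) q N m"
proof -
  interpret D: ring D
    by (rule D)
  note cl = ring_hom_closed[OF hom] and hm = ring_hom_mult[OF hom] and ha = ring_hom_add[OF hom]
  \<comment> \<open>What commutes with the image of the algebra commutes with the inverses of
    denominators, hence with every fraction.\<close>
  have commute_all: "x \<otimes>\<^bsub>D\<^esub> d = d \<otimes>\<^bsub>D\<^esub> x"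
    if x: "x \<in> carrier D" and xu: "\<And>u. u \<in> carrier FF \<Longrightarrow> x \<otimes>\<^bsub>D\<^esub> \<phi> u = \<phi> u \<otimes>\<^bsub>D\<^esub> x" and d: "d \<in> carrier D" for x d
  proof -
    obtain a s where as: "a \<in> carrier FF" "s \<in> carrier FF" "\<phi> s \<in> Units D" "d = \<phi> a \<otimes>\<^bsub>D\<^esub> inv\<^bsub>D\<^esub> (\<phi> s)"
      using frac[OF d] by blast
    have "\<phi> a \<in> D.centralizer {x}" "\<phi> s \<in> D.centralizer {x}"
      using xu as cl by (simp_all add: D.centralizer_def)
    then have "d \<in> D.centralizer {x}"
      unfolding as(4) using x as(3) by (intro D.centralizer_mult D.centralizer_inv) auto
    then show ?thesis
      by (simp add: D.centralizer_def)
  qed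
  interpret D: central_scalars D "\<lambda>c. \<phi> (F.csc c)"
  proof
    show "\<phi> (F.csc c) \<in> carrier D" for c
      by (simp add: cl)
    show "\<phi> (F.csc (c + d)) = \<phi> (F.csc c) \<oplus>\<^bsub>D\<^esub> \<phi> (F.csc d)" "\<phi> (F.csc (c * d)) = \<phi> (F.csc c) \<otimes>\<^bsub>D\<^esub> \<phi> (F.csc d)" for c d
      by (simp_all add: F.PA.sc_add F.PA.sc_mult ha hm)
    show "\<phi> (F.csc 1) = \<one>\<^bsub>D\<^esub>"
      by (simp add: F.PA.sc_one ring_hom_one[OF hom])
    fix x c assume "x \<in> carrier D"
    moreover have "\<phi> (F.csc c) \<otimes>\<^bsub>D\<^esub> \<phi> u = \<phi> u \<otimes>\<^bsub>D\<^esub> \<phi> (F.csc c)" if "u \<in> carrier FF" for u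
      using F.PA.sc_central[OF that, of c] that by (simp flip: hm)
    ultimately show "x \<otimes>\<^bsub>D\<^esub> \<phi> (F.csc c) = \<phi> (F.csc c) \<otimes>\<^bsub>D\<^esub> x"
      using commute_all[of "\<phi> (F.csc c)" x] cl by simp
  qed
  have qcomm: "D.qcomm c (\<phi> u) (\<phi> v)" if "F.PA.qcomm c u v" "u \<in> carrier FF" "v \<in> carrier FF" for c u v
    using that by (simp add: D.qcomm_def F.PA.qcomm_def flip: hm)
  interpret D: quantum_relations D "\<lambda>c. \<phi> (F.csc c)" "\<lambda>i. \<phi> (zF i)" "\<lambda>i. \<phi> (zsF i)" "\<lambda>j. \<phi> (OmF j)" q N
  proof
    show "\<phi> (OmF N) = \<zero>\<^bsub>D\<^esub>"
      using ring_hom_zero[OF hom F.PA.ring_axioms D(1)] by (simp add: F.Om_N)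
    show "\<phi> (OmF i) = \<phi> (zF i) \<otimes>\<^bsub>D\<^esub> \<phi> (zsF i) \<oplus>\<^bsub>D\<^esub> \<phi> (OmF (Suc i))" if "i < N" for i
      using that by (simp add: F.Om_step ha hm)
    show "\<phi> (zF i) \<otimes>\<^bsub>D\<^esub> \<phi> (zsF i) = \<phi> (zsF i) \<otimes>\<^bsub>D\<^esub> \<phi> (zF i) \<oplus>\<^bsub>D\<^esub> \<phi> (F.csc (q\<^sup>2 - 1)) \<otimes>\<^bsub>D\<^esub> \<phi> (OmF (Suc i))"
      if "i < N" for i
      using that F.z_zs_same[OF that] by (simp flip: ha hm)
  qed (use q_neq_0 cl qcomm F.z_z F.zs_zs F.z_zs in auto)
  show ?thesis
  proof (intro quantum_field.intro quantum_field_axioms.intro generated_quantum_relations.intro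
      generated_quantum_relations_axioms.intro D.quantum_relations_axioms)
    show "x \<in> ring_center D" if x: "x \<in> carrier D" and z: "\<And>i. i < N \<Longrightarrow> D.qcomm 1 (\<phi> (zF i)) x"
      and zs: "\<And>i. i < N \<Longrightarrow> D.qcomm 1 (\<phi> (zsF i)) x" for x
    proof -
      have "x \<otimes>\<^bsub>D\<^esub> \<phi> u = \<phi> u \<otimes>\<^bsub>D\<^esub> x" if "u \<in> carrier FF" for u
        by (rule commute_generated[OF D(1) hom x _ _ _ that])
          (use z zs x cl D.sc_central in \<open>auto simp: D.qcomm_1_iff\<close>)
      then show ?thesis
        using commute_all x by (simp add: ring_center_iff)
    qed
    show "x = \<zero>\<^bsub>D\<^esub>" if "i < N" "x \<in> carrier D" "\<phi> (zF i) \<otimes>\<^bsub>D\<^esub> x = \<zero>\<^bsub>D\<^esub>" for i x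
    proof -
      have "x = inv\<^bsub>D\<^esub> (\<phi> (zF i)) \<otimes>\<^bsub>D\<^esub> (\<phi> (zF i) \<otimes>\<^bsub>D\<^esub> x)"
        using that z_unit[OF that(1)] D.m_assoc[of "inv\<^bsub>D\<^esub> (\<phi> (zF i))" "\<phi> (zF i)" x] cl by simp
      then show ?thesis
        using that z_unit[OF that(1)] by simp
    qed
    show "subfield (ring_center D) D"
      using D.center_is_subfield D(2) center_unit by blast
  qed (use m_odd qm primitive N_pos z_unit Om_unit in auto)
qed

lemma fractions_quantum_field:
  "quantum_field F.fractions (\<lambda>c. F.embed (F.csc c)) (\<lambda>i. F.embed (zF i)) (\<lambda>i. F.embed (zsF i))
    (\<lambda>j. F.embed (OmF j)) q N m"
proof (rule quantum_field_of_fractions[OF F.ring_fractions F.fractions_nontrivial F.embed_hom])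
  interpret D: ring F.fractions
    by (rule F.ring_fractions)
  have m: "0 < m"
    using m_odd by (cases m) auto
  \<comment> \<open>As u^m is central and nonzero it is a denominator and becomes invertible; then
    so does u.\<close>
  have unit: "F.embed u \<in> Units F.fractions"
    if u: "u \<in> carrier FF" "u \<noteq> \<zero>\<^bsub>FF\<^esub>" and um: "u [^]\<^bsub>FF\<^esub> m \<in> ring_center FF" for u
  proof (rule D.Units_of_pow[OF _ m])
    interpret h: ring_hom_ring FF F.fractions F.embed
      by (rule ring_hom_ringI2[OF F.PA.ring_axioms F.ring_fractions F.embed_hom])
    show "F.embed u \<in> carrier F.fractions"
      using u by simp
    have "u [^]\<^bsub>FF\<^esub> m \<in> F.denominators"
      using um pow_nonzero[OF u] by (simp add: F.denominators_def)
    then show "F.embed u [^]\<^bsub>F.fractions\<^esub> m \<in> Units F.fractions"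
      using F.embed_unit(1) u(1) by (simp flip: h.hom_nat_pow)
  qed
  show "F.embed (zF i) \<in> Units F.fractions" if "i < N" for i
    using unit F.z_pow_central z_nonzero that by simp
  show "F.embed (OmF j) \<in> Units F.fractions" if "j < N" for j
    using unit F.Om_pow_central Om_nonzero that by simp
  show "k \<in> Units F.fractions" if "k \<in> ring_center F.fractions" "k \<noteq> \<zero>\<^bsub>F.fractions\<^esub>" for k
    using F.center_fractions that .
  fix d assume "d \<in> carrier F.fractions"
  then obtain a s where "a \<in> carrier FF" "s \<in> F.denominators" "d = F.frac a s"
    by (rule F.carrier_fractionsE)
  then show "\<exists>a\<in>carrier FF. \<exists>s\<in>carrier FF. F.embed s \<in> Units F.fractions \<and>
      d = F.embed a \<otimes>\<^bsub>F.fractions\<^esub> inv\<^bsub>F.fractions\<^esub> (F.embed s)"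
    using F.frac_eq_embed F.embed_unit(1) F.den_closed by blast
qed

text \<open>The count gives finite dimension over the center, and a domain of finite dimension over
  a central field is a division ring. This provides the ring whose existence
  \<open>has_degree\<close> demands.\<close>

lemma division_ring_fractions: "division_ring_of_fractions FF F.fractions F.embed"
proof -
  interpret D: quantum_field F.fractions "\<lambda>c. F.embed (F.csc c)" "\<lambda>i. F.embed (zF i)" "\<lambda>i. F.embed (zsF i)"
    "\<lambda>j. F.embed (OmF j)" q N m
    by (rule fractions_quantum_field)
  have "Units F.fractions = carrier F.fractions - {\<zero>\<^bsub>F.fractions\<^esub>}"
    using D.finite_dimension_division_ring[OF D.center_subfield order_refl D.dimension_center
        F.fractions_nontrivial F.fractions_domain] .
  moreover have "\<exists>a\<in>carrier FF. \<exists>s\<in>carrier FF - {\<zero>\<^bsub>FF\<^esub>}. d = F.embed a \<otimes>\<^bsub>F.fractions\<^esub> inv\<^bsub>F.fractions\<^esub> (F.embed s)"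
    if d: "d \<in> carrier F.fractions" for d
  proof -
    obtain a s where "a \<in> carrier FF" "s \<in> F.denominators" "d = F.frac a s"
      by (rule F.carrier_fractionsE[OF d])
    moreover from this have "s \<in> carrier FF - {\<zero>\<^bsub>FF\<^esub>}"
      using F.den_closed unfolding F.denominators_def by blast
    ultimately show ?thesis
      using F.frac_eq_embed by blast
  qed
  ultimately show ?thesis
    unfolding division_ring_of_fractions_def
    using F.ring_fractions F.fractions_nontrivial F.embed_hom F.embed_inj by blast
qed

lemma dimension_over_center:
  assumes "division_ring_of_fractions FF D \<phi>"
  shows "ring.dimension D (m ^ (2 * (N - 1))) (ring_center D) (carrier D)"
proof -
  have D: "ring D" "\<one>\<^bsub>D\<^esub> \<noteq> \<zero>\<^bsub>D\<^esub>" "Units D = carrier D - {\<zero>\<^bsub>D\<^esub>}" "\<phi> \<in> Ring.ring_hom FF D" "inj_on \<phi> (carrier FF)"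
    and frac: "\<And>d. d \<in> carrier D \<Longrightarrow> \<exists>a\<in>carrier FF. \<exists>s\<in>carrier FF - {\<zero>\<^bsub>FF\<^esub>}. d = \<phi> a \<otimes>\<^bsub>D\<^esub> inv\<^bsub>D\<^esub> (\<phi> s)"
    using assms unfolding division_ring_of_fractions_def by blast+
  have unit: "\<phi> u \<in> Units D" if "u \<in> carrier FF" "u \<noteq> \<zero>\<^bsub>FF\<^esub>" for u
  proof -
    have "\<phi> u \<noteq> \<phi> \<zero>\<^bsub>FF\<^esub>"
      using D(5) that F.PA.zero_closed by (metis inj_onD)
    then show ?thesis
      using that ring_hom_closed[OF D(4)] ring_hom_zero[OF D(4) F.PA.ring_axioms D(1)] by (simp add: D(3))
  qed
  have "quantum_field D (\<lambda>c. \<phi> (F.csc c)) (\<lambda>i. \<phi> (zF i)) (\<lambda>i. \<phi> (zsF i)) (\<lambda>j. \<phi> (OmF j)) q N m"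
  proof (rule quantum_field_of_fractions[OF D(1,2,4)])
    show "\<phi> (zF i) \<in> Units D" if "i < N" for i
      using unit that z_nonzero by simp
    show "\<phi> (OmF j) \<in> Units D" if "j < N" for j
      using unit that Om_nonzero by simp
    show "k \<in> Units D" if "k \<in> ring_center D" "k \<noteq> \<zero>\<^bsub>D\<^esub>" for k
      using that by (simp add: D(3) ring_center_iff)
    fix d assume "d \<in> carrier D"
    then show "\<exists>a\<in>carrier FF. \<exists>s\<in>carrier FF. \<phi> s \<in> Units D \<and> d = \<phi> a \<otimes>\<^bsub>D\<^esub> inv\<^bsub>D\<^esub> (\<phi> s)"
      using frac[of d] unit by blast
  qed
  then show ?thesis
    by (rule quantum_field.dimension_center)
qed

lemma F_has_degree: "has_degree (F_algebra q N) (m ^ (N - 1))"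
proof -
  have "(m ^ (N - 1))\<^sup>2 = m ^ (2 * (N - 1))"
    by (simp add: mult.commute flip: power_mult)
  then show ?thesis
    unfolding has_degree_def F_algebra_presented
    using division_ring_fractions dimension_over_center by auto
qed

end

text \<open>The first conjunct keeps the equality of the two sets from holding vacuously. In the
  last one m = 1 is included; it means q = 1, and the degree is 1.\<close>

theorem lemma5p3:
  fixes N :: nat
  assumes "N \<ge> 1"
  shows "nonzero_blocks (Fbar_matrix N) \<noteq> {} \<and>
         nonzero_blocks (Fbar_matrix N) = nonzero_blocks (L_matrix N) \<and>
         (\<forall>(q :: complex) (m :: nat).
            odd m \<and> q ^ m = 1 \<and> (\<forall>k. 0 < k \<and> k < m \<longrightarrow> q ^ k \<noteq> 1) \<longrightarrow>
            has_degree (F_algebra q N) (m ^ (N - 1)))"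
proof (intro conjI allI impI)
  show "nonzero_blocks (Fbar_matrix N) \<noteq> {}" "nonzero_blocks (Fbar_matrix N) = nonzero_blocks (L_matrix N)"
    using nonzero_blocks_Fbar_L[OF assms] by simp_all
next
  fix q :: complex and m :: nat
  assume "odd m \<and> q ^ m = 1 \<and> (\<forall>k. 0 < k \<and> k < m \<longrightarrow> q ^ k \<noteq> 1)"
  then interpret F_at_root_of_unity q N m
    using assms by unfold_locales auto
  show "has_degree (F_algebra q N) (m ^ (N - 1))"
    by (rule F_has_degree)
qed

end
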